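(* Let $R(z)\in\mathbb{C}(z)^{m\times m}$ be a para-Hermitian (resp., para-skew-Hermitian) rational matrix having no poles on the unit circle. Write (uniquely) $$R(z)=R_{in}(z)+R_{out}(z)+R_0,$$ where $R_{in}(z)$ is strictly proper with all its poles in the open unit disk, $R_{out}(z)$ satisfies $R_{out}(0)=0$ and has all its poles (infinity included) strictly outside the unit circle, and $R_0$ is constant, so that $R_{in}^*(z)=R_{out}(1/z)$ and $R_0^*=R_0$ (resp., $R_{in}^*(z)=-R_{out}(1/z)$ and $R_0^*=-R_0$). Let $$R_{in}(z)=B(zA_1-A_0)^{-1}C$$ be a minimal generalized state-space realization of $R_{in}(z)$ with $A_1$ invertible. Then $$R_{out}(z)=zC^*(A_1^*-zA_0^* )^{-1}B^*\qquad(\text{resp., } R_{out}(z)=zC^*(zA_0^*-A_1^* )^{-1}B^* )$$ is a minimal generalized state-space realization of $R_{out}(z)$, and the following pencil $L(z)$ is a strongly minimal $*$-palindromic (resp., strongly minimal $*$-anti-palindromic) linearization of $(1+z)R(z)$: $$L(z)=\left[\begin{array}{cc|c}0&A_0-zA_1&C\\ zA_0^*-A_1^*&0&B^*(1+z)\\ \hline zC^*&B(1+z)&R_0(1+z)\end{array}\right]$$ $$\left(\text{resp., } L(z)=\left[\begin{array}{cc|c}0&A_0-zA_1&C\\ A_1^*-zA_0^*&0&-B^*(1+z)\\ \hline -zC^*&B(1+z)&R_0(1+z)\end{array}\right]\right).$$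
   Context: For a rational matrix $R(t)$ with complex coefficients, $R^*(t):=[R(\overline{t})]^*$ (the coefficients are conjugate-transposed, the variable is not conjugated). A square rational matrix $R(z)$ is para-Hermitian if $R^*(z)=R(1/z)$, and para-skew-Hermitian if $R^*(z)=-R(1/z)$. For constant matrices $^*$ is the conjugate transpose. Strictly proper means tending to $0$ as $z\to\infty$. A pencil is a polynomial matrix of the form $L(z)=zL_1+L_0$. With $\mathrm{rev}_1 H(z):=zH(1/z)$, a square pencil $L(z)$ is $*$-palindromic if $\mathrm{rev}_1L^*(z)=L(z)$ and $*$-anti-palindromic if $\mathrm{rev}_1L^*(z)=-L(z)$. A linear system matrix is a block-partitioned complex pencil $$L(z)=\begin{bmatrix}-A(z)&B(z)\\ C(z)&D(z)\end{bmatrix}=\begin{bmatrix}-zA_1+A_0& zB_1-B_0\\ zC_1-C_0& zD_1-D_0\end{bmatrix}$$ with $A(z)$ a square regular pencil ($\det A(z)\not\equiv0$; possibly of size $0$). Its transfer function is $D(z)+C(z)A(z)^{-1}B(z)$. It is minimal if $\begin{bmatrix}-A(z_0)&B(z_0)\end{bmatrix}$ has full row rank and $\begin{bmatrix}-A(z_0)\\ C(z_0)\end{bmatrix}$ has full column rank for all $z_0\in\mathbb{C}$; minimal at $\infty$ if $\begin{bmatrix}-A_1&B_1\end{bmatrix}$ has full row rank and $\begin{bmatrix}-A_1\\ C_1\end{bmatrix}$ has full column rank; strongly minimal if both hold. A strongly minimal linearization of $H(z)$ is a strongly minimal linear system matrix with transfer function $H(z)$. In the pencils of the claim the partition lines indicate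 the blocks: the top-left block is $-A(z)$. Here $R_{in}(z)=B(zA_1-A_0)^{-1}C$ being a minimal generalized state-space realization means that $A_1,A_0,B,C$ are constant complex matrices of compatible sizes, $zA_1-A_0$ is regular, and the linear system matrix $\begin{bmatrix}-(zA_1-A_0)&C\\ B&0\end{bmatrix}$ is minimal. Likewise, that the displayed expression for $R_{out}(z)$ is a minimal realization means that the equality holds and that the linear system matrix $\begin{bmatrix}-(A_1^*-zA_0^* )&B^*\\ zC^*&0\end{bmatrix}$ (resp., $\begin{bmatrix}-(zA_0^*-A_1^* )&B^*\\ zC^*&0\end{bmatrix}$) is minimal. *)

theory Defs
  imports
    "HOL-Computational_Algebra.Computational_Algebra"
    "HOL-Computational_Algebra.Field_as_Ring"
    "Jordan_Normal_Form.Schur_Decomposition"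
    "Jordan_Normal_Form.DL_Rank"
begin

type_synonym rat_fun = "complex poly fract"

abbreviation zp :: "complex poly" where "zp \<equiv> [:0, 1:]"

definition rf_eval :: "rat_fun \<Rightarrow> complex \<Rightarrow> complex" where
  "rf_eval f z = (case quot_of_fract f of (p, q) \<Rightarrow> poly p z / poly q z)"

text \<open>\<open>quot_of_fract\<close> returns a coprime numerator and denominator.\<close>

definition rf_pole :: "rat_fun \<Rightarrow> complex \<Rightarrow> bool" where
  "rf_pole f z \<longleftrightarrow> poly (snd (quot_of_fract f)) z = 0"

text \<open>Conjugation of the coefficients only: \<open>z \<mapsto> cnj (f (cnj z))\<close>.\<close>

definition rf_cnj :: "rat_fun \<Rightarrow> rat_fun" where
  "rf_cnj f = (case quot_of_fract f of (p, q) \<Rightarrow>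
     to_fract (map_poly cnj p) / to_fract (map_poly cnj q))"

text \<open>The substitution \<open>f(z) \<mapsto> f(1/z)\<close>, carried out in the field of rational functions.\<close>

definition rf_recip :: "rat_fun \<Rightarrow> rat_fun" where
  "rf_recip f = (case quot_of_fract f of (p, q) \<Rightarrow>
     poly (map_poly (\<lambda>c. to_fract [:c:]) p) (1 / to_fract zp) /
     poly (map_poly (\<lambda>c. to_fract [:c:]) q) (1 / to_fract zp))"

definition cmat :: "complex mat \<Rightarrow> complex poly mat" where
  "cmat = map_mat (\<lambda>c. [:c:])"

definition rmat :: "complex poly mat \<Rightarrow> rat_fun mat" where
  "rmat = map_mat to_fract"

definition eval_mat :: "complex \<Rightarrow> complex poly mat \<Rightarrow> complex mat" where
  "eval_mat z = map_mat (\<lambda>p. poly p z)"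

definition coeff_mat :: "nat \<Rightarrow> complex poly mat \<Rightarrow> complex mat" where
  "coeff_mat k = map_mat (\<lambda>p. coeff p k)"

definition rat_star :: "rat_fun mat \<Rightarrow> rat_fun mat" where
  "rat_star R = map_mat rf_cnj (transpose_mat R)"

definition rat_recip :: "rat_fun mat \<Rightarrow> rat_fun mat" where
  "rat_recip = map_mat rf_recip"

definition rat_inv :: "rat_fun mat \<Rightarrow> rat_fun mat" where
  "rat_inv A = the (mat_inverse A)"

definition para_hermitian :: "rat_fun mat \<Rightarrow> bool" where
  "para_hermitian R \<longleftrightarrow> square_mat R \<and> rat_star R = rat_recip R"

definition para_skew_hermitian :: "rat_fun mat \<Rightarrow> bool" where
  "para_skew_hermitian R \<longleftrightarrow> square_mat R \<and> rat_star R = - rat_recip R"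

definition mat_pole :: "rat_fun mat \<Rightarrow> complex \<Rightarrow> bool" where
  "mat_pole R z \<longleftrightarrow> (\<exists>i < dim_row R. \<exists>j < dim_col R. rf_pole (R $$ (i, j)) z)"

definition strictly_proper :: "rat_fun mat \<Rightarrow> bool" where
  "strictly_proper R \<longleftrightarrow> (\<forall>i < dim_row R. \<forall>j < dim_col R.
     (rf_eval (R $$ (i, j)) \<longlongrightarrow> 0) at_infinity)"

text \<open>In the following decomposition a pole of \<open>Rin\<close> at infinity is excluded by strict
  properness, while \<open>Rout\<close> may have one, infinity being outside the unit circle.  As \<open>Rout\<close> has
  no pole at the origin, \<open>rf_eval\<close> computes its true value there.\<close>

definition in_out_decomposition ::
  "rat_fun mat \<Rightarrow> rat_fun mat \<Rightarrow> rat_fun mat \<Rightarrow> complex mat \<Rightarrow> bool" where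
  "in_out_decomposition R Rin Rout R0 \<longleftrightarrow>
     Rin \<in> carrier_mat (dim_row R) (dim_col R) \<and>
     Rout \<in> carrier_mat (dim_row R) (dim_col R) \<and>
     R0 \<in> carrier_mat (dim_row R) (dim_col R) \<and>
     R = Rin + Rout + rmat (cmat R0) \<and>
     strictly_proper Rin \<and> (\<forall>z. mat_pole Rin z \<longrightarrow> cmod z < 1) \<and>
     map_mat (\<lambda>f. rf_eval f 0) Rout = 0\<^sub>m (dim_row R) (dim_col R) \<and>
     (\<forall>z. mat_pole Rout z \<longrightarrow> 1 < cmod z)"

definition pencil :: "complex poly mat \<Rightarrow> bool" where
  "pencil L \<longleftrightarrow> (\<forall>i < dim_row L. \<forall>j < dim_col L. degree (L $$ (i, j)) \<le> 1)"

definition rev1 :: "rat_fun mat \<Rightarrow> rat_fun mat" where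
  "rev1 H = to_fract zp \<cdot>\<^sub>m rat_recip H"

definition star_palindromic :: "complex poly mat \<Rightarrow> bool" where
  "star_palindromic L \<longleftrightarrow> pencil L \<and> square_mat L \<and> rev1 (rat_star (rmat L)) = rmat L"

definition star_anti_palindromic :: "complex poly mat \<Rightarrow> bool" where
  "star_anti_palindromic L \<longleftrightarrow> pencil L \<and> square_mat L \<and> rev1 (rat_star (rmat L)) = - rmat L"

definition hcat :: "'a :: zero mat \<Rightarrow> 'a mat \<Rightarrow> 'a mat" where
  "hcat X Y = four_block_mat X Y (0\<^sub>m 0 (dim_col X)) (0\<^sub>m 0 (dim_col Y))"

definition full_row_rank :: "complex mat \<Rightarrow> bool" where
  "full_row_rank M \<longleftrightarrow> vec_space.rank (dim_row M) M = dim_row M"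

definition full_col_rank :: "complex mat \<Rightarrow> bool" where
  "full_col_rank M \<longleftrightarrow> vec_space.rank (dim_row M) M = dim_col M"

text \<open>A matrix together with a 2-by-2 partition.  For a linear system matrix the block \<open>b11\<close>
  is \<open>-A(z)\<close>, with the sign included.\<close>

datatype 'a blocks = Blocks (b11: "'a mat") (b12: "'a mat") (b21: "'a mat") (b22: "'a mat")

definition full_mat :: "'a blocks \<Rightarrow> 'a mat" where
  "full_mat S = four_block_mat (b11 S) (b12 S) (b21 S) (b22 S)"

definition linear_system_matrix :: "complex poly blocks \<Rightarrow> bool" where
  "linear_system_matrix S \<longleftrightarrow>
     square_mat (b11 S) \<and>
     dim_row (b12 S) = dim_row (b11 S) \<and> dim_col (b21 S) = dim_col (b11 S) \<and>
     dim_row (b22 S) = dim_row (b21 S) \<and> dim_col (b22 S) = dim_col (b12 S) \<and>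
     pencil (b11 S) \<and> pencil (b12 S) \<and> pencil (b21 S) \<and> pencil (b22 S) \<and>
     det (- b11 S) \<noteq> 0"

definition transfer_function :: "complex poly blocks \<Rightarrow> rat_fun mat" where
  "transfer_function S =
     rmat (b22 S) + rmat (b21 S) * rat_inv (rmat (- b11 S)) * rmat (b12 S)"

definition minimal_system :: "complex poly blocks \<Rightarrow> bool" where
  "minimal_system S \<longleftrightarrow> (\<forall>z.
     full_row_rank (hcat (eval_mat z (b11 S)) (eval_mat z (b12 S))) \<and>
     full_col_rank (eval_mat z (b11 S) @\<^sub>r eval_mat z (b21 S)))"

definition minimal_at_infinity :: "complex poly blocks \<Rightarrow> bool" where
  "minimal_at_infinity S \<longleftrightarrow>
     full_row_rank (hcat (coeff_mat 1 (b11 S)) (coeff_mat 1 (b12 S))) \<and>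
     full_col_rank (coeff_mat 1 (b11 S) @\<^sub>r coeff_mat 1 (b21 S))"

definition strongly_minimal_linearization :: "complex poly blocks \<Rightarrow> rat_fun mat \<Rightarrow> bool" where
  "strongly_minimal_linearization S H \<longleftrightarrow>
     linear_system_matrix S \<and> minimal_system S \<and> minimal_at_infinity S \<and>
     transfer_function S = H"

text \<open>The factors may depend on \<open>z\<close>, as \<open>z C\<^sup>*\<close> does in the realization of \<open>Rout\<close>.  Minimality
  is required at the finite points only.\<close>

definition minimal_realization ::
  "complex poly mat \<Rightarrow> complex poly mat \<Rightarrow> complex poly mat \<Rightarrow> rat_fun mat \<Rightarrow> bool" where
  "minimal_realization F P G R \<longleftrightarrow>
     R = rmat F * rat_inv (rmat P) * rmat G \<and>
     (let S = Blocks (- P) G F (0\<^sub>m (dim_row F) (dim_col G))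
      in linear_system_matrix S \<and> minimal_system S)"

definition palindromic_pencil ::
  "complex mat \<Rightarrow> complex mat \<Rightarrow> complex mat \<Rightarrow> complex mat \<Rightarrow> complex mat \<Rightarrow> complex poly blocks"
  where
  "palindromic_pencil A1 A0 B C R0 = Blocks
     (four_block_mat
        (0\<^sub>m (dim_row A1) (dim_row A1))                      (cmat A0 - zp \<cdot>\<^sub>m cmat A1)
        (zp \<cdot>\<^sub>m cmat (mat_adjoint A0) - cmat (mat_adjoint A1)) (0\<^sub>m (dim_row A1) (dim_row A1)))
     (cmat C @\<^sub>r (1 + zp) \<cdot>\<^sub>m cmat (mat_adjoint B))
     (hcat (zp \<cdot>\<^sub>m cmat (mat_adjoint C)) ((1 + zp) \<cdot>\<^sub>m cmat B))
     ((1 + zp) \<cdot>\<^sub>m cmat R0)"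

definition anti_palindromic_pencil ::
  "complex mat \<Rightarrow> complex mat \<Rightarrow> complex mat \<Rightarrow> complex mat \<Rightarrow> complex mat \<Rightarrow> complex poly blocks"
  where
  "anti_palindromic_pencil A1 A0 B C R0 = Blocks
     (four_block_mat
        (0\<^sub>m (dim_row A1) (dim_row A1))                      (cmat A0 - zp \<cdot>\<^sub>m cmat A1)
        (cmat (mat_adjoint A1) - zp \<cdot>\<^sub>m cmat (mat_adjoint A0)) (0\<^sub>m (dim_row A1) (dim_row A1)))
     (cmat C @\<^sub>r - ((1 + zp) \<cdot>\<^sub>m cmat (mat_adjoint B)))
     (hcat (- (zp \<cdot>\<^sub>m cmat (mat_adjoint C))) ((1 + zp) \<cdot>\<^sub>m cmat B))
     ((1 + zp) \<cdot>\<^sub>m cmat R0)"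

end

theory Submission
  imports Defs
begin

text \<open>Let \<open>\<sigma> f\<close> be the rational function \<open>z \<mapsto> cnj (f (1 / cnj z))\<close>.  Reflection in the unit circle
  exchanges functions that vanish at infinity and have all poles inside the disk with functions
  that vanish at the origin and have all poles outside, so uniqueness of the splitting (an entire
  rational function vanishing at infinity is zero) forces \<open>\<sigma>\<close>, combined with transposition, to
  exchange \<open>Rin\<close> and \<open>Rout\<close> up to the sign \<open>e = \<plusminus>1\<close> of the symmetry.  Reflecting a
  realization of \<open>Rin\<close> therefore yields the one of \<open>Rout\<close>.

  Both cases are handled at once, with \<open>e\<close> as a parameter.  Minimality rests on one fact: the pencil
  \<open>K z = z A\<^sub>1 - A\<^sub>0\<close> of a minimal realization is singular only at poles of \<open>Rin\<close>, hence only inside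
  the disk, while \<open>H z = z A\<^sub>0\<^sup>* - A\<^sub>1\<^sup>*\<close> is singular only outside.  So at every \<open>z\<close> at least one of the two
  is invertible and the rank conditions of the large pencil reduce to those of the small one; at
  \<open>z = -1\<close>, where the factors \<open>1 + z\<close> vanish, both are invertible.\<close>

section \<open>Rational functions\<close>

text \<open>The factor 1 + z is its own reversal, z (1 + 1/z) = 1 + z, so it turns the symmetry of
  \<open>R\<close> under z -> 1/z into a symmetry under \<open>rev1\<close>. It is carried by the
  blocks built from \<open>B\<close>, while \<open>C\<close> and its reversal stay bare; each of the
  two products that give \<open>Rin\<close> and \<open>Rout\<close> then contains the factor exactly
  once. Invertibility of \<open>A1\<close> acts at z = 0 and at infinity: H 0 is minus the adjoint
  of \<open>A1\<close>, and \<open>A1\<close> is the leading coefficient of K. The leading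
  coefficient of H is the adjoint of \<open>A0\<close>, and K 0 = - \<open>A0\<close>, so minimality
  at infinity falls back on minimality at 0. Ranks are treated as trivial kernels, row rank through
  the adjoint. A formal obstacle shapes the scalar part: rational functions are elements of a
  fraction field and \<open>rf_eval\<close> returns 0 at a pole. Evaluation laws therefore carry
  regularity hypotheses, and the reflection is built algebraically, as a field endomorphism, before
  anything is evaluated.\<close>

abbreviation rconst :: "complex \<Rightarrow> rat_fun" where "rconst c \<equiv> to_fract [:c:]"

lemma rconst_add: "rconst (a + b) = rconst a + rconst b"
  by (subst to_fract_add[symmetric]) simp

lemma rconst_mult: "rconst (a * b) = rconst a * rconst b"
  by (subst to_fract_mult[symmetric]) simp

lemma rconst_1: "rconst 1 = 1"
proof -
  have "[:1:] = (1 :: complex poly)" by (simp only: one_pCons)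
  thus ?thesis by (simp only: to_fract_1)
qed

lemma rconst_uminus: "rconst (- a) = - rconst a"
  by (subst to_fract_uminus[symmetric]) simp

lemma rat_fun_quot: "to_fract (fst (quot_of_fract f)) / to_fract (snd (quot_of_fract f)) = f"
  by (metis Fract_conv_to_fract Fract_quot_of_fract)

lemma rat_fun_cases:
  fixes f :: rat_fun
  obtains p q where "f = to_fract p / to_fract q" "q \<noteq> 0" "coprime p q" "quot_of_fract f = (p, q)"
  using that[of "fst (quot_of_fract f)" "snd (quot_of_fract f)"] rat_fun_quot[of f]
    coprime_quot_of_fract[of f] by simp

text \<open>\<open>quot_of_fract\<close> may return another pair than the one written down; cross
  multiplication is how an arbitrary fraction is compared with the reduced one.\<close>

lemma quot_cross_mult:
  fixes p q :: "complex poly"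
  assumes "q \<noteq> 0" "quot_of_fract (to_fract p / to_fract q) = (p', q')"
  shows "p * q' = p' * q" "q' \<noteq> 0"
proof -
  obtain p1 q1 where 1: "to_fract p / to_fract q = to_fract p1 / to_fract q1" "q1 \<noteq> 0"
    "quot_of_fract (to_fract p / to_fract q) = (p1, q1)"
    by (metis rat_fun_cases)
  with assms(2) have eq: "p1 = p'" "q1 = q'" by auto
  have "to_fract (p * q1) = to_fract (p1 * q)"
    using 1(1,2) assms(1) by (simp add: field_simps)
  thus "p * q' = p' * q" "q' \<noteq> 0" using eq 1(2) by (simp_all only: to_fract_eq_iff) auto
qed

text \<open>Being coprime to its numerator, the reduced denominator divides every other denominator.
  So any representation with a nonvanishing denominator certifies regularity, without reducing the
  fraction.\<close>

lemma no_rf_pole_iff: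
  "\<not> rf_pole f z \<longleftrightarrow> (\<exists>p q. f = to_fract p / to_fract q \<and> poly q z \<noteq> 0)"
proof
  assume "\<not> rf_pole f z"
  thus "\<exists>p q. f = to_fract p / to_fract q \<and> poly q z \<noteq> 0"
    unfolding rf_pole_def by (metis rat_fun_quot)
next
  assume "\<exists>p q. f = to_fract p / to_fract q \<and> poly q z \<noteq> 0"
  then obtain p q where f: "f = to_fract p / to_fract q" and q: "poly q z \<noteq> 0" by auto
  obtain p' q' where pq': "coprime p' q'" "quot_of_fract f = (p', q')" by (metis rat_fun_cases)
  have "q \<noteq> 0" using q by auto
  from quot_cross_mult(1)[OF this pq'(2)[unfolded f]] have "q' dvd p' * q" by (metis dvd_triv_right)
  hence "q' dvd q" using pq'(1) by (metis coprime_commute coprime_dvd_mult_right_iff)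
  thus "\<not> rf_pole f z" using q pq'(2) unfolding rf_pole_def by (auto elim: dvdE)
qed

lemma no_rf_poleI: "f = to_fract p / to_fract q \<Longrightarrow> poly q z \<noteq> 0 \<Longrightarrow> \<not> rf_pole f z"
  by (auto simp: no_rf_pole_iff)

lemma no_rf_poleE:
  assumes "\<not> rf_pole f z"
  obtains p q where "f = to_fract p / to_fract q" "poly q z \<noteq> 0" "q \<noteq> 0"
  using assms unfolding no_rf_pole_iff by (metis poly_0)

lemma rf_eval_quot:
  assumes "poly q z \<noteq> 0"
  shows "rf_eval (to_fract p / to_fract q) z = poly p z / poly q z"
proof -
  obtain p' q' where pq': "quot_of_fract (to_fract p / to_fract q) = (p', q')" by fastforce
  have q: "q \<noteq> 0" using assms by auto
  have "poly q' z \<noteq> 0"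
    using no_rf_poleI[OF refl assms, of p] pq' unfolding rf_pole_def by simp
  moreover have "poly p z * poly q' z = poly p' z * poly q z"
    using arg_cong[OF quot_cross_mult(1)[OF q pq'], of "\<lambda>p. poly p z"] by simp
  ultimately show ?thesis using assms pq' unfolding rf_eval_def by (simp add: field_simps)
qed

lemma no_rf_pole_to_fract [simp]: "\<not> rf_pole (to_fract p) z"
  by (rule no_rf_poleI[of _ p 1]) auto

lemma no_rf_pole_0 [simp]: "\<not> rf_pole 0 z"
  using no_rf_pole_to_fract[of 0 z] by simp

lemma rf_eval_to_fract [simp]: "rf_eval (to_fract p) z = poly p z"
  using rf_eval_quot[of 1 z p] by simp

text \<open>Regularity matters for evaluation: at 0 the product of 1/z and z is 1, while
  \<open>rf_eval\<close> gives 0 for both factors, the first one by division by zero.\<close>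

lemma
  assumes "\<not> rf_pole f z" "\<not> rf_pole g z"
  shows no_rf_pole_add: "\<not> rf_pole (f + g) z"
    and rf_eval_add: "rf_eval (f + g) z = rf_eval f z + rf_eval g z"
    and no_rf_pole_mult: "\<not> rf_pole (f * g) z"
    and rf_eval_mult: "rf_eval (f * g) z = rf_eval f z * rf_eval g z"
proof -
  from assms obtain p q p' q' where f: "f = to_fract p / to_fract q" "poly q z \<noteq> 0" "q \<noteq> 0"
    and g: "g = to_fract p' / to_fract q'" "poly q' z \<noteq> 0" "q' \<noteq> 0"
    by (metis no_rf_poleE)
  have 1: "f + g = to_fract (p * q' + p' * q) / to_fract (q * q')"
    using f g by (simp add: add_frac_eq)
  have 2: "f * g = to_fract (p * p') / to_fract (q * q')"
    using f g by simp
  have q: "poly (q * q') z \<noteq> 0" using f g by simp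
  show "\<not> rf_pole (f + g) z" "\<not> rf_pole (f * g) z"
    using no_rf_poleI[OF 1 q] no_rf_poleI[OF 2 q] by auto
  show "rf_eval (f + g) z = rf_eval f z + rf_eval g z"
    unfolding 1 rf_eval_quot[OF q] using f g by (simp add: rf_eval_quot add_frac_eq)
  show "rf_eval (f * g) z = rf_eval f z * rf_eval g z"
    unfolding 2 rf_eval_quot[OF q] using f g by (simp add: rf_eval_quot)
qed

lemma
  assumes "\<not> rf_pole f z"
  shows no_rf_pole_uminus: "\<not> rf_pole (- f) z"
    and rf_eval_uminus: "rf_eval (- f) z = - rf_eval f z"
proof -
  have 1: "- f = rconst (- 1) * f" by (simp only: rconst_uminus rconst_1) simp
  show "\<not> rf_pole (- f) z" "rf_eval (- f) z = - rf_eval f z"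
    unfolding 1 using no_rf_pole_mult[OF no_rf_pole_to_fract assms]
      rf_eval_mult[OF no_rf_pole_to_fract assms] by auto
qed

lemma no_rf_pole_diff: "\<not> rf_pole f z \<Longrightarrow> \<not> rf_pole g z \<Longrightarrow> \<not> rf_pole (f - g) z"
  and rf_eval_diff: "\<not> rf_pole f z \<Longrightarrow> \<not> rf_pole g z \<Longrightarrow>
    rf_eval (f - g) z = rf_eval f z - rf_eval g z"
  using no_rf_pole_add[of f z "- g"] rf_eval_add[of f z "- g"] no_rf_pole_uminus rf_eval_uminus
  by auto

lemma no_rf_pole_sum: "(\<And>i. i \<in> I \<Longrightarrow> \<not> rf_pole (f i) z) \<Longrightarrow> \<not> rf_pole (sum f I) z"
  by (induction I rule: infinite_finite_induct) (simp_all add: no_rf_pole_add)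

lemma no_rf_pole_prod: "(\<And>i. i \<in> I \<Longrightarrow> \<not> rf_pole (f i) z) \<Longrightarrow> \<not> rf_pole (prod f I) z"
  using no_rf_pole_to_fract[of 1]
  by (induction I rule: infinite_finite_induct) (simp_all add: no_rf_pole_mult)

text \<open>By the fundamental theorem of algebra a reduced denominator without roots is
  constant.\<close>

lemma entire_rat_fun_polynomial:
  assumes "\<And>z. \<not> rf_pole f z"
  obtains p where "f = to_fract p"
proof -
  obtain p q where f: "f = to_fract p / to_fract q" "q \<noteq> 0" "quot_of_fract f = (p, q)"
    by (metis rat_fun_cases)
  have "\<And>z. poly q z \<noteq> 0" using assms f unfolding rf_pole_def by auto
  hence "constant (poly q)" using fundamental_theorem_of_algebra by blast
  hence "degree q = 0" using constant_degree by auto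
  then obtain c where q: "q = [:c:]" by (metis degree_eq_zeroE)
  with f have c: "c \<noteq> 0" by auto
  have "f = to_fract (Polynomial.smult (1 / c) p)"
    unfolding f(1) q using c by (simp add: field_simps flip: to_fract_mult)
  thus thesis using that by blast
qed

subsection \<open>Field endomorphisms of the rational functions\<close>

text \<open>The universal property of the fraction field, computed on the reduced pair;
  \<open>ext_quot\<close> shows that any other pair gives the same value. Both
  \<open>rf_recip\<close> and \<open>rf_cnj\<close> are instances.\<close>

definition fract_ext :: "(complex poly \<Rightarrow> rat_fun) \<Rightarrow> rat_fun \<Rightarrow> rat_fun" where
  "fract_ext \<phi> f = (case quot_of_fract f of (p, q) \<Rightarrow> \<phi> p / \<phi> q)"

text \<open>Injectivity, in the form \<open>zero_iff\<close>, keeps the images of denominators away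
  from 0.\<close>

locale poly_embedding =
  fixes \<phi> :: "complex poly \<Rightarrow> rat_fun"
  assumes add: "\<phi> (p + q) = \<phi> p + \<phi> q"
    and mult: "\<phi> (p * q) = \<phi> p * \<phi> q"
    and one: "\<phi> 1 = 1"
    and zero_iff: "\<phi> p = 0 \<longleftrightarrow> p = 0"
begin

lemma ext_quot:
  assumes "q \<noteq> 0"
  shows "fract_ext \<phi> (to_fract p / to_fract q) = \<phi> p / \<phi> q"
proof -
  obtain p' q' where pq': "quot_of_fract (to_fract p / to_fract q) = (p', q')" by fastforce
  note 1 = quot_cross_mult[OF assms pq']
  have "\<phi> p * \<phi> q' = \<phi> p' * \<phi> q" using arg_cong[OF 1(1), of \<phi>] by (simp add: mult)
  thus ?thesis unfolding fract_ext_def pq' using assms 1(2) zero_iff by (simp add: field_simps)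
qed

lemma ext_to_fract: "fract_ext \<phi> (to_fract p) = \<phi> p"
  using ext_quot[of 1 p] by (simp add: one)

lemma ext_hom: "field_hom (fract_ext \<phi>)"
proof
  fix f g :: rat_fun
  obtain p q where f: "f = to_fract p / to_fract q" "q \<noteq> 0" by (metis rat_fun_cases)
  obtain p' q' where g: "g = to_fract p' / to_fract q'" "q' \<noteq> 0" by (metis rat_fun_cases)
  have 1: "f + g = to_fract (p * q' + p' * q) / to_fract (q * q')"
    using f g by (simp add: add_frac_eq)
  have 2: "f * g = to_fract (p * p') / to_fract (q * q')"
    using f g by simp
  have q: "q * q' \<noteq> 0" using f g by simp
  show "fract_ext \<phi> (f + g) = fract_ext \<phi> f + fract_ext \<phi> g"
    unfolding 1 ext_quot[OF q] using f g by (simp add: ext_quot zero_iff add mult add_frac_eq)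
  show "fract_ext \<phi> (f * g) = fract_ext \<phi> f * fract_ext \<phi> g"
    unfolding 2 ext_quot[OF q] using f g by (simp add: ext_quot mult)
qed (use ext_to_fract[of 1] ext_to_fract[of 0] zero_iff one in auto)

end

lemma field_hom_eqI:
  assumes "field_hom F" "field_hom G" "\<And>p. F (to_fract p) = G (to_fract p)"
  shows "F (f :: rat_fun) = G f"
proof -
  interpret F: field_hom F by fact
  interpret G: field_hom G by fact
  obtain p q where f: "f = to_fract p / to_fract q" "q \<noteq> 0" by (metis rat_fun_cases)
  show ?thesis unfolding f by (simp add: divide_inverse F.hom_mult G.hom_mult F.hom_inverse G.hom_inverse assms(3))
qed

lemma field_hom_comp: "field_hom F \<Longrightarrow> field_hom G \<Longrightarrow> field_hom (\<lambda>x. F (G x))"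
  unfolding field_hom_def idom_hom_def comm_ring_hom_def ring_hom_def semiring_hom_def
    comm_monoid_add_hom_def monoid_add_hom_def monoid_mult_hom_def semigroup_mult_hom_def
    semigroup_add_hom_def times_hom_def plus_hom_def zero_hom_def one_hom_def
  by simp

definition recip_poly :: "complex poly \<Rightarrow> rat_fun" where
  "recip_poly p = poly (map_poly (\<lambda>c. to_fract [:c:]) p) (1 / to_fract zp)"

lemma to_fract_zp_neq_0 [simp]: "to_fract zp \<noteq> 0"
  by simp

lemma recip_poly_pCons [simp]:
  "recip_poly (pCons a p) = rconst a + recip_poly p / to_fract zp"
proof (cases "pCons a p = 0")
  case False
  thus ?thesis by (simp add: recip_poly_def map_poly_pCons)
qed (simp add: recip_poly_def)

lemma recip_poly_0 [simp]: "recip_poly 0 = 0"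
  by (simp add: recip_poly_def)

lemma pCons_eq_zp: "pCons a p = [:a:] + zp * p"
  by simp

lemma to_fract_pCons: "to_fract (pCons a p) = rconst a + to_fract zp * to_fract p"
  unfolding pCons_eq_zp[of a p] to_fract_add to_fract_mult ..

lemma to_fract_power: "to_fract (x ^ n) = to_fract x ^ n"
  by (induction n) simp_all

text \<open>Substituting 1/z reverses the coefficients up to a power of z. This yields injectivity
  of the substitution and, since the reversed polynomial has a nonzero value at 0, control of
  fractions at infinity.\<close>

lemma recip_poly_eq_reflect:
  "recip_poly p = to_fract (reflect_poly p) / to_fract zp ^ degree p"
proof (induction p)
  case (pCons a p)
  show ?case
  proof (cases "p = 0")
    case False
    have refl: "reflect_poly (pCons a p) = reflect_poly p + [:a:] * zp ^ Suc (degree p)"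
      using False by (simp add: reflect_poly_pCons' monom_altdef mult.commute)
    have "to_fract (reflect_poly (pCons a p)) =
        to_fract (reflect_poly p) + rconst a * to_fract zp ^ Suc (degree p)"
      unfolding refl to_fract_add to_fract_mult to_fract_power ..
    thus ?thesis using pCons False by (simp add: field_simps)
  qed simp
qed simp

interpretation rconst_poly: map_poly_inj_comm_ring_hom "rconst"
  by unfold_locales (simp_all add: rconst_add rconst_mult rconst_1)

interpretation recip_poly: poly_embedding recip_poly
proof
  show "recip_poly (p + q) = recip_poly p + recip_poly q"
    and "recip_poly (p * q) = recip_poly p * recip_poly q" for p q
    unfolding recip_poly_def by (simp_all add: rconst_poly.hom_add rconst_poly.hom_mult)
  show "recip_poly 1 = 1"
    by (simp add: one_pCons rconst_1)
  show "recip_poly p = 0 \<longleftrightarrow> p = 0" for p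
    unfolding recip_poly_eq_reflect by simp
qed

definition cnj_poly :: "complex poly \<Rightarrow> rat_fun" where
  "cnj_poly p = to_fract (map_poly cnj p)"

interpretation cnj_hom: map_poly_inj_comm_ring_hom cnj
  by unfold_locales simp_all

interpretation cnj_poly: poly_embedding cnj_poly
  by unfold_locales (simp_all add: cnj_poly_def cnj_hom.hom_add cnj_hom.hom_mult)

lemma rf_recip_eq_ext: "rf_recip = fract_ext recip_poly"
  unfolding rf_recip_def fract_ext_def recip_poly_def by blast

lemma rf_cnj_eq_ext: "rf_cnj = fract_ext cnj_poly"
  unfolding rf_cnj_def fract_ext_def cnj_poly_def by blast

lemma rf_recip_to_fract: "rf_recip (to_fract p) = recip_poly p"
  by (simp add: rf_recip_eq_ext recip_poly.ext_to_fract)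

lemma rf_cnj_to_fract: "rf_cnj (to_fract p) = to_fract (map_poly cnj p)"
  by (simp add: rf_cnj_eq_ext cnj_poly.ext_to_fract cnj_poly_def)

interpretation rf_recip: field_hom rf_recip
  unfolding rf_recip_eq_ext by (rule recip_poly.ext_hom)

interpretation rf_cnj: field_hom rf_cnj
  unfolding rf_cnj_eq_ext by (rule cnj_poly.ext_hom)

lemma rf_recip_const [simp]: "rf_recip (rconst c) = rconst c"
  by (simp add: rf_recip_to_fract)

lemma cnj_map_poly_pCons: "map_poly cnj (pCons a p) = pCons (cnj a) (map_poly cnj p)"
  by (intro poly_eqI) (simp add: coeff_map_poly coeff_pCons split: nat.splits)

lemma cnj_map_poly_const: "map_poly cnj [:a:] = [:cnj a:]"
  by (simp add: cnj_map_poly_pCons)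

lemma rf_cnj_const [simp]: "rf_cnj (rconst c) = rconst (cnj c)"
  by (simp add: rf_cnj_to_fract cnj_map_poly_const)

lemma rf_recip_zp [simp]: "rf_recip (to_fract zp) = 1 / to_fract zp"
  by (simp add: rf_recip_to_fract rconst_1)

lemma rf_cnj_zp [simp]: "rf_cnj (to_fract zp) = to_fract zp"
  by (simp add: rf_cnj_to_fract cnj_map_poly_pCons)

text \<open>The constants and z generate the field, so identities between the substitutions need to
  be checked only there.\<close>

lemma field_hom_eqI':
  assumes F: "field_hom F" and G: "field_hom G"
    and const: "\<And>c. F (rconst c) = G (rconst c)" and z: "F (to_fract zp) = G (to_fract zp)"
  shows "F (f :: rat_fun) = G f"
proof (rule field_hom_eqI[OF F G])
  interpret F: field_hom F by fact
  interpret G: field_hom G by fact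
  show "F (to_fract p) = G (to_fract p)" for p
  proof (induction p)
    case (pCons a p)
    thus ?case using const z
      unfolding to_fract_pCons[of a p] by (simp only: F.hom_add G.hom_add F.hom_mult G.hom_mult)
  qed simp
qed

lemma field_hom_id: "field_hom (\<lambda>x. x)"
  by standard auto

lemma rf_recip_inverse_zp [simp]: "rf_recip (1 / to_fract zp) = to_fract zp"
  by (simp only: rf_recip.hom_div rf_recip.hom_one rf_recip_zp) simp

lemma rf_cnj_inverse_zp [simp]: "rf_cnj (1 / to_fract zp) = 1 / to_fract zp"
  by (simp only: rf_cnj.hom_div rf_cnj.hom_one rf_cnj_zp)

lemma rf_recip_recip [simp]: "rf_recip (rf_recip f) = f"
  by (rule field_hom_eqI'[OF field_hom_comp field_hom_id])
    (simp_all only: rf_recip.field_hom_axioms rf_recip_const rf_recip_zp rf_recip_inverse_zp)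

lemma rf_recip_cnj: "rf_recip (rf_cnj f) = rf_cnj (rf_recip f)"
  by (rule field_hom_eqI'[OF field_hom_comp field_hom_comp])
    (simp_all only: rf_cnj.field_hom_axioms rf_recip.field_hom_axioms rf_recip_const rf_cnj_const
      rf_recip_zp rf_cnj_zp rf_cnj_inverse_zp)

lemma
  assumes "\<not> rf_pole f (cnj z)"
  shows no_rf_pole_cnj: "\<not> rf_pole (rf_cnj f) z"
    and rf_eval_cnj: "rf_eval (rf_cnj f) z = cnj (rf_eval f (cnj z))"
proof -
  obtain p q where f: "f = to_fract p / to_fract q" "poly q (cnj z) \<noteq> 0" "q \<noteq> 0"
    using assms by (rule no_rf_poleE)
  have poly: "poly (map_poly cnj r) z = cnj (poly r (cnj z))" for r
    by (induction r) (simp_all add: cnj_map_poly_pCons)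
  have 1: "rf_cnj f = to_fract (map_poly cnj p) / to_fract (map_poly cnj q)"
    unfolding f by (simp only: rf_cnj.hom_div rf_cnj_to_fract)
  have 2: "poly (map_poly cnj q) z \<noteq> 0" using f poly by simp
  show "\<not> rf_pole (rf_cnj f) z" using 1 2 by (rule no_rf_poleI)
  show "rf_eval (rf_cnj f) z = cnj (rf_eval f (cnj z))"
    using f unfolding 1 rf_eval_quot[OF 2] by (simp add: rf_eval_quot poly)
qed

text \<open>At z = 0 the convention 1 / 0 = 0 would test the origin where infinity is meant; that
  point is treated by \<open>rf_strictly_proper_iff\<close>.\<close>

lemma
  assumes "\<not> rf_pole f (1 / z)" "z \<noteq> 0"
  shows no_rf_pole_recip: "\<not> rf_pole (rf_recip f) z"
    and rf_eval_recip: "rf_eval (rf_recip f) z = rf_eval f (1 / z)"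
proof -
  obtain p q where f: "f = to_fract p / to_fract q" "poly q (1 / z) \<noteq> 0" "q \<noteq> 0"
    using assms(1) by (rule no_rf_poleE)
  have r: "\<not> rf_pole (recip_poly r) z \<and> rf_eval (recip_poly r) z = poly r (1 / z)" for r
  proof -
    have zp: "\<not> rf_pole (1 / to_fract zp) z"
      using no_rf_poleI[of "1 / to_fract zp" 1 zp z] assms by simp
    show ?thesis
    proof (induction r)
      case (pCons a r)
      have *: "recip_poly (pCons a r) = rconst a + recip_poly r * (1 / to_fract zp)" by simp
      have ev: "rf_eval (1 / to_fract zp) z = 1 / z"
        using rf_eval_quot[of zp z 1] assms by simp
      have r: "\<not> rf_pole (recip_poly r) z" "rf_eval (recip_poly r) z = poly r (1 / z)"
        using pCons by auto
      note 1 = no_rf_pole_mult[OF r(1) zp] no_rf_pole_to_fract[of "[:a:]" z]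
      show ?case unfolding * rf_eval_add[OF 1(2,1)] rf_eval_mult[OF r(1) zp]
        using no_rf_pole_add[OF 1(2,1)] r ev by simp
    qed (use rf_eval_to_fract[of 0 z] in simp)
  qed
  \<comment> \<open>The denominator \<open>recip_poly q\<close> is itself a rational function, so
    \<open>no_rf_poleI\<close> does not apply to the quotient; regularity of the reciprocal comes
    from the nonzero value of the denominator at z.\<close>
  have inv: "\<not> rf_pole (inverse g) z \<and> rf_eval (inverse g) z = inverse (rf_eval g z)"
    if g: "\<not> rf_pole g z" and g0: "rf_eval g z \<noteq> 0" for g
  proof -
    obtain p q where 1: "g = to_fract p / to_fract q" "poly q z \<noteq> 0" using g
      by (rule no_rf_poleE)
    hence "poly p z \<noteq> 0" using g0 rf_eval_quot[of q z p] by simp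
    moreover have 2: "inverse g = to_fract q / to_fract p" using 1 by simp
    ultimately show ?thesis using 1 no_rf_poleI[OF 2] unfolding 2 by (simp add: rf_eval_quot)
  qed
  have i: "\<not> rf_pole (inverse (recip_poly q)) z"
    "rf_eval (inverse (recip_poly q)) z = inverse (poly q (1 / z))"
    using inv[of "recip_poly q"] r[of q] f(2) by simp_all
  have 1: "rf_recip f = recip_poly p * inverse (recip_poly q)"
    unfolding f by (simp only: divide_inverse rf_recip.hom_mult rf_recip.hom_inverse rf_recip_to_fract)
  show "\<not> rf_pole (rf_recip f) z"
    unfolding 1 using r i by (intro no_rf_pole_mult) auto
  have "rf_eval (rf_recip f) z = poly p (1 / z) * inverse (poly q (1 / z))"
    unfolding 1 using r i by (subst rf_eval_mult) auto
  thus "rf_eval (rf_recip f) z = rf_eval f (1 / z)"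
    unfolding f(1) rf_eval_quot[OF f(2)] by (simp only: divide_inverse)
qed

section \<open>The inner and outer parts of a scalar rational function\<close>

abbreviation rf_strictly_proper :: "rat_fun \<Rightarrow> bool" where
  "rf_strictly_proper f \<equiv> (rf_eval f \<longlongrightarrow> 0) at_infinity"

lemma poly_tendsto_0_at_infinity:
  fixes p :: "complex poly"
  assumes "(poly p \<longlongrightarrow> 0) at_infinity"
  shows "p = 0"
proof -
  obtain a p' where p: "p = pCons a p'" by (cases p)
  \<comment> \<open>A positive lower bound near infinity contradicts the limit. Growth supplies it
    when \<open>p'\<close> is nonzero, and the modulus of \<open>a\<close> when \<open>p\<close> is
    constant.\<close>
  have no: False if e: "0 < e" and r: "\<forall>z. r \<le> cmod z \<longrightarrow> e \<le> cmod (poly p z)" for e r :: real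
  proof -
    have "\<forall>\<^sub>F z in at_infinity. cmod (poly p z) < e"
      using tendstoD[OF assms e] by (simp only: dist_norm diff_0_right)
    then obtain b where b: "\<forall>z. b \<le> cmod z \<longrightarrow> cmod (poly p z) < e"
      unfolding eventually_at_infinity by (rule exE)
    define w :: complex where "w = of_real (\<bar>r\<bar> + \<bar>b\<bar>)"
    have "cmod w = \<bar>r\<bar> + \<bar>b\<bar>" unfolding w_def norm_of_real by simp
    thus False using spec[OF r, of w] spec[OF b, of w] by linarith
  qed
  have "p' = 0"
  proof (rule ccontr)
    assume "p' \<noteq> 0"
    from poly_infinity[OF this, of 1 a] obtain r where "\<forall>z. r \<le> cmod z \<longrightarrow> 1 \<le> cmod (poly p z)"
      unfolding p by (rule exE)
    thus False using no[of 1 r] by simp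
  qed
  moreover have "a = 0"
  proof (rule ccontr)
    assume "a \<noteq> 0"
    moreover have "poly p z = a" for z using \<open>p' = 0\<close> by (simp only: p poly_pCons poly_0 mult_zero_right add_0_right)
    ultimately show False using no[of "cmod a" 0] by (simp only: zero_less_norm_iff) simp
  qed
  ultimately show ?thesis by (simp add: p)
qed

lemma eventually_poly_nonzero_at_infinity:
  fixes q :: "complex poly"
  assumes "q \<noteq> 0"
  shows "\<forall>\<^sub>F z in at_infinity. poly q z \<noteq> 0"
proof -
  \<comment> \<open>The sum of the moduli of the finitely many roots bounds each of them.\<close>
  define b where "b = (\<Sum>z | poly q z = 0. cmod z)"
  have "cmod z \<le> b" if "poly q z = 0" for z
    unfolding b_def using that poly_roots_finite[OF assms] by (intro member_le_sum) auto
  hence "\<forall>z. b + 1 \<le> cmod z \<longrightarrow> poly q z \<noteq> 0" by force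
  thus ?thesis unfolding eventually_at_infinity by blast
qed

lemma rf_strictly_properI:
  assumes "f = to_fract p / to_fract q" "degree p < degree q"
  shows "rf_strictly_proper f"
proof -
  have "q \<noteq> 0" using assms by auto
  from eventually_poly_nonzero_at_infinity[OF this]
  have "\<forall>\<^sub>F z in at_infinity. poly p z / poly q z = rf_eval f z"
    by eventually_elim (unfold assms(1), subst rf_eval_quot, simp_all)
  thus ?thesis by (rule Lim_transform_eventually[OF poly_divide_tendsto_0_at_infinity[OF assms(2)]])
qed

text \<open>Behaviour at infinity becomes behaviour of the substituted function at the origin. In
  this form strict properness is the mirror image of the condition on the outer part, and
  differences and multiples inherit it through the evaluation laws at a point.\<close>

lemma rf_strictly_proper_iff:
  "rf_strictly_proper f \<longleftrightarrow> \<not> rf_pole (rf_recip f) 0 \<and> rf_eval (rf_recip f) 0 = 0"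
proof safe
  obtain p q where f: "f = to_fract p / to_fract q" "q \<noteq> 0" by (metis rat_fun_cases)
  assume sp: "rf_strictly_proper f"
  \<comment> \<open>Removing the proper fraction r / q leaves the polynomial s, which tends to 0 and
    hence vanishes; what remains is the degree inequality.\<close>
  define s r where "s = p div q" and "r = p mod q"
  have p: "p = q * s + r" by (simp add: s_def r_def)
  have r: "r = 0 \<or> degree r < degree q" using degree_mod_less[OF f(2)] by (simp add: r_def)
  have "((\<lambda>z. poly r z / poly q z) \<longlongrightarrow> 0) at_infinity"
    using r poly_divide_tendsto_0_at_infinity by auto
  from tendsto_diff[OF sp this]
  have "((\<lambda>z. rf_eval f z - poly r z / poly q z) \<longlongrightarrow> 0) at_infinity" by simp
  moreover have "\<forall>\<^sub>F z in at_infinity. rf_eval f z - poly r z / poly q z = poly s z"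
    using eventually_poly_nonzero_at_infinity[OF f(2)]
  proof eventually_elim
    case (elim z)
    have "poly p z = poly q z * poly s z + poly r z" by (subst p) simp
    thus ?case unfolding f(1) rf_eval_quot[OF elim] using elim by (simp add: add_divide_distrib)
  qed
  ultimately have "(poly s \<longlongrightarrow> 0) at_infinity" by (rule Lim_transform_eventually)
  hence "s = 0" by (rule poly_tendsto_0_at_infinity)
  hence deg: "p = 0 \<or> degree p < degree q" using p r by simp
  have "\<not> rf_pole (rf_recip f) 0 \<and> rf_eval (rf_recip f) 0 = 0"
  proof (cases "p = 0")
    case True
    thus ?thesis using f rf_eval_to_fract[of 0 0] by simp
  next
    case False
    define n where "n = degree q - degree p"
    have n: "degree q = degree p + n" "n > 0" using False deg by (auto simp: n_def)
    have "rf_recip f = recip_poly p / recip_poly q"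
      unfolding f by (simp only: rf_recip.hom_div rf_recip_to_fract)
    \<comment> \<open>The degree deficit n survives as a power of z in the numerator, which makes
      the value at 0 vanish.\<close>
    also have "\<dots> = to_fract (reflect_poly p * zp ^ n) / to_fract (reflect_poly q)"
      unfolding recip_poly_eq_reflect n(1)
      by (simp add: power_add to_fract_power field_simps del: to_fract_eq_0_iff)
    finally have 1: "rf_recip f = \<dots>" .
    have 2: "poly (reflect_poly q) 0 \<noteq> 0" using f by simp
    have "poly (reflect_poly p * zp ^ n) 0 = 0" using n(2) by simp
    thus ?thesis using no_rf_poleI[OF 1 2] unfolding 1 rf_eval_quot[OF 2] by auto
  qed
  thus "rf_pole (rf_recip f) 0 \<Longrightarrow> False" "rf_eval (rf_recip f) 0 = 0" by auto
next
  define g where "g = rf_recip f"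
  assume g0: "rf_eval (rf_recip f) 0 = 0" and "\<not> rf_pole (rf_recip f) 0"
  then obtain p q where g: "g = to_fract p / to_fract q" "poly q 0 \<noteq> 0"
    unfolding g_def by (metis no_rf_poleE)
  have lim: "((\<lambda>z :: complex. 1 / z) \<longlongrightarrow> 0) at_infinity"
    using tendsto_inverse_0 by (simp add: divide_inverse)
  have pq: "((\<lambda>z. poly r (1 / z)) \<longlongrightarrow> poly r 0) at_infinity" for r :: "complex poly"
    by (rule tendsto_poly[OF lim])
  have "\<forall>\<^sub>F z in at_infinity. poly q (1 / z) \<noteq> 0"
    using pq[of q] g(2) by (rule tendsto_imp_eventually_ne)
  moreover have "\<forall>\<^sub>F z :: complex in at_infinity. z \<noteq> 0"
    using eventually_poly_nonzero_at_infinity[of zp] by simp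
  ultimately have ev: "\<forall>\<^sub>F z in at_infinity. poly p (1 / z) / poly q (1 / z) = rf_eval f z"
  proof eventually_elim
    case (elim z)
    from rf_eval_recip[OF no_rf_poleI[OF g(1) elim(1)] elim(2)]
    show ?case unfolding g_def rf_recip_recip unfolding g_def[symmetric] g(1)
      using elim by (simp add: rf_eval_quot)
  qed
  have "((\<lambda>z. poly p (1 / z) / poly q (1 / z)) \<longlongrightarrow> poly p 0 / poly q 0) at_infinity"
    by (intro tendsto_divide pq g)
  moreover have "poly p 0 = 0" using g0 g rf_eval_quot[OF g(2), of p] by (simp flip: g_def)
  ultimately have "((\<lambda>z. poly p (1 / z) / poly q (1 / z)) \<longlongrightarrow> 0) at_infinity"
    by (simp only: div_0)
  thus "rf_strictly_proper f" by (rule Lim_transform_eventually[OF _ ev])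
qed

definition rf_in_out :: "rat_fun \<Rightarrow> rat_fun \<Rightarrow> rat_fun \<Rightarrow> complex \<Rightarrow> bool" where
  "rf_in_out f a b c \<longleftrightarrow> f = a + b + rconst c \<and>
     rf_strictly_proper a \<and> (\<forall>z. rf_pole a z \<longrightarrow> cmod z < 1) \<and>
     rf_eval b 0 = 0 \<and> (\<forall>z. rf_pole b z \<longrightarrow> 1 < cmod z)"

text \<open>One linear factor is split off for each root in \<open>S\<close>, by induction on the
  degree. With the open disk as \<open>S\<close> this separates inner from outer poles.\<close>

lemma split_poly_roots:
  fixes q :: "complex poly"
  assumes "q \<noteq> 0"
  shows "\<exists>q1 q2. q = q1 * q2 \<and> (\<forall>z. poly q1 z = 0 \<longrightarrow> z \<in> S) \<and> (\<forall>z. poly q2 z = 0 \<longrightarrow> z \<notin> S)"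
  using assms
proof (induction "degree q" arbitrary: q rule: less_induct)
  case less
  show ?case
  proof (cases "\<exists>z \<in> S. poly q z = 0")
    case True
    then obtain a where a: "a \<in> S" "poly q a = 0" by blast
    then obtain q' where q: "q = [:- a, 1:] * q'" by (metis dvdE poly_eq_0_iff_dvd)
    with less have "q' \<noteq> 0" by auto
    moreover have "degree q = Suc (degree q')"
      unfolding q using \<open>q' \<noteq> 0\<close> by (subst degree_mult_eq) auto
    ultimately obtain q1 q2 where *: "q' = q1 * q2" "\<forall>z. poly q1 z = 0 \<longrightarrow> z \<in> S"
      "\<forall>z. poly q2 z = 0 \<longrightarrow> z \<notin> S"
      using less(1)[of q'] by auto
    have "\<forall>z. poly ([:- a, 1:] * q1) z = 0 \<longrightarrow> z \<in> S" using * a by auto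
    thus ?thesis using * q by (metis mult.assoc)
  next
    case False
    hence "q = 1 * q \<and> (\<forall>z. poly 1 z = 0 \<longrightarrow> z \<in> S) \<and> (\<forall>z. poly q z = 0 \<longrightarrow> z \<notin> S)" by auto
    thus ?thesis by blast
  qed
qed

text \<open>Without a common root the gcd has no root at all, so it is a constant, which is divided
  out of the Bezout identity.\<close>

lemma bezout_disjoint_roots:
  fixes p q :: "complex poly"
  assumes "p \<noteq> 0" "\<And>z. poly p z = 0 \<Longrightarrow> poly q z \<noteq> 0"
  obtains u v where "u * p + v * q = 1"
proof -
  have "\<And>z. poly (gcd p q) z \<noteq> 0"
    using assms(2) by (metis dvdE gcd_dvd1 gcd_dvd2 mult_zero_left poly_mult)
  hence "constant (poly (gcd p q))" using fundamental_theorem_of_algebra by blast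
  hence "degree (gcd p q) = 0" using constant_degree by auto
  then obtain c where c: "gcd p q = [:c:]" by (metis degree_eq_zeroE)
  have "c \<noteq> 0" using c assms(1) by auto
  have "fst (bezout_coefficients p q) * p + snd (bezout_coefficients p q) * q = [:c:]"
    using bezout_coefficients_fst_snd[of p q] c by simp
  hence "[:1 / c:] * (fst (bezout_coefficients p q) * p + snd (bezout_coefficients p q) * q) = 1"
    using \<open>c \<noteq> 0\<close> by (simp add: one_pCons)
  hence "([:1 / c:] * fst (bezout_coefficients p q)) * p + ([:1 / c:] * snd (bezout_coefficients p q)) * q = 1"
    by (simp only: distrib_left mult.assoc)
  thus thesis by (rule that)
qed

text \<open>Partial fractions over the two root sets: u q1 + v q2 = 1 gives p / q = p v / q1 + p u /
  q2. The polynomial part of the first term is moved to the second, where a pole at infinity is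
  allowed, and the value of the second at 0 becomes the constant.\<close>

lemma rf_in_out_exists:
  assumes "\<And>z. cmod z = 1 \<Longrightarrow> \<not> rf_pole f z"
  shows "\<exists>a b c. rf_in_out f a b c"
proof -
  obtain p q where f: "f = to_fract p / to_fract q" "q \<noteq> 0" "quot_of_fract f = (p, q)"
    by (metis rat_fun_cases)
  obtain q1 q2 where q: "q = q1 * q2" and q1: "\<And>z. poly q1 z = 0 \<Longrightarrow> cmod z < 1"
    and q2: "\<And>z. poly q2 z = 0 \<Longrightarrow> \<not> cmod z < 1"
    using split_poly_roots[OF f(2), of "{z. cmod z < 1}"] by auto
  \<comment> \<open>\<open>q\<close> is the reduced denominator, so a root on the circle would be a
    pole of \<open>f\<close> there.\<close>
  have q2': "cmod z > 1" if "poly q2 z = 0" for z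
    using q2[OF that] assms[of z] f(3) that unfolding rf_pole_def q by fastforce
  have nz: "q1 \<noteq> 0" "q2 \<noteq> 0" using f q by auto
  obtain u v where uv: "u * q1 + v * q2 = 1"
    using bezout_disjoint_roots[OF nz(1), of q2] q1 q2 by metis
  define s r where "s = (p * v) div q1" and "r = (p * v) mod q1"
  have pv: "p * v = s * q1 + r" by (simp add: s_def r_def)
  define a b where "a = to_fract r / to_fract q1" and "b = to_fract (s * q2 + p * u) / to_fract q2"
  define c where "c = rf_eval b 0"
  have "p = (p * v) * q2 + p * u * q1"
    using arg_cong[OF uv, of "\<lambda>x. p * x"] by (simp add: algebra_simps)
  hence "p = r * q2 + (s * q2 + p * u) * q1" unfolding pv by (simp add: algebra_simps)
  hence "to_fract p = to_fract r * to_fract q2 + to_fract (s * q2 + p * u) * to_fract q1"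
    by (metis to_fract_add to_fract_mult)
  hence "f = a + b"
    unfolding f q a_def b_def using nz by (simp add: field_simps)
  hence 1: "f = a + (b - rconst c) + rconst c" by simp
  have sp: "rf_strictly_proper a"
  proof (cases "degree q1 = 0")
    case True
    hence "r = 0" unfolding r_def using nz mod_poly_less[of "p*v" q1]
      by (metis degree_mod_less less_nat_zero_code)
    hence "a = 0" by (simp add: a_def)
    moreover have "rf_eval 0 = (\<lambda>_. 0)" using rf_eval_to_fract[of 0] by auto
    ultimately show ?thesis by simp
  next
    case False
    hence "degree r < degree q1" using degree_mod_less[OF nz(1), of "p * v"] by (auto simp: r_def)
    thus ?thesis using rf_strictly_properI a_def by blast
  qed
  have a: "rf_pole a z \<longrightarrow> cmod z < 1" for z
    using no_rf_poleI[OF a_def] q1 by blast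
  have b: "\<not> rf_pole b z" if "cmod z \<le> 1" for z
    using no_rf_poleI[OF b_def] q2' that by fastforce
  have "rf_eval (b - rconst c) 0 = 0"
    using rf_eval_diff[OF b[of 0] no_rf_pole_to_fract, of "[:c:]"] by (simp add: c_def)
  moreover have "\<forall>z. rf_pole (b - rconst c) z \<longrightarrow> 1 < cmod z"
    using no_rf_pole_diff[OF b no_rf_pole_to_fract, of _ "[:c:]"] by force
  ultimately have "rf_in_out f a (b - rconst c) c"
    unfolding rf_in_out_def using 1 sp a by blast
  thus ?thesis by blast
qed

lemma rf_strictly_proper_diff:
  assumes "rf_strictly_proper f" "rf_strictly_proper g"
  shows "rf_strictly_proper (f - g)"
  using assms unfolding rf_strictly_proper_iff
  by (simp add: rf_recip.hom_minus no_rf_pole_diff rf_eval_diff)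

lemma rf_in_out_unique:
  assumes "rf_in_out f a b c" "rf_in_out f a' b' c'"
  shows "a = a' \<and> b = b' \<and> c = c'"
proof -
  \<comment> \<open>Each side is regular where the other may fail: the right one inside the open
    disk, the left one on and outside the circle.\<close>
  have eq: "a - a' = b' - b + rconst (c' - c)"
    using assms rconst_add[of "c' - c" c] unfolding rf_in_out_def by (simp add: algebra_simps)
  have b: "\<not> rf_pole b z" "\<not> rf_pole b' z" if "cmod z \<le> 1" for z
    using assms that unfolding rf_in_out_def by force+
  have "\<not> rf_pole (a - a') z" for z
  proof (cases "cmod z < 1")
    case True
    thus ?thesis unfolding eq by (intro no_rf_pole_add no_rf_pole_diff b no_rf_pole_to_fract) auto
  next
    case False
    thus ?thesis using assms unfolding rf_in_out_def by (intro no_rf_pole_diff) auto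
  qed
  then obtain p where p: "a - a' = to_fract p" by (rule entire_rat_fun_polynomial)
  have "rf_strictly_proper (a - a')"
    using assms unfolding rf_in_out_def by (intro rf_strictly_proper_diff) auto
  hence "(poly p \<longlongrightarrow> 0) at_infinity"
    unfolding p rf_eval_to_fract[of p, THEN ext] .
  hence "p = 0" by (rule poly_tendsto_0_at_infinity)
  hence a: "a = a'" using p by simp
  hence b': "b - b' = rconst (c' - c)" using eq by (simp add: algebra_simps)
  have "rf_eval (b - b') 0 = 0"
    using assms b[of 0] by (simp add: rf_eval_diff rf_in_out_def)
  hence "c' - c = 0" unfolding b' by simp
  thus ?thesis using a b' by simp
qed

lemma rf_strictly_proper_scale:
  assumes "rf_strictly_proper f"
  shows "rf_strictly_proper (rconst e * f)"
  using assms unfolding rf_strictly_proper_iff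
  by (simp add: rf_recip.hom_mult no_rf_pole_mult rf_eval_mult)

lemma rf_in_out_scale:
  assumes "rf_in_out f a b c"
  shows "rf_in_out (rconst e * f) (rconst e * a) (rconst e * b) (e * c)"
proof -
  have pole: "rf_pole (rconst e * g) z \<Longrightarrow> rf_pole g z" for g z
    using no_rf_pole_mult[OF no_rf_pole_to_fract] by blast
  have "\<not> rf_pole b 0" using assms unfolding rf_in_out_def by force
  hence "rf_eval (rconst e * b) 0 = 0"
    using assms rf_eval_mult[of "rconst e" 0 b] by (simp add: rf_in_out_def)
  thus ?thesis using assms pole rf_strictly_proper_scale unfolding rf_in_out_def
    by (auto simp: rconst_mult distrib_left)
qed

lemma rf_in_out_reflect:
  assumes "rf_in_out f a b c"
  shows "rf_in_out (rf_recip (rf_cnj f)) (rf_recip (rf_cnj b)) (rf_recip (rf_cnj a)) (cnj c)"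
  unfolding rf_in_out_def
proof (intro conjI allI impI)
  from assms have f: "f = a + b + rconst c" and a: "rf_strictly_proper a"
    and pa: "\<And>z. 1 \<le> cmod z \<Longrightarrow> \<not> rf_pole a z"
    and b: "rf_eval b 0 = 0" and pb: "\<And>z. cmod z \<le> 1 \<Longrightarrow> \<not> rf_pole b z"
    unfolding rf_in_out_def by force+
  show "rf_recip (rf_cnj f) = rf_recip (rf_cnj b) + rf_recip (rf_cnj a) + rconst (cnj c)"
    unfolding f by (simp add: rf_cnj.hom_add rf_recip.hom_add)
  show "rf_strictly_proper (rf_recip (rf_cnj b))"
    unfolding rf_strictly_proper_iff rf_recip_recip
    using no_rf_pole_cnj[of b 0] rf_eval_cnj[of b 0] pb[of 0] b by simp
  have a0: "\<not> rf_pole (rf_recip (rf_cnj a)) 0" "rf_eval (rf_recip (rf_cnj a)) 0 = 0"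
    using a no_rf_pole_cnj[of "rf_recip a" 0] rf_eval_cnj[of "rf_recip a" 0]
    unfolding rf_recip_cnj rf_strictly_proper_iff by auto
  show "rf_eval (rf_recip (rf_cnj a)) 0 = 0" by fact
  fix z
  show "cmod z < 1" if "rf_pole (rf_recip (rf_cnj b)) z"
  proof (rule ccontr)
    assume "\<not> cmod z < 1"
    hence "z \<noteq> 0" "cmod (cnj (1 / z)) \<le> 1" by (auto simp: norm_divide divide_le_eq_1)
    thus False using that no_rf_pole_recip[OF no_rf_pole_cnj[OF pb]] by blast
  qed
  show "1 < cmod z" if "rf_pole (rf_recip (rf_cnj a)) z"
  proof (rule ccontr)
    assume "\<not> 1 < cmod z"
    moreover have "z \<noteq> 0" using a0 that by auto
    ultimately have "1 \<le> cmod (cnj (1 / z))" by (auto simp: norm_divide)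
    thus False using that no_rf_pole_recip[OF no_rf_pole_cnj[OF pa] \<open>z \<noteq> 0\<close>] by blast
  qed
qed

section \<open>Rank conditions as kernel conditions\<close>

lemma mat_adjoint_eq: "mat_adjoint A = map_mat cnj (transpose_mat A)"
  unfolding mat_adjoint_def by (intro eq_matI) (auto simp: mat_of_rows_index)

lemma dim_mat_adjoint [simp]: "dim_row (mat_adjoint A) = dim_col A" "dim_col (mat_adjoint A) = dim_row A"
  for A :: "complex mat"
  by (simp_all add: mat_adjoint_eq)

lemma mat_adjoint_carrier [simp, intro]:
  "(A :: complex mat) \<in> carrier_mat n k \<Longrightarrow> mat_adjoint A \<in> carrier_mat k n"
  by (rule carrier_matI) simp_all

lemma mat_adjoint_index [simp]:
  "i < dim_col A \<Longrightarrow> j < dim_row A \<Longrightarrow> mat_adjoint A $$ (i, j) = cnj (A $$ (j, i))"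
  by (simp add: mat_adjoint_eq)

lemma mat_adjoint_adjoint [simp]: "mat_adjoint (mat_adjoint A) = (A :: complex mat)"
  by (intro eq_matI) auto

lemma mult_mat_vec_cscalar_prod:
  fixes A :: "complex mat"
  assumes A: "A \<in> carrier_mat n k" and x: "x \<in> carrier_vec k" and y: "y \<in> carrier_vec n"
  shows "(A *\<^sub>v x) \<bullet>c y = x \<bullet>c (mat_adjoint A *\<^sub>v y)"
proof -
  have "conjugate (mat_adjoint A *\<^sub>v y) = transpose_mat A *\<^sub>v conjugate y"
  proof (rule eq_vecI)
    fix i assume "i < dim_vec (transpose_mat A *\<^sub>v conjugate y)"
    hence i: "i < k" using A by simp
    show "vec_index (conjugate (mat_adjoint A *\<^sub>v y)) i = vec_index (transpose_mat A *\<^sub>v conjugate y) i"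
      using A y i unfolding scalar_prod_def mult_mat_vec_def
      by (simp add: scalar_prod_def cnj_sum)
  qed (use A in simp)
  moreover have "(A *\<^sub>v x) \<bullet> conjugate y = x \<bullet> (transpose_mat A *\<^sub>v conjugate y)"
    using transpose_vec_mult_scalar[of "transpose_mat A" k n "conjugate y" x] A x y by simp
  ultimately show ?thesis by simp
qed

text \<open>The quadratic form of the Gram sum at v is the sum of the squared norms of A v and B v,
  so a kernel vector of the sum lies in both kernels. This turns a rank condition into an invertible
  square matrix.\<close>

lemma det_gram_sum_nonzero:
  fixes A B :: "complex mat"
  assumes A: "A \<in> carrier_mat a n" and B: "B \<in> carrier_mat b n"
    and ker: "\<And>v. v \<in> carrier_vec n \<Longrightarrow> A *\<^sub>v v = 0\<^sub>v a \<Longrightarrow> B *\<^sub>v v = 0\<^sub>v b \<Longrightarrow> v = 0\<^sub>v n"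
  shows "det (mat_adjoint A * A + mat_adjoint B * B) \<noteq> 0"
proof
  let ?G = "mat_adjoint A * A + mat_adjoint B * B"
  have G: "?G \<in> carrier_mat n n" using A B by auto
  assume "det ?G = 0"
  then obtain v where v: "v \<in> carrier_vec n" "v \<noteq> 0\<^sub>v n" "?G *\<^sub>v v = 0\<^sub>v n"
    using det_0_iff_vec_prod_zero_field[OF G] by blast
  have sq: "(mat_adjoint X * X *\<^sub>v v) \<bullet>c v = (X *\<^sub>v v) \<bullet>c (X *\<^sub>v v)" if X: "X \<in> carrier_mat k n" for X k
  proof -
    have "mat_adjoint X * X *\<^sub>v v = mat_adjoint X *\<^sub>v (X *\<^sub>v v)"
      using X v by (intro assoc_mult_mat_vec[of _ n k _ n]) auto
    thus ?thesis using mult_mat_vec_cscalar_prod[of "mat_adjoint X" n k "X *\<^sub>v v" v] X v by simp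
  qed
  have "0 = (?G *\<^sub>v v) \<bullet>c v" unfolding v(3) using v(1) by simp
  also have "?G *\<^sub>v v = mat_adjoint A * A *\<^sub>v v + mat_adjoint B * B *\<^sub>v v"
    using A B v by (intro add_mult_distrib_mat_vec[of _ n n]) auto
  also have "\<dots> \<bullet>c v = (A *\<^sub>v v) \<bullet>c (A *\<^sub>v v) + (B *\<^sub>v v) \<bullet>c (B *\<^sub>v v)"
    using mult_mat_vec_carrier[OF mult_carrier_mat[OF mat_adjoint_carrier[OF A] A] v(1)]
      mult_mat_vec_carrier[OF mult_carrier_mat[OF mat_adjoint_carrier[OF B] B] v(1)] v
    by (subst add_scalar_prod_distrib[of _ n]) (simp_all add: sq[OF A] sq[OF B])
  finally have 0: "(A *\<^sub>v v) \<bullet>c (A *\<^sub>v v) + (B *\<^sub>v v) \<bullet>c (B *\<^sub>v v) = 0" by (rule sym)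
  have "(A *\<^sub>v v) \<bullet>c (A *\<^sub>v v) \<ge> 0" "(B *\<^sub>v v) \<bullet>c (B *\<^sub>v v) \<ge> 0"
    by (rule conjugate_square_ge_0_vec)+
  from add_nonneg_eq_0_iff[OF this] 0
  have "(A *\<^sub>v v) \<bullet>c (A *\<^sub>v v) = 0" "(B *\<^sub>v v) \<bullet>c (B *\<^sub>v v) = 0"
    by blast+
  hence "A *\<^sub>v v = 0\<^sub>v a" "B *\<^sub>v v = 0\<^sub>v b"
    using conjugate_square_eq_0_vec[OF mult_mat_vec_carrier[OF A v(1)]]
      conjugate_square_eq_0_vec[OF mult_mat_vec_carrier[OF B v(1)]] by blast+
  thus False using ker v by blast
qed

lemma (in vec_space) rank_maximal_columns:
  assumes M: "M \<in> carrier_mat n k"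
  obtains S where "S \<subseteq> set (cols M)" "lin_indpt S" "card S = rank M"
proof -
  obtain S where S: "maximal S (\<lambda>T. T \<subseteq> set (cols M) \<and> lin_indpt T)"
    using maximal_exists[of "\<lambda>T. T \<subseteq> set (cols M) \<and> lin_indpt T" "card (set (cols M))" "{}"]
    by (meson List.finite_set card_mono empty_iff empty_subsetI finite_lin_indpt2 rev_finite_subset)
  hence "S \<subseteq> set (cols M)" "lin_indpt S" unfolding maximal_def by auto
  thus thesis using that rank_card_indpt[OF M S] by metis
qed

text \<open>The rank is computed from the set of columns, in which equal columns collapse. Both
  directions therefore first establish that the columns are distinct; only then is independence of
  that set the same as a trivial kernel.\<close>

lemma full_col_rank_iff:
  assumes M: "M \<in> carrier_mat n k"
  shows "full_col_rank M \<longleftrightarrow> (\<forall>v \<in> carrier_vec k. M *\<^sub>v v = 0\<^sub>v n \<longrightarrow> v = 0\<^sub>v k)"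
proof -
  interpret vec_space "TYPE(complex)" n .
  have eq: "full_col_rank M \<longleftrightarrow> rank M = k"
    using M unfolding full_col_rank_def by auto
  show ?thesis
  proof
    assume "full_col_rank M"
    hence r: "rank M = k" using eq by simp
    obtain S where "S \<subseteq> set (cols M)" "card S = rank M" using rank_maximal_columns[OF M] by metis
    \<comment> \<open>An independent set of k columns inside \<open>set (cols M)\<close> leaves no
      room for repetitions.\<close>
    hence "length (cols M) \<le> card (set (cols M))" using r M card_mono[of "set (cols M)" S] by simp
    hence d: "distinct (cols M)" using card_length[of "cols M"] by (intro card_distinct) simp
    show "\<forall>v \<in> carrier_vec k. M *\<^sub>v v = 0\<^sub>v n \<longrightarrow> v = 0\<^sub>v k"
      using full_rank_lin_indpt[OF M r d] lin_depI[OF M _ _ _ d] by blast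
  next
    assume ker: "\<forall>v \<in> carrier_vec k. M *\<^sub>v v = 0\<^sub>v n \<longrightarrow> v = 0\<^sub>v k"
    have d: "distinct (cols M)"
    proof (rule ccontr)
      assume "\<not> distinct (cols M)"
      then obtain i j where ij: "i < k" "j < k" "i \<noteq> j" "col M i = col M j"
        using M unfolding distinct_conv_nth by auto
      have unit: "M *\<^sub>v unit_vec k l = col M l" if "l < k" for l
        using M that by (intro eq_vecI) auto
      \<comment> \<open>Equal columns i and j put the difference of two unit vectors into the
        kernel.\<close>
      have "M *\<^sub>v (unit_vec k i - unit_vec k j) = M *\<^sub>v unit_vec k i - M *\<^sub>v unit_vec k j"
        using M by (intro mult_minus_distrib_mat_vec) auto
      also have "\<dots> = col M j - col M j" using unit ij by simp
      also have "\<dots> = 0\<^sub>v n" using M by (intro eq_vecI) auto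
      finally have "unit_vec k i - unit_vec k j = (0\<^sub>v k :: complex vec)" using ker by simp
      from arg_cong[OF this, of "\<lambda>v. vec_index v i"] show False using ij by simp
    qed
    have "lin_indpt (set (cols M))"
      using lin_depE[OF M _ d] ker by metis
    thus "full_col_rank M" using lin_indpt_full_rank[OF M d] eq by blast
  qed
qed

text \<open>The rank is a column rank, so full row rank means that the columns span the whole space.
  If they do, a vector v = M x in the kernel of the adjoint is orthogonal to itself. Conversely, a
  trivial kernel of the adjoint makes the product \<open>G\<close> of M with its adjoint invertible,
  and solving G z = y exhibits y as an image under M.\<close>

lemma full_row_rank_iff:
  assumes M: "M \<in> carrier_mat n k"
  shows "full_row_rank M \<longleftrightarrow> (\<forall>v \<in> carrier_vec n. mat_adjoint M *\<^sub>v v = 0\<^sub>v k \<longrightarrow> v = 0\<^sub>v n)"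
proof -
  interpret vec_space "TYPE(complex)" n .
  have eq: "full_row_rank M \<longleftrightarrow> rank M = n"
    using M unfolding full_row_rank_def by auto
  have cs: "span (set (cols M)) = {y \<in> carrier_vec n. \<exists>x \<in> carrier_vec k. M *\<^sub>v x = y}"
    using col_space_eq[OF M] M unfolding col_space_def by auto
  have cols: "set (cols M) \<subseteq> carrier_vec n" using M cols_dim by blast
  show ?thesis
  proof
    assume "full_row_rank M"
    hence r: "rank M = n" using eq by simp
    obtain S where S': "S \<subseteq> set (cols M)" "lin_indpt S" and "card S = n"
      using rank_maximal_columns[OF M] r by metis
    have "basis S"
      using S' cols \<open>card S = n\<close> finite_subset[OF S'(1)] by (intro dim_li_is_basis) (auto simp: dim_is_n)
    hence "span S = carrier_vec n" unfolding basis_def by simp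
    hence sp: "carrier_vec n \<subseteq> span (set (cols M))" using span_is_monotone[OF S'(1)] by simp
    show "\<forall>v \<in> carrier_vec n. mat_adjoint M *\<^sub>v v = 0\<^sub>v k \<longrightarrow> v = 0\<^sub>v n"
    proof (intro ballI impI)
      fix v assume v: "v \<in> carrier_vec n" and 0: "mat_adjoint M *\<^sub>v v = 0\<^sub>v k"
      obtain x where x: "x \<in> carrier_vec k" "M *\<^sub>v x = v" using sp v cs by blast
      have "v \<bullet>c v = x \<bullet>c (mat_adjoint M *\<^sub>v v)"
        using mult_mat_vec_cscalar_prod[OF M x(1) v] x(2) by simp
      also have "\<dots> = 0" using 0 x by simp
      finally show "v = 0\<^sub>v n" using v by simp
    qed
  next
    assume ker: "\<forall>v \<in> carrier_vec n. mat_adjoint M *\<^sub>v v = 0\<^sub>v k \<longrightarrow> v = 0\<^sub>v n"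
    define G where "G = M * mat_adjoint M"
    have G: "G \<in> carrier_mat n n" using M by (auto simp: G_def)
    \<comment> \<open>The second summand of the Gram lemma is filled with a matrix without rows,
      which contributes nothing.\<close>
    have "det (mat_adjoint (mat_adjoint M) * mat_adjoint M + mat_adjoint (0\<^sub>m 0 n) * 0\<^sub>m 0 n) \<noteq> 0"
      by (rule det_gram_sum_nonzero[of _ k]) (use M ker in auto)
    also have "mat_adjoint (mat_adjoint M) * mat_adjoint M + mat_adjoint (0\<^sub>m 0 n) * 0\<^sub>m 0 n = G"
      using M by (intro eq_matI) (auto simp: G_def scalar_prod_def)
    finally have "det G \<noteq> 0" .
    have "carrier_vec n \<subseteq> span (set (cols M))"
    proof
      fix y :: "complex vec" assume y: "y \<in> carrier_vec n"
      define z where "z = (1 / det G) \<cdot>\<^sub>v (adj_mat G *\<^sub>v y)"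
      have adj: "adj_mat G \<in> carrier_mat n n" "G * adj_mat G = det G \<cdot>\<^sub>m 1\<^sub>m n"
        using adj_mat[OF G] by auto
      have z: "z \<in> carrier_vec n" using adj y by (auto simp: z_def)
      have "G *\<^sub>v z = (1 / det G) \<cdot>\<^sub>v (G *\<^sub>v (adj_mat G *\<^sub>v y))"
        unfolding z_def using G adj y by (intro mult_mat_vec) auto
      also have "G *\<^sub>v (adj_mat G *\<^sub>v y) = (G * adj_mat G) *\<^sub>v y"
        using G adj y by (intro assoc_mult_mat_vec[symmetric]) auto
      also have "\<dots> = det G \<cdot>\<^sub>v y" unfolding adj(2) using y by (intro eq_vecI) auto
      also have "(1 / det G) \<cdot>\<^sub>v (det G \<cdot>\<^sub>v y) = y"
        using \<open>det G \<noteq> 0\<close> by (intro eq_vecI) auto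
      finally have "G *\<^sub>v z = y" .
      hence "M *\<^sub>v (mat_adjoint M *\<^sub>v z) = y"
        unfolding G_def using M z by (subst assoc_mult_mat_vec[symmetric]) auto
      thus "y \<in> span (set (cols M))" unfolding cs
        using y mult_mat_vec_carrier[OF mat_adjoint_carrier[OF M] z] by blast
    qed
    hence sp: "span (set (cols M)) = carrier_vec n" unfolding cs by auto
    have V: "vs (carrier_vec n) = V" by (simp add: module_vec_def)
    have "rank M = dim" unfolding rank_def sp V ..
    thus "full_row_rank M" using eq dim_is_n by simp
  qed
qed

lemma append_vec_eq_0_iff:
  assumes "v \<in> carrier_vec a" "w \<in> carrier_vec b"
  shows "v @\<^sub>v w = 0\<^sub>v (a + b) \<longleftrightarrow> v = 0\<^sub>v a \<and> w = 0\<^sub>v b"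
proof -
  have "0\<^sub>v (a + b) = 0\<^sub>v a @\<^sub>v (0\<^sub>v b :: 'a vec)" by (intro eq_vecI) auto
  thus ?thesis using append_vec_eq[of v a "0\<^sub>v a" w "0\<^sub>v b"] assms by simp
qed

lemma full_col_rank_append_rows_iff:
  assumes X: "X \<in> carrier_mat a n" and Y: "Y \<in> carrier_mat b n"
  shows "full_col_rank (X @\<^sub>r Y) \<longleftrightarrow>
    (\<forall>v \<in> carrier_vec n. X *\<^sub>v v = 0\<^sub>v a \<longrightarrow> Y *\<^sub>v v = 0\<^sub>v b \<longrightarrow> v = 0\<^sub>v n)"
proof -
  have "(X @\<^sub>r Y) *\<^sub>v v = 0\<^sub>v (a + b) \<longleftrightarrow> X *\<^sub>v v = 0\<^sub>v a \<and> Y *\<^sub>v v = 0\<^sub>v b"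
    if "v \<in> carrier_vec n" for v
    unfolding mat_mult_append[OF X Y that]
    by (rule append_vec_eq_0_iff[OF mult_mat_vec_carrier[OF X that] mult_mat_vec_carrier[OF Y that]])
  thus ?thesis unfolding full_col_rank_iff[OF carrier_append_rows[OF X Y]] by blast
qed

lemma hcat_carrier [simp]:
  "X \<in> carrier_mat n a \<Longrightarrow> Y \<in> carrier_mat n b \<Longrightarrow> hcat X Y \<in> carrier_mat n (a + b)"
  unfolding hcat_def by (rule carrier_matI) simp_all

lemma hcat_index [simp]:
  assumes "X \<in> carrier_mat n a" "Y \<in> carrier_mat n b" "i < n" "j < a + b"
  shows "hcat X Y $$ (i, j) = (if j < a then X $$ (i, j) else Y $$ (i, j - a))"
  using assms unfolding hcat_def by auto

lemma full_row_rank_hcat_iff: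
  assumes X: "X \<in> carrier_mat n a" and Y: "Y \<in> carrier_mat n b"
  shows "full_row_rank (hcat X Y) \<longleftrightarrow>
    (\<forall>v \<in> carrier_vec n. mat_adjoint X *\<^sub>v v = 0\<^sub>v a \<longrightarrow> mat_adjoint Y *\<^sub>v v = 0\<^sub>v b \<longrightarrow> v = 0\<^sub>v n)"
proof -
  have "mat_adjoint (hcat X Y) = mat_adjoint X @\<^sub>r mat_adjoint Y"
    using X Y carrier_matD[OF hcat_carrier[OF X Y]]
    by (intro eq_matI) (auto simp: append_rows_def hcat_index[OF X Y])
  hence "full_row_rank (hcat X Y) \<longleftrightarrow> full_col_rank (mat_adjoint X @\<^sub>r mat_adjoint Y)"
    unfolding full_row_rank_iff[OF hcat_carrier[OF X Y]]
      full_col_rank_iff[OF carrier_append_rows[OF mat_adjoint_carrier[OF X] mat_adjoint_carrier[OF Y]]]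
    by simp
  thus ?thesis
    by (simp add: full_col_rank_append_rows_iff[OF mat_adjoint_carrier[OF X] mat_adjoint_carrier[OF Y]])
qed

section \<open>Matrices of rational functions\<close>

interpretation to_fract: inj_comm_ring_hom "to_fract :: complex poly \<Rightarrow> rat_fun"
  by unfold_locales simp_all

interpretation const_poly: inj_comm_ring_hom "\<lambda>c :: complex. [:c:]"
  by unfold_locales (simp_all add: one_pCons)

lemma eval_poly_hom: "comm_ring_hom (\<lambda>p. poly p (z :: complex))"
  by unfold_locales simp_all

lemma dim_rmat [simp]: "dim_row (rmat X) = dim_row X" "dim_col (rmat X) = dim_col X"
  by (simp_all add: rmat_def)

lemma dim_cmat [simp]: "dim_row (cmat X) = dim_row X" "dim_col (cmat X) = dim_col X"
  by (simp_all add: cmat_def)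

lemma dim_eval_mat [simp]: "dim_row (eval_mat z X) = dim_row X" "dim_col (eval_mat z X) = dim_col X"
  by (simp_all add: eval_mat_def)

lemma rmat_carrier [simp, intro]: "X \<in> carrier_mat n k \<Longrightarrow> rmat X \<in> carrier_mat n k"
  by (simp add: rmat_def)

lemma cmat_carrier [simp, intro]: "X \<in> carrier_mat n k \<Longrightarrow> cmat X \<in> carrier_mat n k"
  by (simp add: cmat_def)

lemma eval_mat_carrier [simp, intro]: "X \<in> carrier_mat n k \<Longrightarrow> eval_mat z X \<in> carrier_mat n k"
  by (simp add: eval_mat_def)

lemma eval_mat_cmat [simp]: "eval_mat z (cmat X) = X"
  by (intro eq_matI) (simp_all add: eval_mat_def cmat_def)

lemma rmat_mult: "X \<in> carrier_mat n k \<Longrightarrow> Y \<in> carrier_mat k l \<Longrightarrow> rmat (X * Y) = rmat X * rmat Y"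
  unfolding rmat_def by (rule to_fract.mat_hom_mult)

lemma rmat_add: "X \<in> carrier_mat n k \<Longrightarrow> Y \<in> carrier_mat n k \<Longrightarrow> rmat (X + Y) = rmat X + rmat Y"
  by (intro eq_matI) (auto simp: rmat_def)

lemma rmat_minus: "X \<in> carrier_mat n k \<Longrightarrow> Y \<in> carrier_mat n k \<Longrightarrow> rmat (X - Y) = rmat X - rmat Y"
  by (intro eq_matI) (auto simp: rmat_def)

lemma rmat_smult: "rmat (p \<cdot>\<^sub>m X) = to_fract p \<cdot>\<^sub>m rmat X"
  by (intro eq_matI) (auto simp: rmat_def)

lemma det_rmat: "det (rmat X) = to_fract (det X)"
  unfolding rmat_def by (rule to_fract.hom_det)

lemma det_eval_mat: "det (eval_mat z X) = poly (det X) z"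
  unfolding eval_mat_def by (rule comm_ring_hom.hom_det[OF eval_poly_hom])

lemma eval_mat_mult:
  "X \<in> carrier_mat n k \<Longrightarrow> Y \<in> carrier_mat k l \<Longrightarrow> eval_mat z (X * Y) = eval_mat z X * eval_mat z Y"
  by (intro eq_matI) (auto simp: eval_mat_def scalar_prod_def poly_sum)

lemma eval_mat_add:
  "X \<in> carrier_mat n k \<Longrightarrow> Y \<in> carrier_mat n k \<Longrightarrow> eval_mat z (X + Y) = eval_mat z X + eval_mat z Y"
  by (intro eq_matI) (auto simp: eval_mat_def)

lemma no_mat_pole_rmat: "\<not> mat_pole (rmat X) z"
  by (auto simp: mat_pole_def rmat_def)

lemma no_mat_pole_add:
  assumes "X \<in> carrier_mat n k" "Y \<in> carrier_mat n k" "\<not> mat_pole X z" "\<not> mat_pole Y z"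
  shows "\<not> mat_pole (X + Y) z"
  using assms by (auto simp: mat_pole_def no_rf_pole_add)

lemma no_mat_pole_mult:
  assumes "X \<in> carrier_mat n k" "Y \<in> carrier_mat k l" "\<not> mat_pole X z" "\<not> mat_pole Y z"
  shows "\<not> mat_pole (X * Y) z"
  unfolding mat_pole_def
proof safe
  fix i j assume ij: "i < dim_row (X * Y)" "j < dim_col (X * Y)" and "rf_pole ((X * Y) $$ (i, j)) z"
  moreover have "\<not> rf_pole (\<Sum>l<k. X $$ (i, l) * Y $$ (l, j)) z"
    using assms ij unfolding mat_pole_def by (intro no_rf_pole_sum no_rf_pole_mult) auto
  ultimately show False using assms by (simp add: scalar_prod_def atLeast0LessThan)
qed

lemma no_mat_pole_smult: "\<not> rf_pole f z \<Longrightarrow> \<not> mat_pole X z \<Longrightarrow> \<not> mat_pole (f \<cdot>\<^sub>m X) z"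
  by (auto simp: mat_pole_def no_rf_pole_mult)

lemma no_rf_pole_det:
  assumes "X \<in> carrier_mat n n" "\<not> mat_pole X z"
  shows "\<not> rf_pole (det X) z"
proof -
  have sign: "\<not> rf_pole (signof p) z" for p
    using no_rf_pole_to_fract[of 1 z] no_rf_pole_uminus[OF no_rf_pole_to_fract[of 1 z]]
    by (simp add: sign_def)
  have "\<not> rf_pole (\<Prod>i = 0..<n. X $$ (i, p i)) z" if p: "p permutes {0..<n}" for p
  proof (rule no_rf_pole_prod)
    fix i assume i: "i \<in> {0..<n}"
    hence "p i < n" using permutes_in_image[OF p, of i] by simp
    thus "\<not> rf_pole (X $$ (i, p i)) z" using assms i unfolding mat_pole_def by auto
  qed
  hence "\<not> rf_pole (\<Sum>p | p permutes {0..<n}. signof p * (\<Prod>i = 0..<n. X $$ (i, p i))) z"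
    using sign by (intro no_rf_pole_sum no_rf_pole_mult) auto
  thus ?thesis unfolding det_def'[OF assms(1)] .
qed

lemma rat_inv_props:
  assumes P: "P \<in> carrier_mat n n" and det: "det P \<noteq> 0"
  shows "rat_inv P \<in> carrier_mat n n" "P * rat_inv P = 1\<^sub>m n" "rat_inv P * P = 1\<^sub>m n"
proof -
  have "P \<in> Units (ring_mat TYPE(rat_fun) n ())"
    using det_non_zero_imp_unit[OF P det] .
  then obtain Q where "mat_inverse P = Some Q"
    using mat_inverse(1)[OF P, of "()"] by (cases "mat_inverse P") auto
  thus "rat_inv P \<in> carrier_mat n n" "P * rat_inv P = 1\<^sub>m n" "rat_inv P * P = 1\<^sub>m n"
    using mat_inverse(2)[OF P] unfolding rat_inv_def by auto
qed

lemma rat_inv_eqI: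
  assumes P: "P \<in> carrier_mat n n" and Q: "Q \<in> carrier_mat n n" and PQ: "P * Q = 1\<^sub>m n"
  shows "rat_inv P = Q"
proof -
  have "det P * det Q = 1" using det_mult[OF P Q] PQ by simp
  hence "det P \<noteq> 0" by auto
  note inv = rat_inv_props[OF P this]
  have "rat_inv P * (P * Q) = rat_inv P * P * Q"
    using inv P Q by (intro assoc_mult_mat[symmetric]) auto
  thus ?thesis using inv PQ P Q by simp
qed

text \<open>The adjugate is polynomial, so the only denominator of the inverse is
  \<open>det M\<close>, which does not vanish at z.\<close>

lemma polynomial_mat_local_inverse:
  assumes M: "M \<in> carrier_mat n n" and det: "det (eval_mat z M) \<noteq> 0"
  obtains N where "N \<in> carrier_mat n n" "rmat M * N = 1\<^sub>m n" "N * rmat M = 1\<^sub>m n" "\<not> mat_pole N z"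
proof -
  let ?d = "1 / to_fract (det M)"
  define N where "N = ?d \<cdot>\<^sub>m rmat (adj_mat M)"
  note adj = adj_mat[OF M]
  have d: "poly (det M) z \<noteq> 0" using det by (simp add: det_eval_mat)
  hence d0: "det M \<noteq> 0" by auto
  have 1: "?d \<cdot>\<^sub>m rmat (det M \<cdot>\<^sub>m 1\<^sub>m n) = 1\<^sub>m n"
    using d0 by (intro eq_matI) (auto simp: rmat_def)
  show thesis
  proof
    show N: "N \<in> carrier_mat n n" using adj by (simp add: N_def)
    have "rmat M * N = ?d \<cdot>\<^sub>m (rmat M * rmat (adj_mat M))"
      unfolding N_def using M adj by (intro mult_smult_distrib) auto
    thus "rmat M * N = 1\<^sub>m n" using rmat_mult[OF M adj(1)] adj(2) 1 by simp
    have "N * rmat M = ?d \<cdot>\<^sub>m (rmat (adj_mat M) * rmat M)"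
      unfolding N_def using M adj by (intro mult_smult_assoc_mat) auto
    thus "N * rmat M = 1\<^sub>m n" using rmat_mult[OF adj(1) M] adj(3) 1 by simp
    have "\<not> rf_pole ?d z" by (rule no_rf_poleI[of _ 1 "det M"]) (use d in simp_all)
    thus "\<not> mat_pole N z" unfolding N_def by (intro no_mat_pole_smult no_mat_pole_rmat)
  qed
qed

text \<open>The full rank conditions at \<open>z\<close> make \<open>P P\<^sub>z\<^sup>* + G G\<^sub>z\<^sup>*\<close> and \<open>P\<^sub>z\<^sup>* P + F\<^sub>z\<^sup>* F\<close> invertible
  near \<open>z\<close>, and these express \<open>P\<^sup>-\<^sup>1\<close> through \<open>F P\<^sup>-\<^sup>1 G\<close> without creating a pole at \<open>z\<close>.\<close>

lemma invertible_at_regular_point: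
  assumes P: "P \<in> carrier_mat n n" and F: "F \<in> carrier_mat a n" and G: "G \<in> carrier_mat n b"
    and det: "det P \<noteq> 0"
    and row: "\<And>v. v \<in> carrier_vec n \<Longrightarrow> mat_adjoint (eval_mat z P) *\<^sub>v v = 0\<^sub>v n \<Longrightarrow>
      mat_adjoint (eval_mat z G) *\<^sub>v v = 0\<^sub>v b \<Longrightarrow> v = 0\<^sub>v n"
    and col: "\<And>v. v \<in> carrier_vec n \<Longrightarrow> eval_mat z P *\<^sub>v v = 0\<^sub>v n \<Longrightarrow>
      eval_mat z F *\<^sub>v v = 0\<^sub>v a \<Longrightarrow> v = 0\<^sub>v n"
    and reg: "\<not> mat_pole (rmat F * rat_inv (rmat P) * rmat G) z"
  shows "det (eval_mat z P) \<noteq> 0"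
proof -
  define Pz Gz Fz where "Pz = mat_adjoint (eval_mat z P)" and "Gz = mat_adjoint (eval_mat z G)"
    and "Fz = mat_adjoint (eval_mat z F)"
  have z: "Pz \<in> carrier_mat n n" "Gz \<in> carrier_mat b n" "Fz \<in> carrier_mat n a"
    using P G F by (auto simp: Pz_def Gz_def Fz_def)
  \<comment> \<open>The multipliers are adjoints at the single point z, taken as constants: the
    products stay polynomial, and their values at z are Gram sums, invertible by the rank
    hypotheses.\<close>
  define M where "M = P * cmat Pz + G * cmat Gz"
  define Q where "Q = cmat Pz * P + cmat Fz * F"
  have M: "M \<in> carrier_mat n n" and Q: "Q \<in> carrier_mat n n"
    using P G F z by (auto simp: M_def Q_def)
  define Y where "Y = rat_inv (rmat P)"
  have "det (rmat P) \<noteq> 0" using det by (simp add: det_rmat)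
  note Y = rat_inv_props[OF rmat_carrier[OF P] this, folded Y_def]
  note P' = rmat_carrier[OF P] and G' = rmat_carrier[OF G] and F' = rmat_carrier[OF F]
  note z' = z[THEN cmat_carrier, THEN rmat_carrier]

  note Pc = cmat_carrier[OF z(1)] and Gc = cmat_carrier[OF z(2)] and Fc = cmat_carrier[OF z(3)]
  have "eval_mat z M = mat_adjoint Pz * Pz + mat_adjoint Gz * Gz"
    unfolding M_def eval_mat_add[OF mult_carrier_mat[OF P Pc] mult_carrier_mat[OF G Gc]]
      eval_mat_mult[OF P Pc] eval_mat_mult[OF G Gc] by (simp add: Pz_def Gz_def)
  also have "det \<dots> \<noteq> 0"
    by (rule det_gram_sum_nonzero[OF z(1,2)]) (use row in \<open>auto simp: Pz_def Gz_def\<close>)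
  finally obtain N where N: "N \<in> carrier_mat n n" "rmat M * N = 1\<^sub>m n" "\<not> mat_pole N z"
    using polynomial_mat_local_inverse[OF M] by metis

  have "eval_mat z Q = mat_adjoint (eval_mat z P) * eval_mat z P + mat_adjoint (eval_mat z F) * eval_mat z F"
    unfolding Q_def eval_mat_add[OF mult_carrier_mat[OF Pc P] mult_carrier_mat[OF Fc F]]
      eval_mat_mult[OF Pc P] eval_mat_mult[OF Fc F] by (simp add: Pz_def Fz_def)
  also have "det \<dots> \<noteq> 0"
    by (rule det_gram_sum_nonzero[OF eval_mat_carrier[OF P] eval_mat_carrier[OF F] col])
  finally obtain N' where N': "N' \<in> carrier_mat n n" "N' * rmat Q = 1\<^sub>m n" "\<not> mat_pole N' z"
    using polynomial_mat_local_inverse[OF Q] by metis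

  have YG: "Y * rmat G \<in> carrier_mat n b" and R: "rmat F * Y * rmat G \<in> carrier_mat a b"
    using Y G' F' by auto
  \<comment> \<open>Q Y G consists of a polynomial term and a multiple of F Y G, which is regular by
    hypothesis. Applying the local inverse of Q shows that Y G is regular.\<close>
  have "rmat Q * (Y * rmat G) =
      rmat (cmat Pz) * rmat P * (Y * rmat G) + rmat (cmat Fz) * rmat F * (Y * rmat G)"
    unfolding Q_def rmat_add[OF mult_carrier_mat[OF Pc P] mult_carrier_mat[OF Fc F]]
      rmat_mult[OF Pc P] rmat_mult[OF Fc F]
    by (rule add_mult_distrib_mat[OF mult_carrier_mat[OF z'(1) P'] mult_carrier_mat[OF z'(3) F'] YG])
  also have "rmat (cmat Pz) * rmat P * (Y * rmat G) = rmat (cmat Pz) * (rmat P * (Y * rmat G))"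
    by (rule assoc_mult_mat[OF z'(1) P' YG])
  also have "rmat P * (Y * rmat G) = rmat G"
    unfolding assoc_mult_mat[OF P' Y(1) G', symmetric] Y(2) by (rule left_mult_one_mat[OF G'])
  also have "rmat (cmat Fz) * rmat F * (Y * rmat G) = rmat (cmat Fz) * (rmat F * Y * rmat G)"
    unfolding assoc_mult_mat[OF z'(3) F' YG] assoc_mult_mat[OF F' Y(1) G'] ..
  finally have QYG: "rmat Q * (Y * rmat G) =
    rmat (cmat Pz) * rmat G + rmat (cmat Fz) * (rmat F * Y * rmat G)" .
  have "Y * rmat G = N' * rmat Q * (Y * rmat G)"
    unfolding N'(2) by (rule left_mult_one_mat[OF YG, symmetric])
  also have "\<dots> = N' * (rmat Q * (Y * rmat G))"
    using N' YG Q by (intro assoc_mult_mat) auto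
  finally have YG_eq: "Y * rmat G = N' * (rmat Q * (Y * rmat G))" .
  have "\<not> mat_pole (N' * (rmat Q * (Y * rmat G))) z"
    unfolding QYG
    by (rule no_mat_pole_mult[OF N'(1) add_carrier_mat[OF mult_carrier_mat[OF z'(3) R]] N'(3)
          no_mat_pole_add[OF mult_carrier_mat[OF z'(1) G'] mult_carrier_mat[OF z'(3) R]
            no_mat_pole_mult[OF z'(1) G' no_mat_pole_rmat no_mat_pole_rmat]
            no_mat_pole_mult[OF z'(3) R no_mat_pole_rmat reg[folded Y_def]]]])
  hence YG_reg: "\<not> mat_pole (Y * rmat G) z" using YG_eq by simp

  \<comment> \<open>The same on the right: Y M involves only a constant and Y G, so Y itself is
    regular at z.\<close>
  have "Y * rmat M = Y * (rmat P * rmat (cmat Pz)) + Y * (rmat G * rmat (cmat Gz))"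
    unfolding M_def rmat_add[OF mult_carrier_mat[OF P Pc] mult_carrier_mat[OF G Gc]]
      rmat_mult[OF P Pc] rmat_mult[OF G Gc]
    by (rule mult_add_distrib_mat[OF Y(1) mult_carrier_mat[OF P' z'(1)] mult_carrier_mat[OF G' z'(2)]])
  also have "Y * (rmat P * rmat (cmat Pz)) = rmat (cmat Pz)"
    unfolding assoc_mult_mat[OF Y(1) P' z'(1), symmetric] Y(3) by (rule left_mult_one_mat[OF z'(1)])
  also have "Y * (rmat G * rmat (cmat Gz)) = Y * rmat G * rmat (cmat Gz)"
    by (rule assoc_mult_mat[OF Y(1) G' z'(2), symmetric])
  finally have YM: "Y * rmat M = rmat (cmat Pz) + Y * rmat G * rmat (cmat Gz)" .
  have "Y = Y * (rmat M * N)" unfolding N(2) by (rule right_mult_one_mat[OF Y(1), symmetric])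
  also have "\<dots> = Y * rmat M * N" using N Y M by (intro assoc_mult_mat[symmetric]) auto
  finally have Y_eq: "Y = Y * rmat M * N" .
  have "\<not> mat_pole (Y * rmat M * N) z"
    unfolding YM
    by (rule no_mat_pole_mult[OF add_carrier_mat[OF mult_carrier_mat[OF YG z'(2)]] N(1)
          no_mat_pole_add[OF z'(1) mult_carrier_mat[OF YG z'(2)] no_mat_pole_rmat
            no_mat_pole_mult[OF YG z'(2) YG_reg no_mat_pole_rmat]] N(3)])
  hence "\<not> mat_pole Y z" using Y_eq by simp
  hence "\<not> rf_pole (det Y) z" using no_rf_pole_det Y by blast
  \<comment> \<open>Both determinants are regular at z and multiply to 1, so neither vanishes
    there.\<close>
  moreover have "to_fract (det P) * det Y = 1"
    using det_mult[OF P' Y(1)] Y(2) by (simp add: det_rmat)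
  ultimately have "rf_eval (to_fract (det P)) z * rf_eval (det Y) z = rf_eval (to_fract 1) z"
    using rf_eval_mult[OF no_rf_pole_to_fract, of "det Y" z "det P"] by simp
  thus ?thesis unfolding rf_eval_to_fract det_eval_mat by auto
qed

section \<open>Reflection of rational matrices in the unit circle\<close>

abbreviation rf_reflect :: "rat_fun \<Rightarrow> rat_fun" where "rf_reflect f \<equiv> rf_recip (rf_cnj f)"

interpretation rf_reflect: field_hom rf_reflect
  by (rule field_hom_comp[OF rf_recip.field_hom_axioms rf_cnj.field_hom_axioms])

text \<open>Para-Hermitian matrices are the square matrices fixed by this map, para-skew-Hermitian
  ones those negated by it. It reverses products, so it carries a realization to a
  realization.\<close>

definition mat_reflect :: "rat_fun mat \<Rightarrow> rat_fun mat" where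
  "mat_reflect X = map_mat rf_reflect (transpose_mat X)"

lemma mat_reflect_carrier [simp, intro]: "X \<in> carrier_mat n k \<Longrightarrow> mat_reflect X \<in> carrier_mat k n"
  by (simp add: mat_reflect_def)

lemma mat_reflect_index [simp]:
  "X \<in> carrier_mat n k \<Longrightarrow> i < k \<Longrightarrow> j < n \<Longrightarrow> mat_reflect X $$ (i, j) = rf_reflect (X $$ (j, i))"
  by (simp add: mat_reflect_def)

lemma rat_recip_star: "rat_recip (rat_star X) = mat_reflect X"
  by (intro eq_matI) (simp_all add: rat_recip_def rat_star_def mat_reflect_def)

lemma rat_recip_recip [simp]: "rat_recip (rat_recip X) = X"
  by (intro eq_matI) (simp_all add: rat_recip_def)

lemma mat_reflect_mult:
  assumes X: "X \<in> carrier_mat n k" and Y: "Y \<in> carrier_mat k l"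
  shows "mat_reflect (X * Y) = mat_reflect Y * mat_reflect X"
proof -
  have X': "transpose_mat X \<in> carrier_mat k n" and Y': "transpose_mat Y \<in> carrier_mat l k"
    using X Y by simp_all
  show ?thesis
    unfolding mat_reflect_def transpose_mult[OF X Y] by (rule rf_reflect.mat_hom_mult[OF Y' X'])
qed

lemma mat_reflect_one: "mat_reflect (1\<^sub>m n) = 1\<^sub>m n"
  by (simp add: mat_reflect_def rf_reflect.mat_hom_one)

lemma mat_reflect_minus:
  assumes "X \<in> carrier_mat n k" "Y \<in> carrier_mat n k"
  shows "mat_reflect (X - Y) = mat_reflect X - mat_reflect Y"
  using assms by (intro eq_matI) (auto simp: mat_reflect_def rf_reflect.hom_minus)

lemma mat_reflect_cmat: "mat_reflect (rmat (cmat X)) = rmat (cmat (mat_adjoint X))"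
  by (intro eq_matI) (simp_all add: mat_reflect_def rmat_def cmat_def)

lemma mat_reflect_smult: "mat_reflect (f \<cdot>\<^sub>m X) = rf_reflect f \<cdot>\<^sub>m mat_reflect X"
  by (intro eq_matI) (simp_all add: mat_reflect_def rf_reflect.hom_mult)

lemma mat_reflect_zp_cmat:
  "mat_reflect (rmat (zp \<cdot>\<^sub>m cmat X)) = (1 / to_fract zp) \<cdot>\<^sub>m rmat (cmat (mat_adjoint X))"
  unfolding rmat_smult mat_reflect_smult mat_reflect_cmat rf_cnj_zp rf_recip_zp ..

text \<open>Every condition of the decomposition is a condition on entries, so existence, uniqueness
  and symmetry are inherited from scalar functions.\<close>

lemma in_out_decomposition_iff:
  assumes R: "R \<in> carrier_mat m m"
  shows "in_out_decomposition R Rin Rout R0 \<longleftrightarrow>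
    Rin \<in> carrier_mat m m \<and> Rout \<in> carrier_mat m m \<and> R0 \<in> carrier_mat m m \<and>
    (\<forall>i < m. \<forall>j < m. rf_in_out (R $$ (i, j)) (Rin $$ (i, j)) (Rout $$ (i, j)) (R0 $$ (i, j)))"
proof (cases "Rin \<in> carrier_mat m m \<and> Rout \<in> carrier_mat m m \<and> R0 \<in> carrier_mat m m")
  case True
  hence dims: "dim_row R = m" "dim_col R = m" "dim_row Rin = m" "dim_col Rin = m"
    "dim_row Rout = m" "dim_col Rout = m" "dim_row R0 = m" "dim_col R0 = m" using R by auto
  have eq: "R = Rin + Rout + rmat (cmat R0) \<longleftrightarrow>
      (\<forall>i < m. \<forall>j < m. R $$ (i, j) = Rin $$ (i, j) + Rout $$ (i, j) + rconst (R0 $$ (i, j)))"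
    unfolding mat_eq_iff by (simp add: dims rmat_def cmat_def)
  have zero: "map_mat (\<lambda>f. rf_eval f 0) Rout = 0\<^sub>m m m \<longleftrightarrow>
      (\<forall>i < m. \<forall>j < m. rf_eval (Rout $$ (i, j)) 0 = 0)"
    unfolding mat_eq_iff by (simp add: dims)
  have poles: "(\<forall>z. (\<exists>i < m. \<exists>j < m. p i j z) \<longrightarrow> q z) \<longleftrightarrow> (\<forall>i < m. \<forall>j < m. \<forall>z. p i j z \<longrightarrow> q z)"
    for p and q :: "complex \<Rightarrow> bool"
    by blast
  show ?thesis
    unfolding in_out_decomposition_def rf_in_out_def strictly_proper_def mat_pole_def dims eq zero poles
    by (simp only: imp_conjR all_conj_distrib conj_assoc)
next
  case False
  thus ?thesis unfolding in_out_decomposition_def carrier_matD[OF R] by blast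
qed

lemma in_out_decomposition_ex1:
  assumes R: "R \<in> carrier_mat m m" and circle: "\<forall>z. cmod z = 1 \<longrightarrow> \<not> mat_pole R z"
  shows "\<exists>!d. case d of (Rin, Rout, R0) \<Rightarrow> in_out_decomposition R Rin Rout R0"
proof -
  have "\<exists>a b c. rf_in_out (R $$ (i, j)) a b c" if "i < m" "j < m" for i j
    using R circle that by (intro rf_in_out_exists) (auto simp: mat_pole_def)
  then obtain a b c where abc: "\<And>i j. i < m \<Longrightarrow> j < m \<Longrightarrow> rf_in_out (R $$ (i, j)) (a i j) (b i j) (c i j)"
    by metis
  show ?thesis
  proof (rule ex1I)
    show "case (mat m m (\<lambda>(i, j). a i j), mat m m (\<lambda>(i, j). b i j), mat m m (\<lambda>(i, j). c i j)) of
      (Rin, Rout, R0) \<Rightarrow> in_out_decomposition R Rin Rout R0"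
      unfolding prod.case in_out_decomposition_iff[OF R] using abc by simp
  next
    fix d assume d: "case d of (Rin, Rout, R0) \<Rightarrow> in_out_decomposition R Rin Rout R0"
    obtain Rin Rout R0 where d': "d = (Rin, Rout, R0)" by (cases d)
    have "Rin $$ (i, j) = a i j \<and> Rout $$ (i, j) = b i j \<and> R0 $$ (i, j) = c i j"
      if "i < m" "j < m" for i j
      using d that unfolding d' prod.case in_out_decomposition_iff[OF R]
      by (intro rf_in_out_unique[OF _ abc[OF that]]) blast
    moreover have "Rin \<in> carrier_mat m m" "Rout \<in> carrier_mat m m" "R0 \<in> carrier_mat m m"
      using d unfolding d' prod.case in_out_decomposition_iff[OF R] by blast+
    ultimately have "Rin = mat m m (\<lambda>(i, j). a i j)" "Rout = mat m m (\<lambda>(i, j). b i j)"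
      "R0 = mat m m (\<lambda>(i, j). c i j)"
      by (simp_all add: mat_eq_iff)
    thus "d = (mat m m (\<lambda>(i, j). a i j), mat m m (\<lambda>(i, j). b i j), mat m m (\<lambda>(i, j). c i j))"
      unfolding d' by simp
  qed
qed

lemma in_out_reflect:
  assumes R: "R \<in> carrier_mat m m" and sym: "mat_reflect R = rconst e \<cdot>\<^sub>m R"
    and dec: "in_out_decomposition R Rin Rout R0"
  shows "mat_reflect Rin = rconst e \<cdot>\<^sub>m Rout" "mat_reflect Rout = rconst e \<cdot>\<^sub>m Rin"
    "mat_adjoint R0 = e \<cdot>\<^sub>m R0"
proof -
  note dec' = dec[unfolded in_out_decomposition_iff[OF R]]
  have *: "rf_reflect (Rin $$ (j, i)) = rconst e * Rout $$ (i, j) \<and>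
    rf_reflect (Rout $$ (j, i)) = rconst e * Rin $$ (i, j) \<and> cnj (R0 $$ (j, i)) = e * R0 $$ (i, j)"
    if ij: "i < m" "j < m" for i j
  proof -
    have "mat_reflect R $$ (i, j) = (rconst e \<cdot>\<^sub>m R) $$ (i, j)" by (simp only: sym)
    hence 0: "rf_reflect (R $$ (j, i)) = rconst e * R $$ (i, j)"
      using ij R by simp
    \<comment> \<open>Facts 1 and 2 split the same function, once by reflecting the splitting of the
      mirrored entry and once by scaling its own; uniqueness identifies the parts, the inner one
      with the reflected outer one.\<close>
    have 1: "rf_in_out (rf_reflect (R $$ (j, i))) (rf_reflect (Rout $$ (j, i)))
        (rf_reflect (Rin $$ (j, i))) (cnj (R0 $$ (j, i)))"
      using dec' ij by (intro rf_in_out_reflect) blast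
    have 2: "rf_in_out (rconst e * R $$ (i, j)) (rconst e * Rin $$ (i, j))
        (rconst e * Rout $$ (i, j)) (e * R0 $$ (i, j))"
      using dec' ij by (intro rf_in_out_scale) blast
    show ?thesis using rf_in_out_unique[OF 1[unfolded 0] 2] by blast
  qed
  have dims: "Rin \<in> carrier_mat m m" "Rout \<in> carrier_mat m m" "R0 \<in> carrier_mat m m"
    using dec' by blast+
  show "mat_reflect Rin = rconst e \<cdot>\<^sub>m Rout" "mat_reflect Rout = rconst e \<cdot>\<^sub>m Rin"
    "mat_adjoint R0 = e \<cdot>\<^sub>m R0"
    by (rule eq_matI; use dims * in \<open>simp add: mat_reflect_def\<close>)+
qed

section \<open>Kernels and products of block antidiagonal matrices\<close>

lemma smult_mat_vec_eq_0_iff: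
  fixes A :: "complex mat"
  assumes A: "A \<in> carrier_mat n k" and v: "v \<in> carrier_vec k" and c: "c \<noteq> 0"
  shows "(c \<cdot>\<^sub>m A) *\<^sub>v v = 0\<^sub>v n \<longleftrightarrow> A *\<^sub>v v = 0\<^sub>v n"
proof -
  have "vec_index ((c \<cdot>\<^sub>m A) *\<^sub>v v) i = c * vec_index (A *\<^sub>v v) i" if "i < n" for i
    using A v that by simp
  thus ?thesis using A c by (simp add: vec_eq_iff)
qed

lemma smult_smult_mat: "a \<cdot>\<^sub>m (b \<cdot>\<^sub>m X) = (a * b :: 'a :: semigroup_mult) \<cdot>\<^sub>m X"
  by (intro eq_matI) (simp_all add: mult.assoc)

lemma mat_adjoint_smult: "mat_adjoint (c \<cdot>\<^sub>m A) = cnj c \<cdot>\<^sub>m mat_adjoint A"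
  by (intro eq_matI) simp_all

lemma mat_adjoint_zero [simp]: "mat_adjoint (0\<^sub>m n k) = (0\<^sub>m k n :: complex mat)"
  by (intro eq_matI) simp_all

lemma det_mat_adjoint: "A \<in> carrier_mat n n \<Longrightarrow> det (mat_adjoint A) = cnj (det A)"
  unfolding mat_adjoint_eq by (simp add: cnj_hom.base.hom_det det_transpose)

lemma det_nonzero_iff_kernel:
  fixes A :: "complex mat"
  assumes "A \<in> carrier_mat n n"
  shows "det A \<noteq> 0 \<longleftrightarrow> (\<forall>v \<in> carrier_vec n. A *\<^sub>v v = 0\<^sub>v n \<longrightarrow> v = 0\<^sub>v n)"
  using det_0_iff_vec_prod_zero_field[OF assms] by blast

lemma hcat_mult_append_vec:
  assumes X: "X \<in> carrier_mat k a" and Y: "Y \<in> carrier_mat k b"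
    and v: "v \<in> carrier_vec a" and w: "w \<in> carrier_vec b"
  shows "hcat X Y *\<^sub>v (v @\<^sub>v w) = X *\<^sub>v v + Y *\<^sub>v w"
proof -
  have "hcat X Y *\<^sub>v (v @\<^sub>v w) =
      (X *\<^sub>v v + Y *\<^sub>v w) @\<^sub>v (0\<^sub>m 0 a *\<^sub>v v + 0\<^sub>m 0 b *\<^sub>v w)"
    unfolding hcat_def carrier_matD[OF X] carrier_matD[OF Y]
    by (rule four_block_mat_mult_vec[OF X Y zero_carrier_mat zero_carrier_mat v w])
  also have "\<dots> = X *\<^sub>v v + Y *\<^sub>v w"
    using X Y by (intro eq_vecI) auto
  finally show ?thesis .
qed

lemma antidiagonal_block_mult_vec:
  fixes S T :: "complex mat"
  assumes S: "S \<in> carrier_mat n n" and T: "T \<in> carrier_mat n n"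
    and v: "v \<in> carrier_vec n" and w: "w \<in> carrier_vec n"
  shows "four_block_mat (0\<^sub>m n n) S T (0\<^sub>m n n) *\<^sub>v (v @\<^sub>v w) = 0\<^sub>v (n + n) \<longleftrightarrow>
    S *\<^sub>v w = 0\<^sub>v n \<and> T *\<^sub>v v = 0\<^sub>v n"
proof -
  have Sw: "S *\<^sub>v w \<in> carrier_vec n" and Tv: "T *\<^sub>v v \<in> carrier_vec n"
    using S T v w by (blast intro: mult_mat_vec_carrier)+
  have 0: "0\<^sub>m n n *\<^sub>v u = 0\<^sub>v n" if "u \<in> carrier_vec n" for u :: "complex vec"
    using that by (intro eq_vecI) auto
  have "four_block_mat (0\<^sub>m n n) S T (0\<^sub>m n n) *\<^sub>v (v @\<^sub>v w) = (S *\<^sub>v w) @\<^sub>v (T *\<^sub>v v)"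
    using four_block_mat_mult_vec[OF zero_carrier_mat S T zero_carrier_mat v w] Sw Tv
    by (simp add: 0 v w)
  thus ?thesis using append_vec_eq_0_iff[OF Sw Tv] by simp
qed

lemma carrier_vec_append_cases:
  assumes "u \<in> carrier_vec (a + b)"
  obtains v w where "v \<in> carrier_vec a" "w \<in> carrier_vec b" "u = v @\<^sub>v w"
proof
  show "u = vec_first u a @\<^sub>v vec_last u b" using assms by (rule vec_first_last_append[symmetric])
qed simp_all

text \<open>The antidiagonal matrix annihilates the pair v, w exactly when S annihilates w and T
  annihilates v; the two halves are coupled only through \<open>F1\<close> and
  \<open>F2\<close>.\<close>

lemma full_col_rank_antidiagonal:
  fixes S T :: "complex mat"
  assumes S: "S \<in> carrier_mat n n" and T: "T \<in> carrier_mat n n"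
    and F1: "F1 \<in> carrier_mat m n" and F2: "F2 \<in> carrier_mat m n"
    and ker: "\<And>v w. v \<in> carrier_vec n \<Longrightarrow> w \<in> carrier_vec n \<Longrightarrow> S *\<^sub>v w = 0\<^sub>v n \<Longrightarrow> T *\<^sub>v v = 0\<^sub>v n \<Longrightarrow>
      F1 *\<^sub>v v + F2 *\<^sub>v w = 0\<^sub>v m \<Longrightarrow> v = 0\<^sub>v n \<and> w = 0\<^sub>v n"
  shows "full_col_rank (four_block_mat (0\<^sub>m n n) S T (0\<^sub>m n n) @\<^sub>r hcat F1 F2)"
proof -
  have ST: "four_block_mat (0\<^sub>m n n) S T (0\<^sub>m n n) \<in> carrier_mat (n + n) (n + n)" by simp
  show ?thesis
    unfolding full_col_rank_append_rows_iff[OF ST hcat_carrier[OF F1 F2]]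
  proof (intro ballI impI)
    fix u :: "complex vec"
    assume u: "u \<in> carrier_vec (n + n)"
      and 1: "four_block_mat (0\<^sub>m n n) S T (0\<^sub>m n n) *\<^sub>v u = 0\<^sub>v (n + n)" and 2: "hcat F1 F2 *\<^sub>v u = 0\<^sub>v m"
    obtain v w where vw: "v \<in> carrier_vec n" "w \<in> carrier_vec n" "u = v @\<^sub>v w"
      using u by (rule carrier_vec_append_cases)
    show "u = 0\<^sub>v (n + n)"
      unfolding vw(3) append_vec_eq_0_iff[OF vw(1,2)]
      using 1 2 ker[OF vw(1,2)] unfolding vw(3) antidiagonal_block_mult_vec[OF S T vw(1,2)]
        hcat_mult_append_vec[OF F1 F2 vw(1,2)] by blast
  qed
qed

text \<open>The adjoint is antidiagonal again, with the adjoint blocks exchanged, so the column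
  statement applies to it.\<close>

lemma full_row_rank_antidiagonal:
  fixes S T :: "complex mat"
  assumes S: "S \<in> carrier_mat n n" and T: "T \<in> carrier_mat n n"
    and G1: "G1 \<in> carrier_mat n m" and G2: "G2 \<in> carrier_mat n m"
    and ker: "\<And>v w. v \<in> carrier_vec n \<Longrightarrow> w \<in> carrier_vec n \<Longrightarrow> mat_adjoint T *\<^sub>v w = 0\<^sub>v n \<Longrightarrow>
      mat_adjoint S *\<^sub>v v = 0\<^sub>v n \<Longrightarrow> mat_adjoint G1 *\<^sub>v v + mat_adjoint G2 *\<^sub>v w = 0\<^sub>v m \<Longrightarrow>
      v = 0\<^sub>v n \<and> w = 0\<^sub>v n"
  shows "full_row_rank (hcat (four_block_mat (0\<^sub>m n n) S T (0\<^sub>m n n)) (G1 @\<^sub>r G2))"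
proof -
  let ?ST = "four_block_mat (0\<^sub>m n n) S T (0\<^sub>m n n)"
  have ST: "?ST \<in> carrier_mat (n + n) (n + n)" by simp
  have adj: "mat_adjoint ?ST = four_block_mat (0\<^sub>m n n) (mat_adjoint T) (mat_adjoint S) (0\<^sub>m n n)"
    using S T by (intro eq_matI) auto
  have adj': "mat_adjoint (G1 @\<^sub>r G2) = hcat (mat_adjoint G1) (mat_adjoint G2)"
    using G1 G2 by (intro eq_matI) (auto simp: append_rows_def hcat_def)
  have "full_row_rank (hcat ?ST (G1 @\<^sub>r G2)) \<longleftrightarrow>
      full_col_rank (mat_adjoint ?ST @\<^sub>r mat_adjoint (G1 @\<^sub>r G2))"
    unfolding full_row_rank_hcat_iff[OF ST carrier_append_rows[OF G1 G2]]
      full_col_rank_append_rows_iff[OF mat_adjoint_carrier[OF ST]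
        mat_adjoint_carrier[OF carrier_append_rows[OF G1 G2]]] ..
  moreover have "full_col_rank (mat_adjoint ?ST @\<^sub>r mat_adjoint (G1 @\<^sub>r G2))"
    unfolding adj adj'
    by (rule full_col_rank_antidiagonal[OF mat_adjoint_carrier[OF T] mat_adjoint_carrier[OF S]
          mat_adjoint_carrier[OF G1] mat_adjoint_carrier[OF G2] ker])
  ultimately show ?thesis by simp
qed

lemma hcat_mult_append_rows:
  assumes X: "X \<in> carrier_mat k a" and Y: "Y \<in> carrier_mat k b"
    and G1: "G1 \<in> carrier_mat a l" and G2: "G2 \<in> carrier_mat b l"
  shows "hcat X Y * (G1 @\<^sub>r G2) = X * G1 + Y * G2"
proof -
  have "hcat X Y * (G1 @\<^sub>r G2) = four_block_mat (X * G1 + Y * G2) (X * 0\<^sub>m a 0 + Y * 0\<^sub>m b 0)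
      (0\<^sub>m 0 a * G1 + 0\<^sub>m 0 b * G2) (0\<^sub>m 0 a * 0\<^sub>m a 0 + 0\<^sub>m 0 b * 0\<^sub>m b 0)"
    unfolding hcat_def append_rows_def carrier_matD[OF X] carrier_matD[OF Y] carrier_matD[OF G1] carrier_matD[OF G2]
    by (rule mult_four_block_mat[OF X Y zero_carrier_mat zero_carrier_mat G1 zero_carrier_mat G2 zero_carrier_mat])
  also have "\<dots> = X * G1 + Y * G2"
    using X Y G1 G2 by (intro eq_matI) auto
  finally show ?thesis .
qed

lemma hcat_mult_antidiagonal:
  assumes X: "X \<in> carrier_mat k n" and Y: "Y \<in> carrier_mat k n"
    and S: "S \<in> carrier_mat n n" and T: "T \<in> carrier_mat n n"
  shows "hcat X Y * four_block_mat (0\<^sub>m n n) S T (0\<^sub>m n n) = hcat (Y * T) (X * S)"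
proof -
  have "hcat X Y * four_block_mat (0\<^sub>m n n) S T (0\<^sub>m n n) =
      four_block_mat (X * 0\<^sub>m n n + Y * T) (X * S + Y * 0\<^sub>m n n)
      (0\<^sub>m 0 n * 0\<^sub>m n n + 0\<^sub>m 0 n * T) (0\<^sub>m 0 n * S + 0\<^sub>m 0 n * 0\<^sub>m n n)"
    unfolding hcat_def carrier_matD[OF X] carrier_matD[OF Y]
    by (rule mult_four_block_mat[OF X Y zero_carrier_mat zero_carrier_mat zero_carrier_mat S T zero_carrier_mat])
  also have "\<dots> = hcat (Y * T) (X * S)"
    using X Y S T by (intro eq_matI) (auto simp: hcat_def)
  finally show ?thesis .
qed

section \<open>Signed palindromic pencils\<close>

text \<open>Both pencils of the claim, for e = 1 and e = -1. Each of the three blocks that carry the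
  sign is e times the reversed adjoint of the block in the mirrored position, which carries
  none.\<close>

definition signed_pencil ::
  "complex \<Rightarrow> complex mat \<Rightarrow> complex mat \<Rightarrow> complex mat \<Rightarrow> complex mat \<Rightarrow> complex mat \<Rightarrow> complex poly blocks"
  where
  "signed_pencil e A1 A0 B C R0 = Blocks
     (four_block_mat
        (0\<^sub>m (dim_row A1) (dim_row A1)) (cmat A0 - zp \<cdot>\<^sub>m cmat A1)
        ([:e:] \<cdot>\<^sub>m (zp \<cdot>\<^sub>m cmat (mat_adjoint A0) - cmat (mat_adjoint A1))) (0\<^sub>m (dim_row A1) (dim_row A1)))
     (cmat C @\<^sub>r [:e:] \<cdot>\<^sub>m ((1 + zp) \<cdot>\<^sub>m cmat (mat_adjoint B)))
     (hcat ([:e:] \<cdot>\<^sub>m (zp \<cdot>\<^sub>m cmat (mat_adjoint C))) ((1 + zp) \<cdot>\<^sub>m cmat B))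
     ((1 + zp) \<cdot>\<^sub>m cmat R0)"

lemma one_smult_mat: "[:1:] \<cdot>\<^sub>m (X :: complex poly mat) = X"
  by (intro eq_matI) (simp_all add: one_pCons[symmetric])

lemma minus_one_smult_mat: "[:-1:] \<cdot>\<^sub>m (X :: complex poly mat) = - X"
  by (intro eq_matI) simp_all

lemma palindromic_pencil_eq: "palindromic_pencil A1 A0 B C R0 = signed_pencil 1 A1 A0 B C R0"
  unfolding palindromic_pencil_def signed_pencil_def one_smult_mat ..

lemma anti_palindromic_pencil_eq:
  assumes "A1 \<in> carrier_mat n n" "A0 \<in> carrier_mat n n"
  shows "anti_palindromic_pencil A1 A0 B C R0 = signed_pencil (-1) A1 A0 B C R0"
proof -
  have "- (zp \<cdot>\<^sub>m cmat (mat_adjoint A0) - cmat (mat_adjoint A1)) =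
      cmat (mat_adjoint A1) - zp \<cdot>\<^sub>m cmat (mat_adjoint A0)"
    using assms by (intro eq_matI) auto
  thus ?thesis
    unfolding anti_palindromic_pencil_def signed_pencil_def minus_one_smult_mat by simp
qed

text \<open>Minimality in kernel form, with the row condition moved to adjoints.
  \<open>det_disk\<close> is a consequence of minimality and of the location of the poles;
  \<open>disk_realization_of_minimal\<close> derives it.\<close>

locale disk_realization =
  fixes n m :: nat and A1 A0 B C :: "complex mat"
  assumes A1: "A1 \<in> carrier_mat n n" and A0: "A0 \<in> carrier_mat n n"
    and B: "B \<in> carrier_mat m n" and C: "C \<in> carrier_mat n m"
    and ker_col: "\<And>z v. v \<in> carrier_vec n \<Longrightarrow> (z \<cdot>\<^sub>m A1 - A0) *\<^sub>v v = 0\<^sub>v n \<Longrightarrow>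
      B *\<^sub>v v = 0\<^sub>v m \<Longrightarrow> v = 0\<^sub>v n"
    and ker_row: "\<And>z v. v \<in> carrier_vec n \<Longrightarrow> mat_adjoint (z \<cdot>\<^sub>m A1 - A0) *\<^sub>v v = 0\<^sub>v n \<Longrightarrow>
      mat_adjoint C *\<^sub>v v = 0\<^sub>v m \<Longrightarrow> v = 0\<^sub>v n"
    and det_A1: "det A1 \<noteq> 0"
    and det_disk: "\<And>z. 1 \<le> cmod z \<Longrightarrow> det (z \<cdot>\<^sub>m A1 - A0) \<noteq> 0"
begin

definition K :: "complex \<Rightarrow> complex mat" where "K z = z \<cdot>\<^sub>m A1 - A0"

definition H :: "complex \<Rightarrow> complex mat" where "H z = z \<cdot>\<^sub>m mat_adjoint A0 - mat_adjoint A1"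

lemma K [simp]: "K z \<in> carrier_mat n n" and H [simp]: "H z \<in> carrier_mat n n"
  using A1 A0 unfolding K_def H_def by (auto intro!: minus_carrier_mat)

lemma adjoint_H: "mat_adjoint (H z) = cnj z \<cdot>\<^sub>m A0 - A1"
  using A1 A0 by (intro eq_matI) (simp_all add: H_def)

lemma H_0: "H 0 = (-1) \<cdot>\<^sub>m mat_adjoint A1"
  using A1 A0 by (intro eq_matI) (simp_all add: H_def)

text \<open>H is the reflection of K in the circle up to the factor -z, so kernel facts travel from
  1 / cnj z to z. The point z = 0, whose mirror image is infinity, is covered by \<open>H_0\<close>
  and the invertibility of \<open>A1\<close>.\<close>

lemma H_eq: "z \<noteq> 0 \<Longrightarrow> H z = (- z) \<cdot>\<^sub>m mat_adjoint (K (1 / cnj z))"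
  using A1 A0 by (intro eq_matI) (simp_all add: H_def K_def field_simps)

lemma adjoint_H_eq: "z \<noteq> 0 \<Longrightarrow> mat_adjoint (H z) = (- cnj z) \<cdot>\<^sub>m K (1 / cnj z)"
  using A1 A0 unfolding adjoint_H by (intro eq_matI) (simp_all add: K_def field_simps)

lemma ker_A1:
  assumes "v \<in> carrier_vec n"
  shows "A1 *\<^sub>v v = 0\<^sub>v n \<Longrightarrow> v = 0\<^sub>v n" "mat_adjoint A1 *\<^sub>v v = 0\<^sub>v n \<Longrightarrow> v = 0\<^sub>v n"
  using assms det_A1 det_mat_adjoint[OF A1] det_nonzero_iff_kernel[OF A1]
    det_nonzero_iff_kernel[OF mat_adjoint_carrier[OF A1]] by auto

lemma ker_K_outside:
  assumes "v \<in> carrier_vec n" "1 \<le> cmod z"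
  shows "K z *\<^sub>v v = 0\<^sub>v n \<Longrightarrow> v = 0\<^sub>v n" "mat_adjoint (K z) *\<^sub>v v = 0\<^sub>v n \<Longrightarrow> v = 0\<^sub>v n"
proof -
  have "det (K z) \<noteq> 0" using det_disk[OF assms(2)] by (simp add: K_def)
  moreover from this have "det (mat_adjoint (K z)) \<noteq> 0" by (simp add: det_mat_adjoint[OF K])
  ultimately show "K z *\<^sub>v v = 0\<^sub>v n \<Longrightarrow> v = 0\<^sub>v n" "mat_adjoint (K z) *\<^sub>v v = 0\<^sub>v n \<Longrightarrow> v = 0\<^sub>v n"
    unfolding det_nonzero_iff_kernel[OF K] det_nonzero_iff_kernel[OF mat_adjoint_carrier[OF K]]
    using assms(1) by blast+
qed

lemma ker_H_iff:
  assumes "v \<in> carrier_vec n" "z \<noteq> 0"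
  shows "H z *\<^sub>v v = 0\<^sub>v n \<longleftrightarrow> mat_adjoint (K (1 / cnj z)) *\<^sub>v v = 0\<^sub>v n"
    "mat_adjoint (H z) *\<^sub>v v = 0\<^sub>v n \<longleftrightarrow> K (1 / cnj z) *\<^sub>v v = 0\<^sub>v n"
proof -
  show "H z *\<^sub>v v = 0\<^sub>v n \<longleftrightarrow> mat_adjoint (K (1 / cnj z)) *\<^sub>v v = 0\<^sub>v n"
    unfolding H_eq[OF assms(2)]
    by (rule smult_mat_vec_eq_0_iff[OF mat_adjoint_carrier[OF K] assms(1)]) (use assms(2) in simp)
  show "mat_adjoint (H z) *\<^sub>v v = 0\<^sub>v n \<longleftrightarrow> K (1 / cnj z) *\<^sub>v v = 0\<^sub>v n"
    unfolding adjoint_H_eq[OF assms(2)]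
    by (rule smult_mat_vec_eq_0_iff[OF K assms(1)]) (use assms(2) in simp)
qed

lemma ker_H_0:
  assumes "v \<in> carrier_vec n"
  shows "H 0 *\<^sub>v v = 0\<^sub>v n \<Longrightarrow> v = 0\<^sub>v n" "mat_adjoint (H 0) *\<^sub>v v = 0\<^sub>v n \<Longrightarrow> v = 0\<^sub>v n"
  using smult_mat_vec_eq_0_iff[OF mat_adjoint_carrier[OF A1] assms, of "-1"]
    smult_mat_vec_eq_0_iff[OF A1 assms, of "-1"] ker_A1[OF assms]
  unfolding H_0 mat_adjoint_smult by simp_all

lemma ker_H_inside:
  assumes v: "v \<in> carrier_vec n" and z: "cmod z \<le> 1"
  shows "H z *\<^sub>v v = 0\<^sub>v n \<Longrightarrow> v = 0\<^sub>v n" "mat_adjoint (H z) *\<^sub>v v = 0\<^sub>v n \<Longrightarrow> v = 0\<^sub>v n"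
proof -
  have "1 \<le> cmod (1 / cnj z)" if "z \<noteq> 0" using that z by (simp add: norm_divide)
  thus "H z *\<^sub>v v = 0\<^sub>v n \<Longrightarrow> v = 0\<^sub>v n" "mat_adjoint (H z) *\<^sub>v v = 0\<^sub>v n \<Longrightarrow> v = 0\<^sub>v n"
    using ker_H_0[OF v] ker_H_iff[OF v] ker_K_outside[OF v] by (cases "z = 0"; blast)+
qed

lemma ker_adjoint_H_B:
  assumes "v \<in> carrier_vec n" "mat_adjoint (H z) *\<^sub>v v = 0\<^sub>v n" "B *\<^sub>v v = 0\<^sub>v m"
  shows "v = 0\<^sub>v n"
  using assms ker_H_0 ker_H_iff ker_col[folded K_def] by (cases "z = 0") blast+

text \<open>The block z times the adjoint of C vanishes at z = 0, so it gives information only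
  elsewhere; at 0 the matrix H 0 is invertible by itself.\<close>

lemma ker_H_C:
  assumes "v \<in> carrier_vec n" "H z *\<^sub>v v = 0\<^sub>v n" "z \<noteq> 0 \<Longrightarrow> mat_adjoint C *\<^sub>v v = 0\<^sub>v m"
  shows "v = 0\<^sub>v n"
  using assms ker_H_0 ker_H_iff ker_row[folded K_def] by (cases "z = 0") blast+

text \<open>\<open>c\<close> will be the sign e, and the conjugate of 1 + z arises because row rank
  is tested on adjoints. Outside the open disk the surviving term carries 1 + z, hence the separate
  case z = -1.\<close>

lemma ker_block_row:
  assumes v: "v \<in> carrier_vec n" and w: "w \<in> carrier_vec n"
    and Hw: "mat_adjoint (H z) *\<^sub>v w = 0\<^sub>v n" and Kv: "mat_adjoint (K z) *\<^sub>v v = 0\<^sub>v n"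
    and sum: "mat_adjoint C *\<^sub>v v + (c * cnj (1 + z)) \<cdot>\<^sub>v (B *\<^sub>v w) = 0\<^sub>v m" and c: "c \<noteq> 0"
  shows "v = 0\<^sub>v n \<and> w = 0\<^sub>v n"
proof (cases "cmod z < 1")
  case True
  have w0: "w = 0\<^sub>v n" by (rule ker_H_inside(2)[OF w _ Hw]) (use True in simp)
  have "B *\<^sub>v w = 0\<^sub>v m" using B unfolding w0 by (intro eq_vecI) auto
  hence "mat_adjoint C *\<^sub>v v = 0\<^sub>v m" using sum C v by (auto simp: vec_eq_iff)
  thus ?thesis using ker_row[folded K_def, OF v Kv] w0 by blast
next
  case False
  hence v0: "v = 0\<^sub>v n" by (intro ker_K_outside(2)[OF v _ Kv]) simp
  have "mat_adjoint C *\<^sub>v v = 0\<^sub>v m" using C unfolding v0 by (intro eq_vecI) auto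
  hence 1: "(c * cnj (1 + z)) \<cdot>\<^sub>v (B *\<^sub>v w) = 0\<^sub>v m" using sum B w by (auto simp: vec_eq_iff)
  show ?thesis
  proof (cases "z = -1")
    case True
    thus ?thesis using ker_H_inside(2)[OF w _ Hw] v0 by simp
  next
    case False
    hence "1 + z \<noteq> 0" by (simp add: add_eq_0_iff)
    hence "c * cnj (1 + z) \<noteq> 0" using c complex_cnj_zero_iff[of "1 + z"] by (simp del: complex_cnj_add)
    hence "B *\<^sub>v w = 0\<^sub>v m" using 1 by (auto simp: vec_eq_iff)
    thus ?thesis using ker_adjoint_H_B[OF w Hw] v0 by blast
  qed
qed

text \<open>In contrast to the row condition no exceptional point arises: 1 + z is cancelled only
  inside the open disk and z only outside it, where the respective factor is nonzero.\<close>

lemma ker_block_col: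
  assumes v: "v \<in> carrier_vec n" and w: "w \<in> carrier_vec n"
    and Kw: "K z *\<^sub>v w = 0\<^sub>v n" and Hv: "H z *\<^sub>v v = 0\<^sub>v n"
    and sum: "(c * z) \<cdot>\<^sub>v (mat_adjoint C *\<^sub>v v) + (1 + z) \<cdot>\<^sub>v (B *\<^sub>v w) = 0\<^sub>v m" and c: "c \<noteq> 0"
  shows "v = 0\<^sub>v n \<and> w = 0\<^sub>v n"
proof (cases "cmod z < 1")
  case True
  have v0: "v = 0\<^sub>v n" by (rule ker_H_inside(1)[OF v _ Hv]) (use True in simp)
  have "mat_adjoint C *\<^sub>v v = 0\<^sub>v m" using C unfolding v0 by (intro eq_vecI) auto
  hence 1: "(1 + z) \<cdot>\<^sub>v (B *\<^sub>v w) = 0\<^sub>v m" using sum B w by (auto simp: vec_eq_iff)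
  have "1 + z \<noteq> 0" using True by (auto simp: add_eq_0_iff)
  hence "B *\<^sub>v w = 0\<^sub>v m" using 1 by (auto simp: vec_eq_iff)
  thus ?thesis using ker_col[folded K_def, OF w Kw] v0 by blast
next
  case False
  hence w0: "w = 0\<^sub>v n" by (intro ker_K_outside(1)[OF w _ Kw]) simp
  have "B *\<^sub>v w = 0\<^sub>v m" using B unfolding w0 by (intro eq_vecI) auto
  hence 1: "(c * z) \<cdot>\<^sub>v (mat_adjoint C *\<^sub>v v) = 0\<^sub>v m" using sum C v by (auto simp: vec_eq_iff)
  have "z \<noteq> 0" using False by auto
  hence "c * z \<noteq> 0" using c by simp
  hence "mat_adjoint C *\<^sub>v v = 0\<^sub>v m" using 1 by (auto simp: vec_eq_iff)
  thus ?thesis using ker_H_C[OF v Hv] w0 by blast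
qed

end

lemma smult_mat_vec: "A \<in> carrier_mat n k \<Longrightarrow> v \<in> carrier_vec k \<Longrightarrow> (c \<cdot>\<^sub>m A) *\<^sub>v v = c \<cdot>\<^sub>v (A *\<^sub>v v)"
  for A :: "complex mat"
  by (intro eq_vecI) simp_all

section \<open>Polynomial pencils and their reversal\<close>

lemma pencil_zero: "pencil (0\<^sub>m n k)"
  by (simp add: pencil_def)

lemma pencil_cmat: "pencil (cmat X)"
  by (simp add: pencil_def cmat_def)

lemma pencil_linear_smult_cmat:
  assumes "degree p \<le> 1"
  shows "pencil (p \<cdot>\<^sub>m cmat X)"
  unfolding pencil_def
proof (intro allI impI)
  fix i j assume "i < dim_row (p \<cdot>\<^sub>m cmat X)" "j < dim_col (p \<cdot>\<^sub>m cmat X)"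
  thus "degree ((p \<cdot>\<^sub>m cmat X) $$ (i, j)) \<le> 1"
    using degree_mult_le[of p "[:X $$ (i, j):]"] assms by (simp add: cmat_def)
qed

lemma pencil_const_smult:
  assumes "pencil X"
  shows "pencil ([:c:] \<cdot>\<^sub>m X)"
  unfolding pencil_def
proof (intro allI impI)
  fix i j assume "i < dim_row ([:c:] \<cdot>\<^sub>m X)" "j < dim_col ([:c:] \<cdot>\<^sub>m X)"
  thus "degree (([:c:] \<cdot>\<^sub>m X) $$ (i, j)) \<le> 1"
    using degree_mult_le[of "[:c:]" "X $$ (i, j)"] assms by (force simp: pencil_def)
qed

lemma pencil_minus:
  assumes "pencil X" "pencil Y" "X \<in> carrier_mat n k" "Y \<in> carrier_mat n k"
  shows "pencil (X - Y)"
  using assms by (auto simp: pencil_def intro!: degree_diff_le)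

lemma pencil_uminus: "pencil X \<Longrightarrow> pencil (- X)"
  by (simp add: pencil_def)

lemma pencil_four_block:
  assumes "pencil X" "pencil Y" "pencil Z" "pencil W" and "X \<in> carrier_mat n k" "Y \<in> carrier_mat n l"
    "Z \<in> carrier_mat p k" "W \<in> carrier_mat p l"
  shows "pencil (four_block_mat X Y Z W)"
  using assms by (auto simp: pencil_def)

lemma pencil_hcat:
  assumes "pencil X" "pencil Y" and "X \<in> carrier_mat n k" "Y \<in> carrier_mat n l"
  shows "pencil (hcat X Y)"
  unfolding hcat_def using assms by (intro pencil_four_block[OF _ _ pencil_zero pencil_zero]) auto

lemma pencil_append_rows:
  assumes "pencil X" "pencil Y" and "X \<in> carrier_mat n k" "Y \<in> carrier_mat l k"
  shows "pencil (X @\<^sub>r Y)"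
  unfolding append_rows_def using assms by (intro pencil_four_block[OF _ pencil_zero _ pencil_zero]) auto

lemma det_uminus_eq_0_iff: "det (- X) = 0 \<longleftrightarrow> det X = 0" for X :: "complex poly mat"
proof -
  have "- X = [:-1:] \<cdot>\<^sub>m X" by (intro eq_matI) simp_all
  thus ?thesis by (simp add: det_smult)
qed

lemma rmat_hcat: "X \<in> carrier_mat n k \<Longrightarrow> Y \<in> carrier_mat n l \<Longrightarrow> rmat (hcat X Y) = hcat (rmat X) (rmat Y)"
  by (intro eq_matI) (simp_all add: rmat_def hcat_def)

lemma rmat_append_rows:
  "X \<in> carrier_mat n k \<Longrightarrow> Y \<in> carrier_mat l k \<Longrightarrow> rmat (X @\<^sub>r Y) = rmat X @\<^sub>r rmat Y"
  by (intro eq_matI) (simp_all add: rmat_def append_rows_def)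

text \<open>Reversal with conjugation exchanges the two coefficients of a scalar pencil, so the
  palindromic symmetry becomes an identity between coefficients.\<close>

lemma rev1_star_pencil:
  assumes "degree p \<le> 1"
  shows "to_fract zp * rf_reflect (to_fract p) = to_fract [:cnj (coeff p 1), cnj (coeff p 0):]"
proof -
  have p: "to_fract p = rconst (coeff p 0) + to_fract zp * rconst (coeff p 1)"
    using assms to_fract_pCons[of "coeff p 0" "[:coeff p 1:]"] coeff_eq_0[of p]
    by (subst (1) poly_eq_iff[THEN iffD2, of p "[:coeff p 0, coeff p 1:]"])
      (auto simp: coeff_pCons split: nat.splits)
  have "rf_reflect (to_fract p) = rconst (cnj (coeff p 0)) + 1 / to_fract zp * rconst (cnj (coeff p 1))"
    unfolding p by (simp only: rf_reflect.hom_add rf_reflect.hom_mult rf_cnj_zp rf_recip_zp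
        rf_cnj_const rf_recip_const)
  hence "to_fract zp * rf_reflect (to_fract p) =
      rconst (cnj (coeff p 1)) + to_fract zp * rconst (cnj (coeff p 0))"
    using to_fract_zp_neq_0 by (simp add: field_simps)
  thus ?thesis unfolding to_fract_pCons[of "cnj (coeff p 1)" "[:cnj (coeff p 0):]"] .
qed

lemma rev1_rat_star_pencil:
  assumes L: "L \<in> carrier_mat k k" and pencil: "pencil L"
    and sym: "\<And>i j. i < k \<Longrightarrow> j < k \<Longrightarrow>
      [:cnj (coeff (L $$ (j, i)) 1), cnj (coeff (L $$ (j, i)) 0):] = [:e:] * L $$ (i, j)"
  shows "rev1 (rat_star (rmat L)) = rconst e \<cdot>\<^sub>m rmat L"
proof (rule eq_matI)
  fix i j assume "i < dim_row (rconst e \<cdot>\<^sub>m rmat L)" "j < dim_col (rconst e \<cdot>\<^sub>m rmat L)"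
  hence ij: "i < k" "j < k" using L by simp_all
  have "rev1 (rat_star (rmat L)) $$ (i, j) = to_fract zp * rf_reflect (to_fract (L $$ (j, i)))"
    using L ij unfolding rev1_def rat_recip_star by (simp add: mat_reflect_def rmat_def)
  also have "\<dots> = to_fract ([:e:] * L $$ (i, j))"
    using pencil L ij sym[OF ij] by (subst rev1_star_pencil) (simp_all add: pencil_def)
  also have "\<dots> = rconst e * to_fract (L $$ (i, j))" by (rule to_fract_mult)
  also have "\<dots> = (rconst e \<cdot>\<^sub>m rmat L) $$ (i, j)" using L ij by (simp add: rmat_def)
  finally show "rev1 (rat_star (rmat L)) $$ (i, j) = (rconst e \<cdot>\<^sub>m rmat L) $$ (i, j)" .
qed (use L in \<open>simp_all add: rev1_def rat_recip_star mat_reflect_def\<close>)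

section \<open>Regularity and minimality of the signed pencil\<close>

locale signed_realization = disk_realization +
  fixes e :: complex and R0 :: "complex mat"
  assumes e: "e = 1 \<or> e = -1" and R0: "R0 \<in> carrier_mat m m" and R0_sym: "mat_adjoint R0 = e \<cdot>\<^sub>m R0"
begin

lemma e_simps: "e \<noteq> 0" "cnj e = e" "e * e = 1"
  using e by auto

definition P :: "complex poly mat" where "P = zp \<cdot>\<^sub>m cmat A1 - cmat A0"

text \<open>The sign makes \<open>- P'\<close> the lower left block of the pencil, as the convention
  of a top-left block -A(z) requires. For e = 1 and e = -1 it is the pencil inverted in the
  respective formula for \<open>Rout\<close>.\<close>

definition P' :: "complex poly mat" where
  "P' = [:- e:] \<cdot>\<^sub>m (zp \<cdot>\<^sub>m cmat (mat_adjoint A0) - cmat (mat_adjoint A1))"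

lemma P [simp]: "P \<in> carrier_mat n n" and P' [simp]: "P' \<in> carrier_mat n n"
  using A1 A0 unfolding P_def P'_def by (auto intro!: minus_carrier_mat)

lemma eval_P: "eval_mat z P = K z"
  using A1 A0 by (intro eq_matI) (auto simp: P_def K_def eval_mat_def cmat_def)

lemma eval_uminus_P': "eval_mat z (- P') = e \<cdot>\<^sub>m H z"
  using A1 A0 by (intro eq_matI) (auto simp: P'_def H_def eval_mat_def cmat_def algebra_simps)

lemma blocks:
  "b11 (signed_pencil e A1 A0 B C R0) = four_block_mat (0\<^sub>m n n) (- P) (- P') (0\<^sub>m n n)"
  "b12 (signed_pencil e A1 A0 B C R0) = cmat C @\<^sub>r [:e:] \<cdot>\<^sub>m ((1 + zp) \<cdot>\<^sub>m cmat (mat_adjoint B))"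
  "b21 (signed_pencil e A1 A0 B C R0) =
    hcat ([:e:] \<cdot>\<^sub>m (zp \<cdot>\<^sub>m cmat (mat_adjoint C))) ((1 + zp) \<cdot>\<^sub>m cmat B)"
  "b22 (signed_pencil e A1 A0 B C R0) = (1 + zp) \<cdot>\<^sub>m cmat R0"
proof -
  have 1: "cmat A0 - zp \<cdot>\<^sub>m cmat A1 = - P"
    using A1 A0 by (intro eq_matI) (auto simp: P_def)
  have 2: "[:e:] \<cdot>\<^sub>m (zp \<cdot>\<^sub>m cmat (mat_adjoint A0) - cmat (mat_adjoint A1)) = - P'"
    using A1 A0 by (intro eq_matI) (auto simp: P'_def)
  have d: "dim_row A1 = n" using A1 by simp
  show "b11 (signed_pencil e A1 A0 B C R0) = four_block_mat (0\<^sub>m n n) (- P) (- P') (0\<^sub>m n n)"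
    unfolding signed_pencil_def 1 2 d by simp
qed (simp_all add: signed_pencil_def)

lemma pencil_P: "pencil P" and pencil_P': "pencil P'"
  using A1 A0 unfolding P_def P'_def
  by (auto intro!: pencil_const_smult pencil_minus pencil_linear_smult_cmat pencil_cmat)

lemma eval_b11: "eval_mat z (four_block_mat (0\<^sub>m n n) (- P) (- P') (0\<^sub>m n n)) =
  four_block_mat (0\<^sub>m n n) ((-1) \<cdot>\<^sub>m K z) (e \<cdot>\<^sub>m H z) (0\<^sub>m n n)"
proof -
  have "eval_mat z (four_block_mat (0\<^sub>m n n) (- P) (- P') (0\<^sub>m n n)) =
    four_block_mat (0\<^sub>m n n) (- eval_mat z P) (eval_mat z (- P')) (0\<^sub>m n n)"
    using carrier_matD[OF P] carrier_matD[OF P'] by (intro eq_matI) (auto simp: eval_mat_def)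
  also have "- eval_mat z P = (-1) \<cdot>\<^sub>m K z" unfolding eval_P by (intro eq_matI) auto
  finally show ?thesis unfolding eval_uminus_P' .
qed

lemma eval_b12: "eval_mat z (cmat C @\<^sub>r [:e:] \<cdot>\<^sub>m ((1 + zp) \<cdot>\<^sub>m cmat (mat_adjoint B))) =
    C @\<^sub>r (e * (1 + z)) \<cdot>\<^sub>m mat_adjoint B"
  using B C by (intro eq_matI) (auto simp: eval_mat_def append_rows_def cmat_def)

lemma eval_b21: "eval_mat z (hcat ([:e:] \<cdot>\<^sub>m (zp \<cdot>\<^sub>m cmat (mat_adjoint C))) ((1 + zp) \<cdot>\<^sub>m cmat B)) =
    hcat ((e * z) \<cdot>\<^sub>m mat_adjoint C) ((1 + z) \<cdot>\<^sub>m B)"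
  using B C by (intro eq_matI) (auto simp: eval_mat_def hcat_def cmat_def)

lemma coeff_b11: "coeff_mat 1 (four_block_mat (0\<^sub>m n n) (- P) (- P') (0\<^sub>m n n)) =
  four_block_mat (0\<^sub>m n n) ((-1) \<cdot>\<^sub>m A1) (e \<cdot>\<^sub>m mat_adjoint A0) (0\<^sub>m n n)"
  using A1 A0 by (intro eq_matI) (auto simp: coeff_mat_def P_def P'_def cmat_def)

lemma coeff_b12: "coeff_mat 1 (cmat C @\<^sub>r [:e:] \<cdot>\<^sub>m ((1 + zp) \<cdot>\<^sub>m cmat (mat_adjoint B))) =
    0\<^sub>m n m @\<^sub>r e \<cdot>\<^sub>m mat_adjoint B"
  using B C by (intro eq_matI) (auto simp: coeff_mat_def append_rows_def cmat_def)

lemma coeff_b21: "coeff_mat 1 (hcat ([:e:] \<cdot>\<^sub>m (zp \<cdot>\<^sub>m cmat (mat_adjoint C))) ((1 + zp) \<cdot>\<^sub>m cmat B)) =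
    hcat (e \<cdot>\<^sub>m mat_adjoint C) B"
  using B C by (intro eq_matI) (auto simp: coeff_mat_def hcat_def cmat_def)

lemma adjoint_e_smult: "mat_adjoint (e \<cdot>\<^sub>m X) = e \<cdot>\<^sub>m mat_adjoint X"
  by (simp add: mat_adjoint_smult e_simps)

lemma minimal_system_signed: "minimal_system (signed_pencil e A1 A0 B C R0)"
  unfolding minimal_system_def blocks eval_b11 eval_b12 eval_b21
proof (intro allI conjI)
  fix z
  show "full_row_rank (hcat (four_block_mat (0\<^sub>m n n) ((-1) \<cdot>\<^sub>m K z) (e \<cdot>\<^sub>m H z) (0\<^sub>m n n))
    (C @\<^sub>r (e * (1 + z)) \<cdot>\<^sub>m mat_adjoint B))"
  proof (rule full_row_rank_antidiagonal)
    fix v w :: "complex vec"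
    assume v: "v \<in> carrier_vec n" and w: "w \<in> carrier_vec n"
      and 1: "mat_adjoint (e \<cdot>\<^sub>m H z) *\<^sub>v w = 0\<^sub>v n" and 2: "mat_adjoint ((-1) \<cdot>\<^sub>m K z) *\<^sub>v v = 0\<^sub>v n"
      and 3: "mat_adjoint C *\<^sub>v v + mat_adjoint ((e * (1 + z)) \<cdot>\<^sub>m mat_adjoint B) *\<^sub>v w = 0\<^sub>v m"
    have "mat_adjoint (H z) *\<^sub>v w = 0\<^sub>v n"
      using 1 unfolding adjoint_e_smult smult_mat_vec_eq_0_iff[OF mat_adjoint_carrier[OF H] w e_simps(1)] .
    moreover have "mat_adjoint (K z) *\<^sub>v v = 0\<^sub>v n"
      using 2 smult_mat_vec_eq_0_iff[OF mat_adjoint_carrier[OF K] v, of "-1"]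
      by (simp add: mat_adjoint_smult)
    moreover have "mat_adjoint ((e * (1 + z)) \<cdot>\<^sub>m mat_adjoint B) = (e * cnj (1 + z)) \<cdot>\<^sub>m B"
      unfolding mat_adjoint_smult by (simp add: e_simps)
    ultimately show "v = 0\<^sub>v n \<and> w = 0\<^sub>v n"
      using ker_block_row[OF v w _ _ _ e_simps(1)] 3 smult_mat_vec[OF B w] by metis
  qed (use B C in auto)
  show "full_col_rank (four_block_mat (0\<^sub>m n n) ((-1) \<cdot>\<^sub>m K z) (e \<cdot>\<^sub>m H z) (0\<^sub>m n n) @\<^sub>r
    hcat ((e * z) \<cdot>\<^sub>m mat_adjoint C) ((1 + z) \<cdot>\<^sub>m B))"
  proof (rule full_col_rank_antidiagonal)
    fix v w :: "complex vec"
    assume v: "v \<in> carrier_vec n" and w: "w \<in> carrier_vec n"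
      and 1: "((-1) \<cdot>\<^sub>m K z) *\<^sub>v w = 0\<^sub>v n" and 2: "(e \<cdot>\<^sub>m H z) *\<^sub>v v = 0\<^sub>v n"
      and 3: "((e * z) \<cdot>\<^sub>m mat_adjoint C) *\<^sub>v v + ((1 + z) \<cdot>\<^sub>m B) *\<^sub>v w = 0\<^sub>v m"
    have "K z *\<^sub>v w = 0\<^sub>v n"
      using 1 smult_mat_vec_eq_0_iff[OF K w, of "-1"] by simp
    moreover have "H z *\<^sub>v v = 0\<^sub>v n"
      using 2 unfolding smult_mat_vec_eq_0_iff[OF H v e_simps(1)] .
    ultimately show "v = 0\<^sub>v n \<and> w = 0\<^sub>v n"
      using ker_block_col[OF v w _ _ _ e_simps(1)] 3 smult_mat_vec[OF B w]
        smult_mat_vec[OF mat_adjoint_carrier[OF C] v] by metis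
  qed (use B C in auto)
qed

lemma K_0: "K 0 = (-1) \<cdot>\<^sub>m A0"
  using A1 A0 by (intro eq_matI) (auto simp: K_def)

text \<open>Invertibility of \<open>A1\<close> annihilates one half of a kernel vector. The other
  half meets \<open>A0\<close> or its adjoint, that is K 0 up to sign, so minimality at the finite
  point 0 applies: \<open>B\<close> keeps its coefficient in (1 + z) B for the row condition, and
  the adjoint of \<open>C\<close> keeps its own, up to e, for the column condition.\<close>

lemma minimal_at_infinity_signed: "minimal_at_infinity (signed_pencil e A1 A0 B C R0)"
  unfolding minimal_at_infinity_def blocks coeff_b11 coeff_b12 coeff_b21
proof (intro conjI)
  show "full_row_rank (hcat (four_block_mat (0\<^sub>m n n) ((-1) \<cdot>\<^sub>m A1) (e \<cdot>\<^sub>m mat_adjoint A0) (0\<^sub>m n n))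
    (0\<^sub>m n m @\<^sub>r e \<cdot>\<^sub>m mat_adjoint B))"
  proof (rule full_row_rank_antidiagonal)
    fix v w :: "complex vec"
    assume v: "v \<in> carrier_vec n" and w: "w \<in> carrier_vec n"
      and 1: "mat_adjoint (e \<cdot>\<^sub>m mat_adjoint A0) *\<^sub>v w = 0\<^sub>v n"
      and 2: "mat_adjoint ((-1) \<cdot>\<^sub>m A1) *\<^sub>v v = 0\<^sub>v n"
      and 3: "mat_adjoint (0\<^sub>m n m) *\<^sub>v v + mat_adjoint (e \<cdot>\<^sub>m mat_adjoint B) *\<^sub>v w = 0\<^sub>v m"
    have "mat_adjoint A1 *\<^sub>v v = 0\<^sub>v n"
      using 2 smult_mat_vec_eq_0_iff[OF mat_adjoint_carrier[OF A1] v, of "-1"]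
      by (simp add: mat_adjoint_smult)
    hence "v = 0\<^sub>v n" by (rule ker_A1(2)[OF v])
    have "A0 *\<^sub>v w = 0\<^sub>v n"
      using 1 smult_mat_vec_eq_0_iff[OF A0 w e_simps(1)] by (simp add: adjoint_e_smult)
    hence K: "K 0 *\<^sub>v w = 0\<^sub>v n"
      unfolding K_0 using smult_mat_vec_eq_0_iff[OF A0 w, of "-1"] by simp
    have "0\<^sub>m m n *\<^sub>v v + (e \<cdot>\<^sub>m B) *\<^sub>v w = (e \<cdot>\<^sub>m B) *\<^sub>v w"
      using B v w by (intro eq_vecI) auto
    hence "B *\<^sub>v w = 0\<^sub>v m"
      using 3 smult_mat_vec_eq_0_iff[OF B w e_simps(1)] by (simp add: adjoint_e_smult)
    thus "v = 0\<^sub>v n \<and> w = 0\<^sub>v n"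
      using ker_col[folded K_def, OF w K] \<open>v = 0\<^sub>v n\<close> by blast
  qed (use A1 A0 B C in auto)
  show "full_col_rank (four_block_mat (0\<^sub>m n n) ((-1) \<cdot>\<^sub>m A1) (e \<cdot>\<^sub>m mat_adjoint A0) (0\<^sub>m n n) @\<^sub>r
    hcat (e \<cdot>\<^sub>m mat_adjoint C) B)"
  proof (rule full_col_rank_antidiagonal)
    fix v w :: "complex vec"
    assume v: "v \<in> carrier_vec n" and w: "w \<in> carrier_vec n"
      and 1: "((-1) \<cdot>\<^sub>m A1) *\<^sub>v w = 0\<^sub>v n" and 2: "(e \<cdot>\<^sub>m mat_adjoint A0) *\<^sub>v v = 0\<^sub>v n"
      and 3: "(e \<cdot>\<^sub>m mat_adjoint C) *\<^sub>v v + B *\<^sub>v w = 0\<^sub>v m"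
    have "A1 *\<^sub>v w = 0\<^sub>v n"
      using 1 smult_mat_vec_eq_0_iff[OF A1 w, of "-1"] by simp
    hence w0: "w = 0\<^sub>v n" by (rule ker_A1(1)[OF w])
    have "mat_adjoint A0 *\<^sub>v v = 0\<^sub>v n"
      using 2 unfolding smult_mat_vec_eq_0_iff[OF mat_adjoint_carrier[OF A0] v e_simps(1)] .
    hence K: "mat_adjoint (K 0) *\<^sub>v v = 0\<^sub>v n"
      unfolding K_0 mat_adjoint_smult
      using smult_mat_vec_eq_0_iff[OF mat_adjoint_carrier[OF A0] v, of "-1"] by simp
    have "(e \<cdot>\<^sub>m mat_adjoint C) *\<^sub>v v + B *\<^sub>v 0\<^sub>v n = (e \<cdot>\<^sub>m mat_adjoint C) *\<^sub>v v"
      using B C v by (intro eq_vecI) auto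
    hence "mat_adjoint C *\<^sub>v v = 0\<^sub>v m"
      using 3 smult_mat_vec_eq_0_iff[OF mat_adjoint_carrier[OF C] v e_simps(1)] by (simp add: w0)
    thus "v = 0\<^sub>v n \<and> w = 0\<^sub>v n"
      using ker_row[folded K_def, OF v K] w0 by blast
  qed (use A1 A0 B C in auto)
qed

lemma det_P: "det P \<noteq> 0"
proof -
  \<comment> \<open>The point 1 lies on the circle, where K is invertible.\<close>
  have "det (eval_mat 1 P) \<noteq> 0"
    unfolding eval_P det_nonzero_iff_kernel[OF K]
  proof (intro ballI impI)
    fix v :: "complex vec" assume "v \<in> carrier_vec n" "K 1 *\<^sub>v v = 0\<^sub>v n"
    thus "v = 0\<^sub>v n" by (intro ker_K_outside(1)[of v 1]) (simp_all only: norm_one order_refl)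
  qed
  hence "poly (det P) 1 \<noteq> 0" unfolding det_eval_mat .
  thus ?thesis by (metis poly_0)
qed

lemma det_P': "det P' \<noteq> 0"
proof -
  \<comment> \<open>At 0 the matrix is minus the adjoint of \<open>A1\<close>, up to the sign
    e.\<close>
  have "det (e \<cdot>\<^sub>m H 0) \<noteq> 0"
    unfolding det_nonzero_iff_kernel[OF smult_carrier_mat[OF H]]
    using ker_H_0 smult_mat_vec_eq_0_iff[OF H _ e_simps(1)] by blast
  hence "poly (det (- P')) 0 \<noteq> 0" unfolding eval_uminus_P'[symmetric] det_eval_mat .
  hence "det (- P') \<noteq> 0" by (metis poly_0)
  thus ?thesis by (simp add: det_uminus_eq_0_iff)
qed

lemma degree_one_plus_zp: "degree (1 + zp) \<le> 1"
  by (rule degree_add_le) simp_all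

text \<open>Inverting an antidiagonal matrix inverts the blocks and exchanges their places. The
  determinant is then nonzero because an inverse exists, which avoids expanding a block
  determinant.\<close>

lemma antidiagonal_inverse:
  "rat_inv (rmat (- four_block_mat (0\<^sub>m n n) (- P) (- P') (0\<^sub>m n n))) =
   four_block_mat (0\<^sub>m n n) (rat_inv (rmat P')) (rat_inv (rmat P)) (0\<^sub>m n n)"
  "det (- four_block_mat (0\<^sub>m n n) (- P) (- P') (0\<^sub>m n n)) \<noteq> 0"
proof -
  let ?N = "- four_block_mat (0\<^sub>m n n) (- P) (- P') (0\<^sub>m n n)"
  have "det (rmat P) \<noteq> 0" "det (rmat P') \<noteq> 0" using det_P det_P' by (simp_all add: det_rmat)
  note U = rat_inv_props[OF rmat_carrier[OF P] this(1)] and V = rat_inv_props[OF rmat_carrier[OF P'] this(2)]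
  have eq: "rmat ?N = four_block_mat (0\<^sub>m n n) (rmat P) (rmat P') (0\<^sub>m n n)"
    using carrier_matD[OF P] carrier_matD[OF P'] by (intro eq_matI) (auto simp: rmat_def)
  have "rmat ?N * four_block_mat (0\<^sub>m n n) (rat_inv (rmat P')) (rat_inv (rmat P)) (0\<^sub>m n n) =
      four_block_mat (0\<^sub>m n n * 0\<^sub>m n n + rmat P * rat_inv (rmat P))
        (0\<^sub>m n n * rat_inv (rmat P') + rmat P * 0\<^sub>m n n)
        (rmat P' * 0\<^sub>m n n + 0\<^sub>m n n * rat_inv (rmat P)) (rmat P' * rat_inv (rmat P') + 0\<^sub>m n n * 0\<^sub>m n n)"
    unfolding eq by (rule mult_four_block_mat[OF zero_carrier_mat rmat_carrier[OF P] rmat_carrier[OF P']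
          zero_carrier_mat zero_carrier_mat V(1) U(1) zero_carrier_mat])
  also have "\<dots> = 1\<^sub>m (n + n)"
    unfolding U(2) V(2) using U(1) V(1) rmat_carrier[OF P] rmat_carrier[OF P']
    by (simp add: left_mult_zero_mat[of _ n n] right_mult_zero_mat[of _ n n] flip: four_block_one_mat)
  finally have inv: "rmat ?N * four_block_mat (0\<^sub>m n n) (rat_inv (rmat P')) (rat_inv (rmat P)) (0\<^sub>m n n) =
      1\<^sub>m (n + n)" .
  have N: "rmat ?N \<in> carrier_mat (n + n) (n + n)"
    and I: "four_block_mat (0\<^sub>m n n) (rat_inv (rmat P')) (rat_inv (rmat P)) (0\<^sub>m n n) \<in> carrier_mat (n + n) (n + n)"
    by (rule rmat_carrier; simp) simp
  show "rat_inv (rmat ?N) = four_block_mat (0\<^sub>m n n) (rat_inv (rmat P')) (rat_inv (rmat P)) (0\<^sub>m n n)"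
    by (rule rat_inv_eqI[OF N I inv])
  have "det (rmat ?N) * det (four_block_mat (0\<^sub>m n n) (rat_inv (rmat P')) (rat_inv (rmat P)) (0\<^sub>m n n)) = 1"
    using det_mult[OF N I] inv by simp
  thus "det ?N \<noteq> 0" by (auto simp: det_rmat)
qed

lemma linear_system_matrix_signed: "linear_system_matrix (signed_pencil e A1 A0 B C R0)"
  unfolding linear_system_matrix_def blocks
proof (intro conjI)
  show "pencil (four_block_mat (0\<^sub>m n n) (- P) (- P') (0\<^sub>m n n))"
    by (intro pencil_four_block[of _ _ _ _ n n n n] pencil_zero pencil_uminus pencil_P pencil_P') simp_all
  show "pencil (cmat C @\<^sub>r [:e:] \<cdot>\<^sub>m ((1 + zp) \<cdot>\<^sub>m cmat (mat_adjoint B)))"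
    using B C by (intro pencil_append_rows[of _ _ n m n] pencil_cmat pencil_const_smult
        pencil_linear_smult_cmat degree_one_plus_zp) auto
  show "pencil (hcat ([:e:] \<cdot>\<^sub>m (zp \<cdot>\<^sub>m cmat (mat_adjoint C))) ((1 + zp) \<cdot>\<^sub>m cmat B))"
    using B C by (intro pencil_hcat[of _ _ m n n] pencil_const_smult
        pencil_linear_smult_cmat degree_one_plus_zp) auto
  show "pencil ((1 + zp) \<cdot>\<^sub>m cmat R0)"
    by (intro pencil_linear_smult_cmat degree_one_plus_zp)
  show "det (- four_block_mat (0\<^sub>m n n) (- P) (- P') (0\<^sub>m n n)) \<noteq> 0" by (rule antidiagonal_inverse(2))
qed (use B C R0 carrier_matD[OF P] carrier_matD[OF P'] in
    \<open>simp_all add: append_rows_def hcat_def\<close>)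

end

section \<open>The outer realization and the transfer function\<close>

lemma one_plus_zp_cmat: "(1 + zp) \<cdot>\<^sub>m cmat X = map_mat (\<lambda>c. [:c, c:]) X"
proof -
  have "(1 + zp) * [:c:] = [:c, c:]" for c
    unfolding distrib_right by simp
  thus ?thesis by (intro eq_matI) (simp_all only: cmat_def index_smult_mat index_map_mat dim_cmat)
qed

lemma zp_cmat: "zp \<cdot>\<^sub>m cmat X = map_mat (\<lambda>c. [:0, c:]) X"
  by (intro eq_matI) (simp_all add: cmat_def)

context signed_realization
begin

text \<open>This is the origin of the factor z in the outer realization: the inverse of
  \<open>P'\<close> acquires 1/z from this identity, and the z next to the adjoint of C cancels
  it.\<close>

lemma reflect_rmat_P:
  "rmat P' = (rconst e * to_fract zp) \<cdot>\<^sub>m mat_reflect (rmat P)"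
proof -
  have "mat_reflect (rmat P) = (1 / to_fract zp) \<cdot>\<^sub>m rmat (cmat (mat_adjoint A1)) - rmat (cmat (mat_adjoint A0))"
    unfolding P_def rmat_minus[OF smult_carrier_mat[OF cmat_carrier[OF A1]] cmat_carrier[OF A0]]
      mat_reflect_minus[OF rmat_carrier[OF smult_carrier_mat[OF cmat_carrier[OF A1]]] rmat_carrier[OF cmat_carrier[OF A0]]]
      mat_reflect_zp_cmat mat_reflect_cmat ..
  moreover have "rmat P' = rconst (- e) \<cdot>\<^sub>m
      (to_fract zp \<cdot>\<^sub>m rmat (cmat (mat_adjoint A0)) - rmat (cmat (mat_adjoint A1)))"
    unfolding P'_def rmat_smult rmat_minus[OF smult_carrier_mat[OF cmat_carrier[OF mat_adjoint_carrier[OF A0]]]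
        cmat_carrier[OF mat_adjoint_carrier[OF A1]]] ..
  ultimately show ?thesis
    unfolding rconst_uminus using A1 A0 to_fract_zp_neq_0
    by (intro eq_matI) (simp_all add: field_simps del: to_fract_eq_0_iff)
qed

text \<open>Reflection reverses the product of \<open>B\<close>, the inverse of \<open>P\<close> and
  \<open>C\<close>, and takes adjoints of the constant factors. The inverse of \<open>P'\<close> is
  the reflected inverse \<open>W\<close> times e / z; the sign it brings and the sign of the
  symmetry cancel.\<close>

lemma outer_realization:
  assumes Rin: "Rin = rmat (cmat B) * rat_inv (rmat P) * rmat (cmat C)"
    and sym: "mat_reflect Rin = rconst e \<cdot>\<^sub>m Rout" and Rout: "Rout \<in> carrier_mat m m"
  shows "Rout = rmat (zp \<cdot>\<^sub>m cmat (mat_adjoint C)) * rat_inv (rmat P') * rmat (cmat (mat_adjoint B))"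
proof -
  have "det (rmat P) \<noteq> 0" using det_P by (simp add: det_rmat)
  note U = rat_inv_props[OF rmat_carrier[OF P] this]
  define W where "W = mat_reflect (rat_inv (rmat P))"
  have W: "W \<in> carrier_mat n n" using U by (simp add: W_def)
  note C' = rmat_carrier[OF cmat_carrier[OF mat_adjoint_carrier[OF C]]]
    and B' = rmat_carrier[OF cmat_carrier[OF mat_adjoint_carrier[OF B]]]
  have ee: "rconst e * rconst e = 1" by (simp only: rconst_mult[symmetric] e_simps rconst_1)
  have PW: "mat_reflect (rmat P) * W = 1\<^sub>m n"
    unfolding W_def mat_reflect_mult[OF U(1) rmat_carrier[OF P], symmetric] U(3) mat_reflect_one ..
  have P'W: "rmat P' * ((rconst e / to_fract zp) \<cdot>\<^sub>m W) =
      ((rconst e * to_fract zp) * (rconst e / to_fract zp)) \<cdot>\<^sub>m (mat_reflect (rmat P) * W)"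
    unfolding reflect_rmat_P using W
    by (simp add: mult_smult_distrib[of _ n n _ n] mult_smult_assoc_mat[of _ n n _ n] smult_smult_mat
        mult.commute)
  have "(rconst e * to_fract zp) * (rconst e / to_fract zp) = 1"
    using ee to_fract_zp_neq_0 by (simp add: field_simps del: to_fract_eq_0_iff)
  hence "rmat P' * ((rconst e / to_fract zp) \<cdot>\<^sub>m W) = 1\<^sub>m n"
    unfolding P'W PW by (intro eq_matI) auto
  hence inv: "rat_inv (rmat P') = (rconst e / to_fract zp) \<cdot>\<^sub>m W"
    using W by (intro rat_inv_eqI[of _ n]) auto
  have refl: "mat_reflect Rin = rmat (cmat (mat_adjoint C)) * (W * rmat (cmat (mat_adjoint B)))"
    unfolding Rin mat_reflect_mult[OF mult_carrier_mat[OF rmat_carrier[OF cmat_carrier[OF B]] U(1)]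
        rmat_carrier[OF cmat_carrier[OF C]]]
      mat_reflect_mult[OF rmat_carrier[OF cmat_carrier[OF B]] U(1)] mat_reflect_cmat W_def ..
  have "rmat (zp \<cdot>\<^sub>m cmat (mat_adjoint C)) * rat_inv (rmat P') * rmat (cmat (mat_adjoint B)) =
      (to_fract zp * (rconst e / to_fract zp)) \<cdot>\<^sub>m (rmat (cmat (mat_adjoint C)) * W * rmat (cmat (mat_adjoint B)))"
    unfolding inv rmat_smult using W C' B'
    by (simp add: mult_smult_distrib[of _ m n _ n] mult_smult_assoc_mat[of _ m n _ n]
        mult_smult_assoc_mat[of _ m n _ m] smult_smult_mat mult.commute)
  also have "to_fract zp * (rconst e / to_fract zp) = rconst e"
    using to_fract_zp_neq_0 by (simp del: to_fract_eq_0_iff)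
  also have "rmat (cmat (mat_adjoint C)) * W * rmat (cmat (mat_adjoint B)) = rconst e \<cdot>\<^sub>m Rout"
    unfolding assoc_mult_mat[OF C' W B'] refl[symmetric] sym ..
  also have "rconst e \<cdot>\<^sub>m (rconst e \<cdot>\<^sub>m Rout) = Rout"
    unfolding smult_smult_mat ee by (intro eq_matI) auto
  finally show ?thesis ..
qed

lemma minimal_outer_realization:
  assumes Rin: "Rin = rmat (cmat B) * rat_inv (rmat P) * rmat (cmat C)"
    and sym: "mat_reflect Rin = rconst e \<cdot>\<^sub>m Rout" and Rout: "Rout \<in> carrier_mat m m"
  shows "minimal_realization (zp \<cdot>\<^sub>m cmat (mat_adjoint C)) P' (cmat (mat_adjoint B)) Rout"
  unfolding minimal_realization_def Let_def
proof (intro conjI)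
  show "Rout = rmat (zp \<cdot>\<^sub>m cmat (mat_adjoint C)) * rat_inv (rmat P') * rmat (cmat (mat_adjoint B))"
    by (rule outer_realization[OF assms])
  have "det (- (- P')) \<noteq> 0" using det_P' by simp
  thus "linear_system_matrix (Blocks (- P') (cmat (mat_adjoint B)) (zp \<cdot>\<^sub>m cmat (mat_adjoint C))
      (0\<^sub>m (dim_row (zp \<cdot>\<^sub>m cmat (mat_adjoint C))) (dim_col (cmat (mat_adjoint B)))))"
    using B C carrier_matD[OF P'] unfolding linear_system_matrix_def
    by (simp add: pencil_uminus pencil_P' pencil_cmat pencil_zero pencil_linear_smult_cmat)
  have C': "eval_mat z (zp \<cdot>\<^sub>m cmat (mat_adjoint C)) = z \<cdot>\<^sub>m mat_adjoint C" for z
    by (intro eq_matI) (auto simp: eval_mat_def cmat_def)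
  have eH: "e \<cdot>\<^sub>m H z \<in> carrier_mat n n" for z by simp
  note B' = mat_adjoint_carrier[OF B] and zC' = smult_carrier_mat[OF mat_adjoint_carrier[OF C]]
  show "minimal_system (Blocks (- P') (cmat (mat_adjoint B)) (zp \<cdot>\<^sub>m cmat (mat_adjoint C))
      (0\<^sub>m (dim_row (zp \<cdot>\<^sub>m cmat (mat_adjoint C))) (dim_col (cmat (mat_adjoint B)))))"
    unfolding minimal_system_def blocks.sel eval_uminus_P' eval_mat_cmat C'
      full_row_rank_hcat_iff[OF eH B'] full_col_rank_append_rows_iff[OF eH zC']
  proof (intro allI conjI ballI impI)
    fix z and v :: "complex vec"
    assume v: "v \<in> carrier_vec n" and 1: "mat_adjoint (e \<cdot>\<^sub>m H z) *\<^sub>v v = 0\<^sub>v n"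
      and 2: "mat_adjoint (mat_adjoint B) *\<^sub>v v = 0\<^sub>v m"
    have "mat_adjoint (H z) *\<^sub>v v = 0\<^sub>v n"
      using 1 unfolding adjoint_e_smult smult_mat_vec_eq_0_iff[OF mat_adjoint_carrier[OF H] v e_simps(1)] .
    thus "v = 0\<^sub>v n" using ker_adjoint_H_B[OF v] 2 by simp
  next
    fix z and v :: "complex vec"
    assume v: "v \<in> carrier_vec n" and 1: "(e \<cdot>\<^sub>m H z) *\<^sub>v v = 0\<^sub>v n"
      and 2: "(z \<cdot>\<^sub>m mat_adjoint C) *\<^sub>v v = 0\<^sub>v m"
    have "H z *\<^sub>v v = 0\<^sub>v n"
      using 1 unfolding smult_mat_vec_eq_0_iff[OF H v e_simps(1)] .
    thus "v = 0\<^sub>v n"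
      by (rule ker_H_C[OF v]) (use 2 smult_mat_vec_eq_0_iff[OF mat_adjoint_carrier[OF C] v] in blast)
  qed
qed

text \<open>The antidiagonal inverse pairs the block of \<open>B\<close> with \<open>C\<close>, and
  the adjoint of \<open>C\<close> with that of \<open>B\<close>; no mixed product occurs. Either
  pairing contains 1 + z once, and in the outer one the sign occurs twice.\<close>

lemma transfer_function_signed:
  assumes Rin: "Rin = rmat (cmat B) * rat_inv (rmat P) * rmat (cmat C)"
    and sym: "mat_reflect Rin = rconst e \<cdot>\<^sub>m Rout" and Rout: "Rout \<in> carrier_mat m m"
  shows "transfer_function (signed_pencil e A1 A0 B C R0) =
    to_fract (1 + zp) \<cdot>\<^sub>m (Rin + Rout + rmat (cmat R0))"
proof -
  let ?s = "to_fract (1 + zp)"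
  let ?V = "rat_inv (rmat P')" and ?U = "rat_inv (rmat P)"
  let ?X = "rconst e \<cdot>\<^sub>m rmat (zp \<cdot>\<^sub>m cmat (mat_adjoint C))" and ?Y = "?s \<cdot>\<^sub>m rmat (cmat B)"
  let ?G = "rconst e \<cdot>\<^sub>m (?s \<cdot>\<^sub>m rmat (cmat (mat_adjoint B)))"
  have "det (rmat P) \<noteq> 0" "det (rmat P') \<noteq> 0" using det_P det_P' by (simp_all add: det_rmat)
  hence U: "?U \<in> carrier_mat n n" and V: "?V \<in> carrier_mat n n"
    by (intro rat_inv_props; simp)+
  have rB: "rmat (cmat B) \<in> carrier_mat m n" and rC: "rmat (cmat C) \<in> carrier_mat n m"
    and rB': "rmat (cmat (mat_adjoint B)) \<in> carrier_mat n m"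
    and rC': "rmat (zp \<cdot>\<^sub>m cmat (mat_adjoint C)) \<in> carrier_mat m n"
    using B C by auto
  hence X: "?X \<in> carrier_mat m n" and Y: "?Y \<in> carrier_mat m n" and G: "?G \<in> carrier_mat n m"
    by simp_all
  have b21: "rmat (hcat ([:e:] \<cdot>\<^sub>m (zp \<cdot>\<^sub>m cmat (mat_adjoint C))) ((1 + zp) \<cdot>\<^sub>m cmat B)) = hcat ?X ?Y"
    using B C by (subst rmat_hcat[of _ m n _ n]) (auto simp only: rmat_smult intro!: smult_carrier_mat)
  have b12: "rmat (cmat C @\<^sub>r [:e:] \<cdot>\<^sub>m ((1 + zp) \<cdot>\<^sub>m cmat (mat_adjoint B))) = rmat (cmat C) @\<^sub>r ?G"
    using B C by (subst rmat_append_rows[of _ n m _ n]) (auto simp only: rmat_smult intro!: smult_carrier_mat)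
  have ee: "rconst e * rconst e = 1" by (simp only: rconst_mult[symmetric] e_simps rconst_1)
  have 1: "?Y * ?U * rmat (cmat C) = ?s \<cdot>\<^sub>m Rin"
    unfolding Rin mult_smult_assoc_mat[OF rB U] mult_smult_assoc_mat[OF mult_carrier_mat[OF rB U] rC] ..
  have "?X * ?V * ?G = rconst e \<cdot>\<^sub>m (rconst e \<cdot>\<^sub>m (?s \<cdot>\<^sub>m
      (rmat (zp \<cdot>\<^sub>m cmat (mat_adjoint C)) * ?V * rmat (cmat (mat_adjoint B)))))"
    unfolding mult_smult_assoc_mat[OF rC' V]
      mult_smult_assoc_mat[OF mult_carrier_mat[OF rC' V] smult_carrier_mat[OF smult_carrier_mat[OF rB']]]
      mult_smult_distrib[OF mult_carrier_mat[OF rC' V] smult_carrier_mat[OF rB']]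
      mult_smult_distrib[OF mult_carrier_mat[OF rC' V] rB'] ..
  also have "\<dots> = ?s \<cdot>\<^sub>m Rout"
    unfolding outer_realization[OF assms, symmetric] smult_smult_mat
    by (simp only: mult.assoc[symmetric] ee mult_1_left)
  finally have 2: "?X * ?V * ?G = ?s \<cdot>\<^sub>m Rout" .
  have "transfer_function (signed_pencil e A1 A0 B C R0) = ?s \<cdot>\<^sub>m rmat (cmat R0) +
      hcat ?X ?Y * four_block_mat (0\<^sub>m n n) ?V ?U (0\<^sub>m n n) * (rmat (cmat C) @\<^sub>r ?G)"
    unfolding transfer_function_def blocks antidiagonal_inverse(1) b21 b12 rmat_smult[of "1 + zp"] ..
  also have "\<dots> = ?s \<cdot>\<^sub>m rmat (cmat R0) + (?s \<cdot>\<^sub>m Rin + ?s \<cdot>\<^sub>m Rout)"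
    unfolding hcat_mult_antidiagonal[OF X Y V U]
      hcat_mult_append_rows[OF mult_carrier_mat[OF Y U] mult_carrier_mat[OF X V] rC G] 1 2 ..
  also have "\<dots> = ?s \<cdot>\<^sub>m (Rin + Rout + rmat (cmat R0))"
  proof -
    have "Rin \<in> carrier_mat m m" unfolding Rin using rB U rC by (intro mult_carrier_mat)
    thus ?thesis
      using Rout R0 by (intro eq_matI) (auto simp: algebra_simps simp del: to_fract_add)
  qed
  finally show ?thesis .
qed

section \<open>Palindromic symmetry of the full matrix\<close>

lemma full_mat_signed_carrier: "full_mat (signed_pencil e A1 A0 B C R0) \<in> carrier_mat (n + n + m) (n + n + m)"
  unfolding full_mat_def blocks using R0 by (intro four_block_carrier_mat) simp_all

lemma pencil_full_mat_signed: "pencil (full_mat (signed_pencil e A1 A0 B C R0))"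
  unfolding full_mat_def
  using linear_system_matrix_signed full_mat_signed_carrier B C R0 unfolding linear_system_matrix_def
  by (intro pencil_four_block[of _ _ _ _ "n + n" "n + n" m m])
    (auto simp: blocks intro!: carrier_append_rows hcat_carrier)

lemma b11_carrier: "b11 (signed_pencil e A1 A0 B C R0) \<in> carrier_mat (n + n) (n + n)"
  unfolding blocks by simp

lemma b11_index:
  assumes "i < n + n" "j < n + n"
  shows "b11 (signed_pencil e A1 A0 B C R0) $$ (i, j) =
    (if i < n then if j < n then 0 else [:A0 $$ (i, j - n), - A1 $$ (i, j - n):]
     else if j < n then [:- (e * cnj (A1 $$ (j, i - n))), e * cnj (A0 $$ (j, i - n)):] else 0)"
proof -
  have d: "dim_row A1 = n" "dim_col A1 = n" "dim_row A0 = n" "dim_col A0 = n" using A1 A0 by auto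
  show ?thesis
    using assms unfolding signed_pencil_def zp_cmat blocks.sel
    by (subst index_mat_four_block(1)) (auto simp: d cmat_def)
qed

lemma b12_index:
  assumes "i < n + n" "j < m"
  shows "b12 (signed_pencil e A1 A0 B C R0) $$ (i, j) =
    (if i < n then [:C $$ (i, j):] else [:e * cnj (B $$ (j, i - n)), e * cnj (B $$ (j, i - n)):])"
proof -
  have d: "dim_row C = n" "dim_col C = m" "dim_row B = m" "dim_col B = n" using B C by auto
  show ?thesis
    using assms unfolding signed_pencil_def one_plus_zp_cmat blocks.sel append_rows_def
    by (subst index_mat_four_block(1)) (auto simp: d cmat_def)
qed

lemma b21_index:
  assumes "i < m" "j < n + n"
  shows "b21 (signed_pencil e A1 A0 B C R0) $$ (i, j) =
    (if j < n then [:0, e * cnj (C $$ (j, i)):] else [:B $$ (i, j - n), B $$ (i, j - n):])"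
proof -
  have d: "dim_row C = n" "dim_col C = m" "dim_row B = m" "dim_col B = n" using B C by auto
  show ?thesis
    using assms unfolding signed_pencil_def one_plus_zp_cmat zp_cmat blocks.sel hcat_def
    by (subst index_mat_four_block(1)) (auto simp: d cmat_def)
qed

lemma b22_index:
  "i < m \<Longrightarrow> j < m \<Longrightarrow> b22 (signed_pencil e A1 A0 B C R0) $$ (i, j) = [:R0 $$ (i, j), R0 $$ (i, j):]"
  using R0 unfolding blocks one_plus_zp_cmat by simp

text \<open>By \<open>rev1_rat_star_pencil\<close> it remains to compare coefficients at mirrored
  positions of the nine blocks. The blocks match by the placement of e; the corner block needs the
  symmetry of \<open>R0\<close>.\<close>

lemma rev1_star_signed:
  "rev1 (rat_star (rmat (full_mat (signed_pencil e A1 A0 B C R0)))) =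
    rconst e \<cdot>\<^sub>m rmat (full_mat (signed_pencil e A1 A0 B C R0))"
proof (rule rev1_rat_star_pencil[OF full_mat_signed_carrier pencil_full_mat_signed])
  fix i j assume ij: "i < n + n + m" "j < n + n + m"
  have sym: "cnj (R0 $$ (j, i)) = e * R0 $$ (i, j)" if "i < m" "j < m" for i j
  proof -
    have "mat_adjoint R0 $$ (i, j) = (e \<cdot>\<^sub>m R0) $$ (i, j)" by (simp only: R0_sym)
    thus ?thesis using R0 that by simp
  qed
  have s: "cnj (R0 $$ (j - (n + n), i - (n + n))) = e * R0 $$ (i - (n + n), j - (n + n))"
    if "\<not> i < n + n" "\<not> j < n + n"
    using ij that by (intro sym) simp_all
  have e_cancel: "e * (e * x) = x" for x
    using e by auto
  \<comment> \<open>The implied inequality with n + n is listed as well, so that every condition of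
    the nested \<open>if\<close> formulas is decided by rewriting.\<close>
  have cases: "k < n \<and> k < n + n \<or> \<not> k < n \<and> k < n + n \<or> \<not> k < n \<and> \<not> k < n + n" for k
    by auto
  note index = b11_index b12_index b21_index b22_index
  define L where "L = full_mat (signed_pencil e A1 A0 B C R0)"
  have L: "L $$ (i, j) =
    (if i < n then
       if j < n then 0 else if j < n + n then [:A0 $$ (i, j - n), - A1 $$ (i, j - n):]
       else [:C $$ (i, j - (n + n)):]
     else if i < n + n then
       if j < n then [:- (e * cnj (A1 $$ (j, i - n))), e * cnj (A0 $$ (j, i - n)):]
       else if j < n + n then 0
       else [:e * cnj (B $$ (j - (n + n), i - n)), e * cnj (B $$ (j - (n + n), i - n)):]
     else if j < n then [:0, e * cnj (C $$ (j, i - (n + n))):]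
     else if j < n + n then [:B $$ (i - (n + n), j - n), B $$ (i - (n + n), j - n):]
     else [:R0 $$ (i - (n + n), j - (n + n)), R0 $$ (i - (n + n), j - (n + n)):])"
    if "i < n + n + m" "j < n + n + m" for i j
  proof -
    let ?S = "signed_pencil e A1 A0 B C R0"
    have "L $$ (i, j) =
        (if i < n + n then if j < n + n then b11 ?S $$ (i, j) else b12 ?S $$ (i, j - (n + n))
         else if j < n + n then b21 ?S $$ (i - (n + n), j) else b22 ?S $$ (i - (n + n), j - (n + n)))"
      using that R0 carrier_matD[OF b11_carrier] unfolding L_def full_mat_def
      by (subst index_mat_four_block(1)) (simp_all add: blocks(4))
    moreover have "i - (n + n) < m" if "\<not> i < n + n" using that \<open>i < n + n + m\<close> by simp
    moreover have "j - (n + n) < m" if "\<not> j < n + n" using that \<open>j < n + n + m\<close> by simp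
    ultimately show ?thesis
      using cases[of i] cases[of j] by (elim disjE conjE) (simp_all only: index if_True if_False simp_thms)
  qed
  show "[:cnj (coeff (full_mat (signed_pencil e A1 A0 B C R0) $$ (j, i)) 1),
      cnj (coeff (full_mat (signed_pencil e A1 A0 B C R0) $$ (j, i)) 0):] =
      [:e:] * full_mat (signed_pencil e A1 A0 B C R0) $$ (i, j)"
    unfolding L_def[symmetric] L[OF ij] L[OF ij(2,1)]
    using cases[of i] cases[of j] by (elim disjE conjE) (simp_all add: s e_simps e_cancel)
qed

end

section \<open>From minimal realizations to both cases of the claim\<close>

lemma disk_realization_of_minimal:
  assumes A1: "A1 \<in> carrier_mat n n" and A0: "A0 \<in> carrier_mat n n"
    and B: "B \<in> carrier_mat m n" and C: "C \<in> carrier_mat n m"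
    and min: "minimal_realization (cmat B) (zp \<cdot>\<^sub>m cmat A1 - cmat A0) (cmat C) Rin"
    and inv: "invertible_mat A1" and poles: "\<And>z. mat_pole Rin z \<Longrightarrow> cmod z < 1"
  shows "disk_realization n m A1 A0 B C"
proof -
  define P where "P = zp \<cdot>\<^sub>m cmat A1 - cmat A0"
  have P: "P \<in> carrier_mat n n" using A1 A0 unfolding P_def by (auto intro!: minus_carrier_mat)
  have eval_P: "eval_mat z P = z \<cdot>\<^sub>m A1 - A0" for z
    using A1 A0 by (intro eq_matI) (auto simp: P_def eval_mat_def cmat_def)
  have eval_uminus: "eval_mat z (- P) = (-1) \<cdot>\<^sub>m eval_mat z P" for z
    by (intro eq_matI) (auto simp: eval_mat_def)
  have Rin: "Rin = rmat (cmat B) * rat_inv (rmat P) * rmat (cmat C)" and det: "det P \<noteq> 0"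
    and row: "\<And>z. full_row_rank (hcat (eval_mat z (- P)) (eval_mat z (cmat C)))"
    and col: "\<And>z. full_col_rank (eval_mat z (- P) @\<^sub>r eval_mat z (cmat B))"
    using min unfolding minimal_realization_def Let_def linear_system_matrix_def minimal_system_def
    by (simp_all add: P_def det_uminus_eq_0_iff)
  have neg: "(-1) \<cdot>\<^sub>m eval_mat z P \<in> carrier_mat n n" for z using P by simp
  have ker_row: "v = 0\<^sub>v n" if v: "v \<in> carrier_vec n" "mat_adjoint (eval_mat z P) *\<^sub>v v = 0\<^sub>v n"
      "mat_adjoint C *\<^sub>v v = 0\<^sub>v m" for z v
  proof -
    have "mat_adjoint ((-1) \<cdot>\<^sub>m eval_mat z P) *\<^sub>v v = 0\<^sub>v n"
      unfolding mat_adjoint_smult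
      by (subst smult_mat_vec_eq_0_iff[OF mat_adjoint_carrier[OF eval_mat_carrier[OF P]] v(1)])
        (use v(2) in simp_all)
    thus ?thesis
      using row[of z] v unfolding eval_uminus eval_mat_cmat full_row_rank_hcat_iff[OF neg C] by blast
  qed
  have ker_col: "v = 0\<^sub>v n" if v: "v \<in> carrier_vec n" "eval_mat z P *\<^sub>v v = 0\<^sub>v n"
      "B *\<^sub>v v = 0\<^sub>v m" for z v
  proof -
    have "((-1) \<cdot>\<^sub>m eval_mat z P) *\<^sub>v v = 0\<^sub>v n"
      by (subst smult_mat_vec_eq_0_iff[OF eval_mat_carrier[OF P] v(1)]) (use v(2) in simp_all)
    thus ?thesis
      using col[of z] v unfolding eval_uminus eval_mat_cmat full_col_rank_append_rows_iff[OF neg B] by blast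
  qed
  obtain A1i where "inverts_mat A1 A1i" "inverts_mat A1i A1" using inv unfolding invertible_mat_def by blast
  hence A1i: "A1 * A1i = 1\<^sub>m n" "A1i * A1 = 1\<^sub>m (dim_row A1i)" using A1 unfolding inverts_mat_def by auto
  have "dim_col A1i = n" using arg_cong[OF A1i(1), of dim_col] by simp
  moreover have "dim_row A1i = n" using arg_cong[OF A1i(2), of dim_col] A1 by simp
  ultimately have "A1i \<in> carrier_mat n n" by (intro carrier_matI)
  hence "det A1 * det A1i = 1" using det_mult[OF A1, of A1i] A1i(1) by simp
  hence det_A1: "det A1 \<noteq> 0" by auto
  show ?thesis
  proof
    fix z :: complex assume "1 \<le> cmod z"
    \<comment> \<open>Poles of \<open>Rin\<close> lie in the open disk; elsewhere minimality turns
      regularity of \<open>Rin\<close> into invertibility of the pencil.\<close>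
    hence "\<not> mat_pole Rin z" using poles[of z] by auto
    thus "det (z \<cdot>\<^sub>m A1 - A0) \<noteq> 0"
      using invertible_at_regular_point[OF P cmat_carrier[OF B] cmat_carrier[OF C] det, of z] ker_row ker_col
      unfolding Rin eval_mat_cmat eval_P by blast
  qed (use A1 A0 B C det_A1 ker_row[unfolded eval_P] ker_col[unfolded eval_P] in blast)+
qed

text \<open>The common core of both cases. The realization is quantified only in the last
  conclusion, since the symmetry of the decomposition does not depend on it.\<close>

lemma signed_palindromic_linearization:
  assumes R: "R \<in> carrier_mat m m" and sym: "rat_star R = rconst e \<cdot>\<^sub>m rat_recip R"
    and e: "e = 1 \<or> e = -1" and dec: "in_out_decomposition R Rin Rout R0"
  shows "rat_star Rin = rconst e \<cdot>\<^sub>m rat_recip Rout" "mat_adjoint R0 = e \<cdot>\<^sub>m R0"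
    and "\<And>n A1 A0 B C. A1 \<in> carrier_mat n n \<Longrightarrow> A0 \<in> carrier_mat n n \<Longrightarrow>
      B \<in> carrier_mat m n \<Longrightarrow> C \<in> carrier_mat n m \<Longrightarrow>
      minimal_realization (cmat B) (zp \<cdot>\<^sub>m cmat A1 - cmat A0) (cmat C) Rin \<Longrightarrow> invertible_mat A1 \<Longrightarrow>
      minimal_realization (zp \<cdot>\<^sub>m cmat (mat_adjoint C))
        ([:- e:] \<cdot>\<^sub>m (zp \<cdot>\<^sub>m cmat (mat_adjoint A0) - cmat (mat_adjoint A1))) (cmat (mat_adjoint B)) Rout \<and>
      strongly_minimal_linearization (signed_pencil e A1 A0 B C R0) (to_fract (1 + zp) \<cdot>\<^sub>m R) \<and>
      pencil (full_mat (signed_pencil e A1 A0 B C R0)) \<and>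
      square_mat (full_mat (signed_pencil e A1 A0 B C R0)) \<and>
      rev1 (rat_star (rmat (full_mat (signed_pencil e A1 A0 B C R0)))) =
        rconst e \<cdot>\<^sub>m rmat (full_mat (signed_pencil e A1 A0 B C R0))"
proof -
  have recip_smult: "rat_recip (rconst e \<cdot>\<^sub>m X) = rconst e \<cdot>\<^sub>m rat_recip X" for X
    by (intro eq_matI) (simp_all add: rat_recip_def rf_recip.hom_mult)
  \<comment> \<open>Applying \<open>rat_recip\<close> to both sides of the hypothesis moves the
    substitution to the left, where it joins the conjugate transpose.\<close>
  have "mat_reflect R = rconst e \<cdot>\<^sub>m R"
    unfolding rat_recip_star[symmetric] sym recip_smult rat_recip_recip ..
  note refl = in_out_reflect[OF R this dec]
  note dec' = dec[unfolded in_out_decomposition_def carrier_matD[OF R]]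
  show "rat_star Rin = rconst e \<cdot>\<^sub>m rat_recip Rout"
    using arg_cong[OF refl(1), of rat_recip]
    unfolding rat_recip_star[symmetric] recip_smult rat_recip_recip .
  show "mat_adjoint R0 = e \<cdot>\<^sub>m R0" by (rule refl(3))
  fix n A1 A0 B C
  assume A: "A1 \<in> carrier_mat n n" "A0 \<in> carrier_mat n n" "B \<in> carrier_mat m n" "C \<in> carrier_mat n m"
    and min: "minimal_realization (cmat B) (zp \<cdot>\<^sub>m cmat A1 - cmat A0) (cmat C) Rin"
    and inv: "invertible_mat A1"
  interpret signed_realization n m A1 A0 B C e R0
  proof (intro signed_realization.intro signed_realization_axioms.intro)
    show "disk_realization n m A1 A0 B C"
      using dec' by (intro disk_realization_of_minimal[OF A min inv]) blast
    show "R0 \<in> carrier_mat m m" using dec' by blast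
  qed (fact e refl(3))+
  have Rin: "Rin = rmat (cmat B) * rat_inv (rmat P) * rmat (cmat C)"
    using min unfolding minimal_realization_def P_def by blast
  have Rout: "Rout \<in> carrier_mat m m" using dec' by blast
  have "R = Rin + Rout + rmat (cmat R0)" using dec' by blast
  hence "strongly_minimal_linearization (signed_pencil e A1 A0 B C R0) (to_fract (1 + zp) \<cdot>\<^sub>m R)"
    using transfer_function_signed[OF Rin refl(1) Rout] linear_system_matrix_signed minimal_system_signed
      minimal_at_infinity_signed unfolding strongly_minimal_linearization_def by simp
  moreover have "square_mat (full_mat (signed_pencil e A1 A0 B C R0))"
    using full_mat_signed_carrier by simp
  ultimately show "minimal_realization (zp \<cdot>\<^sub>m cmat (mat_adjoint C))
        ([:- e:] \<cdot>\<^sub>m (zp \<cdot>\<^sub>m cmat (mat_adjoint A0) - cmat (mat_adjoint A1))) (cmat (mat_adjoint B)) Rout \<and>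
      strongly_minimal_linearization (signed_pencil e A1 A0 B C R0) (to_fract (1 + zp) \<cdot>\<^sub>m R) \<and>
      pencil (full_mat (signed_pencil e A1 A0 B C R0)) \<and>
      square_mat (full_mat (signed_pencil e A1 A0 B C R0)) \<and>
      rev1 (rat_star (rmat (full_mat (signed_pencil e A1 A0 B C R0)))) =
        rconst e \<cdot>\<^sub>m rmat (full_mat (signed_pencil e A1 A0 B C R0))"
    using minimal_outer_realization[OF Rin refl(1) Rout, unfolded P'_def] pencil_full_mat_signed
      rev1_star_signed by blast
qed

lemma rconst_1_smult_mat: "rconst 1 \<cdot>\<^sub>m X = X"
  unfolding rconst_1 by (intro eq_matI) simp_all

lemma rconst_minus_1_smult_mat: "rconst (-1) \<cdot>\<^sub>m X = - X"
  unfolding rconst_uminus rconst_1 by (intro eq_matI) simp_all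

lemma one_smult_cmat: "(1 :: complex) \<cdot>\<^sub>m X = X"
  by (intro eq_matI) simp_all

lemma minus_one_smult_cmat: "(-1 :: complex) \<cdot>\<^sub>m X = - X"
  by (intro eq_matI) simp_all

lemma palindromic_linearization:
  assumes R: "R \<in> carrier_mat m m" and herm: "para_hermitian R"
    and dec: "in_out_decomposition R Rin Rout R0"
  shows "rat_star Rin = rat_recip Rout" "mat_adjoint R0 = R0"
    and "\<And>n A1 A0 B C. A1 \<in> carrier_mat n n \<Longrightarrow> A0 \<in> carrier_mat n n \<Longrightarrow>
      B \<in> carrier_mat m n \<Longrightarrow> C \<in> carrier_mat n m \<Longrightarrow>
      minimal_realization (cmat B) (zp \<cdot>\<^sub>m cmat A1 - cmat A0) (cmat C) Rin \<Longrightarrow> invertible_mat A1 \<Longrightarrow>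
      minimal_realization (zp \<cdot>\<^sub>m cmat (mat_adjoint C))
        (cmat (mat_adjoint A1) - zp \<cdot>\<^sub>m cmat (mat_adjoint A0)) (cmat (mat_adjoint B)) Rout \<and>
      strongly_minimal_linearization (palindromic_pencil A1 A0 B C R0) (to_fract (1 + zp) \<cdot>\<^sub>m R) \<and>
      star_palindromic (full_mat (palindromic_pencil A1 A0 B C R0))"
proof -
  have sym: "rat_star R = rconst 1 \<cdot>\<^sub>m rat_recip R"
    using herm unfolding para_hermitian_def rconst_1_smult_mat by blast
  note main = signed_palindromic_linearization[OF R sym disjI1[OF refl] dec,
      unfolded rconst_1_smult_mat one_smult_cmat]
  show "rat_star Rin = rat_recip Rout" "mat_adjoint R0 = R0" by (rule main)+
  fix n A1 A0 B C
  assume A: "A1 \<in> carrier_mat n n" "A0 \<in> carrier_mat n n" "B \<in> carrier_mat m n" "C \<in> carrier_mat n m"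
    "minimal_realization (cmat B) (zp \<cdot>\<^sub>m cmat A1 - cmat A0) (cmat C) Rin" "invertible_mat A1"
  have outer: "[:- 1:] \<cdot>\<^sub>m (zp \<cdot>\<^sub>m cmat (mat_adjoint A0) - cmat (mat_adjoint A1)) =
      cmat (mat_adjoint A1) - zp \<cdot>\<^sub>m cmat (mat_adjoint A0)"
    unfolding minus_one_smult_mat using A(1,2) by (intro eq_matI) auto
  show "minimal_realization (zp \<cdot>\<^sub>m cmat (mat_adjoint C))
      (cmat (mat_adjoint A1) - zp \<cdot>\<^sub>m cmat (mat_adjoint A0)) (cmat (mat_adjoint B)) Rout \<and>
    strongly_minimal_linearization (palindromic_pencil A1 A0 B C R0) (to_fract (1 + zp) \<cdot>\<^sub>m R) \<and>
    star_palindromic (full_mat (palindromic_pencil A1 A0 B C R0))"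
    unfolding palindromic_pencil_eq star_palindromic_def
    using main(3)[OF A] unfolding outer by (simp only: simp_thms)
qed

lemma anti_palindromic_linearization:
  assumes R: "R \<in> carrier_mat m m" and herm: "para_skew_hermitian R"
    and dec: "in_out_decomposition R Rin Rout R0"
  shows "rat_star Rin = - rat_recip Rout" "mat_adjoint R0 = - R0"
    and "\<And>n A1 A0 B C. A1 \<in> carrier_mat n n \<Longrightarrow> A0 \<in> carrier_mat n n \<Longrightarrow>
      B \<in> carrier_mat m n \<Longrightarrow> C \<in> carrier_mat n m \<Longrightarrow>
      minimal_realization (cmat B) (zp \<cdot>\<^sub>m cmat A1 - cmat A0) (cmat C) Rin \<Longrightarrow> invertible_mat A1 \<Longrightarrow>
      minimal_realization (zp \<cdot>\<^sub>m cmat (mat_adjoint C))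
        (zp \<cdot>\<^sub>m cmat (mat_adjoint A0) - cmat (mat_adjoint A1)) (cmat (mat_adjoint B)) Rout \<and>
      strongly_minimal_linearization (anti_palindromic_pencil A1 A0 B C R0) (to_fract (1 + zp) \<cdot>\<^sub>m R) \<and>
      star_anti_palindromic (full_mat (anti_palindromic_pencil A1 A0 B C R0))"
proof -
  have sym: "rat_star R = rconst (-1) \<cdot>\<^sub>m rat_recip R"
    using herm unfolding para_skew_hermitian_def rconst_minus_1_smult_mat by blast
  note main = signed_palindromic_linearization[OF R sym disjI2[OF refl] dec,
      unfolded rconst_minus_1_smult_mat minus_one_smult_cmat minus_minus one_smult_mat]
  show "rat_star Rin = - rat_recip Rout" "mat_adjoint R0 = - R0" by (rule main)+
  fix n A1 A0 B C
  assume A: "A1 \<in> carrier_mat n n" "A0 \<in> carrier_mat n n" "B \<in> carrier_mat m n" "C \<in> carrier_mat n m"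
    "minimal_realization (cmat B) (zp \<cdot>\<^sub>m cmat A1 - cmat A0) (cmat C) Rin" "invertible_mat A1"
  show "minimal_realization (zp \<cdot>\<^sub>m cmat (mat_adjoint C))
      (zp \<cdot>\<^sub>m cmat (mat_adjoint A0) - cmat (mat_adjoint A1)) (cmat (mat_adjoint B)) Rout \<and>
    strongly_minimal_linearization (anti_palindromic_pencil A1 A0 B C R0) (to_fract (1 + zp) \<cdot>\<^sub>m R) \<and>
    star_anti_palindromic (full_mat (anti_palindromic_pencil A1 A0 B C R0))"
    unfolding anti_palindromic_pencil_eq[OF A(1,2)] star_anti_palindromic_def
    using main(3)[OF A] by (simp only: simp_thms)
qed

theorem theorem5p2:
  fixes R :: "rat_fun mat" and m :: nat
  assumes "R \<in> carrier_mat m m"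
    and "\<forall>z. cmod z = 1 \<longrightarrow> \<not> mat_pole R z"
  shows
    "(para_hermitian R \<longrightarrow>
        (\<exists>!d. case d of (Rin, Rout, R0) \<Rightarrow> in_out_decomposition R Rin Rout R0) \<and>
        (\<forall>Rin Rout R0. in_out_decomposition R Rin Rout R0 \<longrightarrow>
           rat_star Rin = rat_recip Rout \<and> mat_adjoint R0 = R0 \<and>
           (\<forall>n A1 A0 B C.
              A1 \<in> carrier_mat n n \<and> A0 \<in> carrier_mat n n \<and>
              B \<in> carrier_mat m n \<and> C \<in> carrier_mat n m \<and>
              minimal_realization (cmat B) (zp \<cdot>\<^sub>m cmat A1 - cmat A0) (cmat C) Rin \<and>
              invertible_mat A1 \<longrightarrow>
              minimal_realization (zp \<cdot>\<^sub>m cmat (mat_adjoint C))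
                (cmat (mat_adjoint A1) - zp \<cdot>\<^sub>m cmat (mat_adjoint A0))
                (cmat (mat_adjoint B)) Rout \<and>
              strongly_minimal_linearization (palindromic_pencil A1 A0 B C R0)
                (to_fract (1 + zp) \<cdot>\<^sub>m R) \<and>
              star_palindromic (full_mat (palindromic_pencil A1 A0 B C R0))))) \<and>
     (para_skew_hermitian R \<longrightarrow>
        (\<exists>!d. case d of (Rin, Rout, R0) \<Rightarrow> in_out_decomposition R Rin Rout R0) \<and>
        (\<forall>Rin Rout R0. in_out_decomposition R Rin Rout R0 \<longrightarrow>
           rat_star Rin = - rat_recip Rout \<and> mat_adjoint R0 = - R0 \<and>
           (\<forall>n A1 A0 B C.
              A1 \<in> carrier_mat n n \<and> A0 \<in> carrier_mat n n \<and>
              B \<in> carrier_mat m n \<and> C \<in> carrier_mat n m \<and>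
              minimal_realization (cmat B) (zp \<cdot>\<^sub>m cmat A1 - cmat A0) (cmat C) Rin \<and>
              invertible_mat A1 \<longrightarrow>
              minimal_realization (zp \<cdot>\<^sub>m cmat (mat_adjoint C))
                (zp \<cdot>\<^sub>m cmat (mat_adjoint A0) - cmat (mat_adjoint A1))
                (cmat (mat_adjoint B)) Rout \<and>
              strongly_minimal_linearization (anti_palindromic_pencil A1 A0 B C R0)
                (to_fract (1 + zp) \<cdot>\<^sub>m R) \<and>
              star_anti_palindromic (full_mat (anti_palindromic_pencil A1 A0 B C R0)))))"
proof (intro conjI impI allI in_out_decomposition_ex1[OF assms]; (elim conjE)?)
  fix Rin Rout R0
  assume "para_hermitian R" "in_out_decomposition R Rin Rout R0"
  note * = palindromic_linearization[OF assms(1) this]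
  show "rat_star Rin = rat_recip Rout" "mat_adjoint R0 = R0" by (rule *)+
  fix n A1 A0 B C
  assume "A1 \<in> carrier_mat n n" "A0 \<in> carrier_mat n n" "B \<in> carrier_mat m n" "C \<in> carrier_mat n m"
    "minimal_realization (cmat B) (zp \<cdot>\<^sub>m cmat A1 - cmat A0) (cmat C) Rin" "invertible_mat A1"
  from *(3)[OF this]
  show "minimal_realization (zp \<cdot>\<^sub>m cmat (mat_adjoint C))
      (cmat (mat_adjoint A1) - zp \<cdot>\<^sub>m cmat (mat_adjoint A0)) (cmat (mat_adjoint B)) Rout"
    "strongly_minimal_linearization (palindromic_pencil A1 A0 B C R0) (to_fract (1 + zp) \<cdot>\<^sub>m R)"
    "star_palindromic (full_mat (palindromic_pencil A1 A0 B C R0))"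
    by blast+
next
  fix Rin Rout R0
  assume "para_skew_hermitian R" "in_out_decomposition R Rin Rout R0"
  note * = anti_palindromic_linearization[OF assms(1) this]
  show "rat_star Rin = - rat_recip Rout" "mat_adjoint R0 = - R0" by (rule *)+
  fix n A1 A0 B C
  assume "A1 \<in> carrier_mat n n" "A0 \<in> carrier_mat n n" "B \<in> carrier_mat m n" "C \<in> carrier_mat n m"
    "minimal_realization (cmat B) (zp \<cdot>\<^sub>m cmat A1 - cmat A0) (cmat C) Rin" "invertible_mat A1"
  from *(3)[OF this]
  show "minimal_realization (zp \<cdot>\<^sub>m cmat (mat_adjoint C))
      (zp \<cdot>\<^sub>m cmat (mat_adjoint A0) - cmat (mat_adjoint A1)) (cmat (mat_adjoint B)) Rout"
    "strongly_minimal_linearization (anti_palindromic_pencil A1 A0 B C R0) (to_fract (1 + zp) \<cdot>\<^sub>m R)"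
    "star_anti_palindromic (full_mat (anti_palindromic_pencil A1 A0 B C R0))"
    by blast+
qed

end
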